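(* Let $d \geq 1$ and let $S \subset \mathbb{R}^d$ be nonempty, open and periodic. Then for every $T > 0$ the controlled Schrödinger equation \[ \begin{cases} i \frac{\mathrm{d}}{\mathrm{d} t} u + \Delta u = \mathbf{1}_S f & \text{in } \mathbb{R}^d \times [0,T],\\ u(0) = u_0 \in L^2(\mathbb{R}^d) \end{cases} \] is controllable in time $T$: for all $u_0, u_T \in L^2(\mathbb{R}^d)$ there exists $f \in L^2(S \times (0,T))$ such that the solution \[ u(t) = \mathrm{e}^{i t \Delta} u_0 + \int_0^t \mathrm{e}^{i (t-s)\Delta} \mathbf{1}_S f(s)\, \mathrm{d} s \] satisfies $u(T) = u_T$.
   Context: $\mathbf{1}_S$ denotes the indicator function of $S$, $\Delta$ the (self-adjoint) Laplacian on $L^2(\mathbb{R}^d)$, and $(\mathrm{e}^{i t \Delta})_{t\in\mathbb{R}}$ the free Schrödinger group. A set $S \subset \mathbb{R}^d$ is periodic if it is invariant under translations by all vectors of some lattice (discrete cocompact subgroup) of $\mathbb{R}^d$. *)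

theory Defs
  imports "HOL-Analysis.Analysis"
begin

definition is_lattice :: "'a::euclidean_space set \<Rightarrow> bool" where
  "is_lattice L \<longleftrightarrow>
     0 \<in> L \<and> (\<forall>x\<in>L. \<forall>y\<in>L. x - y \<in> L) \<and>
     (\<forall>x\<in>L. \<exists>e>0. \<forall>y\<in>L. y \<noteq> x \<longrightarrow> e \<le> dist y x) \<and>
     (\<exists>K. compact K \<and> (\<forall>z. \<exists>k\<in>K. \<exists>l\<in>L. z = k + l))"

definition periodic_set :: "'a::euclidean_space set \<Rightarrow> bool" where
  "periodic_set S \<longleftrightarrow> (\<exists>L. is_lattice L \<and> (\<forall>v\<in>L. (\<lambda>x. v + x) ` S = S))"

definition L2 :: "('a::euclidean_space \<Rightarrow> complex) \<Rightarrow> bool" where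
  "L2 u \<longleftrightarrow> u \<in> borel_measurable lborel \<and> integrable lborel (\<lambda>x. (cmod (u x))\<^sup>2)"

definition l2_inner :: "('a::euclidean_space \<Rightarrow> complex) \<Rightarrow> ('a \<Rightarrow> complex) \<Rightarrow> complex" where
  "l2_inner g h = (\<integral>x. g x * cnj (h x) \<partial>lborel)"

definition fourier :: "('a::euclidean_space \<Rightarrow> complex) \<Rightarrow> 'a \<Rightarrow> complex" where
  "fourier \<psi> \<xi> = (\<integral>x. exp (- \<i> * complex_of_real (x \<bullet> \<xi>)) * \<psi> x \<partial>lborel)"

(* dense class of test functions on which the free Schroedinger group is given by
   the Fourier integral: psi in L^1 \<inter> L^2 with integrable Fourier transform *)
definition schr_test :: "('a::euclidean_space \<Rightarrow> complex) \<Rightarrow> bool" where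
  "schr_test \<psi> \<longleftrightarrow> integrable lborel \<psi> \<and> L2 \<psi> \<and> integrable lborel (fourier \<psi>)"

(* e^{it\<Delta>} psi = F^{-1}( e^{-it|xi|^2} F psi ) for test functions *)
definition schr_free :: "real \<Rightarrow> ('a::euclidean_space \<Rightarrow> complex) \<Rightarrow> 'a \<Rightarrow> complex" where
  "schr_free t \<psi> x =
     complex_of_real ((2 * pi) powr (- real DIM('a))) *
     (\<integral>\<xi>. exp (\<i> * complex_of_real (x \<bullet> \<xi> - t * (norm \<xi>)\<^sup>2)) * fourier \<psi> \<xi> \<partial>lborel)"

definition L2_control :: "'a::euclidean_space set \<Rightarrow> real \<Rightarrow> ('a \<times> real \<Rightarrow> complex) \<Rightarrow> bool" where
  "L2_control S T f \<longleftrightarrow> f \<in> borel_measurable (lborel \<Otimes>\<^sub>M lborel) \<and>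
     integrable (lborel \<Otimes>\<^sub>M lborel)
       (\<lambda>p. indicator (S \<times> {0<..<T}) p * (cmod (f p))\<^sup>2)"

(* g equals u(T) = e^{iT\<Delta>} u0 + \<integral>_0^T e^{i(T-s)\<Delta>} 1_S f(s) ds, as an element of L^2,
   characterised by its L^2 pairing with the dense class of test functions
   (using (e^{it\<Delta>})^* = e^{-it\<Delta>}). *)
definition schr_solution_at ::
  "real \<Rightarrow> ('a::euclidean_space \<Rightarrow> complex) \<Rightarrow> 'a set \<Rightarrow> ('a \<times> real \<Rightarrow> complex) \<Rightarrow> ('a \<Rightarrow> complex) \<Rightarrow> bool" where
  "schr_solution_at T u0 S f g \<longleftrightarrow> L2 g \<and>
     (\<forall>\<psi>. schr_test \<psi> \<longrightarrow>
        l2_inner g \<psi> =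
          l2_inner u0 (schr_free (- T) \<psi>) +
          (\<integral>s. l2_inner (\<lambda>x. indicator S x * f (x, s)) (schr_free (s - T) \<psi>)
               \<partial>(restrict_space lborel {0<..<T})))"

end

theory Submission
  imports Defs "HOL-Probability.Probability"
begin

text \<open>By duality the claim reduces to an observability estimate: the \<open>L\<^sup>2\<close> norm of a free solution is bounded
  by its \<open>L\<^sup>2\<close> norm over \<open>S \<times> (0,T)\<close>. For exponential sums with frequencies \<open>(m, -|m|\<^sup>2)\<close>, \<open>m\<close> in a coset of the
  dual lattice, every single coefficient is bounded by the \<open>L\<^sup>2\<close> norm of the sum over an arbitrarily small
  space-time ball, uniformly in the coset and in the (finite) number of terms. This follows Kahane and
  Jaffard: one constructs functionals supported in a small ball that take the value 1 at one frequency and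
  vanish at the others, by a Neumann series where the frequencies are well separated and by induction on the
  codimension of the resonant directions elsewhere, combining finitely many pieces by products.

  To pass to the whole space without a Floquet--Bloch decomposition, multiply a solution \<open>u\<close> by the \<open>n\<close>-th
  power of a trigonometric polynomial that peaks at the lattice points. On the Fourier side this superposes
  finitely many shifts of the symbol of \<open>u\<close>, so the coefficient bound at each frequency, integrated over all
  frequencies, and Plancherel's theorem give the estimate up to an error that decays geometrically
  in \<open>n\<close>, while the loss in the constant is polynomial in \<open>n\<close>.\<close>

section \<open>Functionals on trigonometric polynomials\<close>

text \<open>A small ball separates lattice frequencies neither in space nor in time alone.
  Summability of a spatial kernel leaves finitely many relevant differences \<open>h\<close>; for
  these, the time frequencies differ by \<open>2 * (m \<bullet> h) + (norm h)\<^sup>2\<close>, which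
  is small on a whole slab of \<open>m\<close>. No uniform gap exists, but each slab fixes one more
  direction up to a bounded error, hence the induction on codimension. Uniformity in the coset is
  essential: the coset used is \<open>\<xi> + \<Gamma>\<close>, and the bound is integrated over all
  \<open>\<xi>\<close>. A power of a trigonometric polynomial serves as cutoff because its
  frequencies are finitely many and lie in \<open>\<Gamma>\<close>, so the localised solution
  consists of finite sums over one coset. Its coefficients are nonnegative, number
  \<open>(n + 1) ^ d\<close> and sum to 1; the largest is at least the average, which is the
  polynomial loss. All estimates are made for test functions: their Fourier transforms are
  integrable, continuous and bounded, so every integral converges absolutely. The control then
  represents a functional on the range of the observation map, which need not be closed.\<close>

text \<open>\<open>F\<close> is the Fourier transform of a functional of norm at most \<open>C\<close> that is supported in the ball of
  radius \<open>\<epsilon>\<close>; testing it on finite exponential sums avoids measures and distributions.\<close>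

definition trig_dual :: "real \<Rightarrow> real \<Rightarrow> ('b::real_inner \<Rightarrow> complex) \<Rightarrow> bool" where
  "trig_dual \<epsilon> C F \<longleftrightarrow> 0 \<le> \<epsilon> \<and> 0 \<le> C \<and>
     (\<forall>\<Lambda> a M. finite \<Lambda> \<longrightarrow> (\<forall>y. norm y \<le> \<epsilon> \<longrightarrow> cmod (\<Sum>l\<in>\<Lambda>. a l * cis (l \<bullet> y)) \<le> M) \<longrightarrow>
        cmod (\<Sum>l\<in>\<Lambda>. a l * F l) \<le> C * M)"

lemma trig_dualD:
  assumes "trig_dual \<epsilon> C F" "finite \<Lambda>"
    "\<And>y. norm y \<le> \<epsilon> \<Longrightarrow> cmod (\<Sum>l\<in>\<Lambda>. a l * cis (l \<bullet> y)) \<le> M"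
  shows "cmod (\<Sum>l\<in>\<Lambda>. a l * F l) \<le> C * M"
  using assms unfolding trig_dual_def by blast

text \<open>The point \<open>y = 0\<close> lies in the ball, so every admissible \<open>M\<close>
  bounds a norm. This supplies \<open>0 \<le> M\<close> as an extra premise.\<close>

lemma trig_dualI:
  assumes "0 \<le> \<epsilon>" "0 \<le> C"
    "\<And>\<Lambda> a M. finite \<Lambda> \<Longrightarrow> 0 \<le> M \<Longrightarrow>
       (\<And>y. norm y \<le> \<epsilon> \<Longrightarrow> cmod (\<Sum>l\<in>\<Lambda>. a l * cis (l \<bullet> y)) \<le> M) \<Longrightarrow>
       cmod (\<Sum>l\<in>\<Lambda>. a l * F l) \<le> C * M"
  shows "trig_dual \<epsilon> C F"
  unfolding trig_dual_def
proof (intro conjI allI impI)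
  fix \<Lambda> :: "'a set" and a M
  assume f: "finite \<Lambda>" and b: "\<forall>y. norm y \<le> \<epsilon> \<longrightarrow> cmod (\<Sum>l\<in>\<Lambda>. a l * cis (l \<bullet> y)) \<le> M"
  have "cmod (\<Sum>l\<in>\<Lambda>. a l * cis (l \<bullet> 0)) \<le> M" using b assms(1) by (metis norm_zero)
  then have "0 \<le> M" using norm_ge_zero order_trans by blast
  then show "cmod (\<Sum>l\<in>\<Lambda>. a l * F l) \<le> C * M" using assms(3)[OF f] b by blast
qed (use assms in auto)

lemma trig_dual_mono:
  assumes "trig_dual \<epsilon> C F" "\<epsilon> \<le> \<epsilon>'" "C \<le> C'"
  shows "trig_dual \<epsilon>' C' F"
proof (rule trig_dualI)
  fix \<Lambda> :: "'a set" and a M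
  assume f: "finite \<Lambda>" "0 \<le> M" and b: "\<And>y. norm y \<le> \<epsilon>' \<Longrightarrow> cmod (\<Sum>l\<in>\<Lambda>. a l * cis (l \<bullet> y)) \<le> M"
  have "cmod (\<Sum>l\<in>\<Lambda>. a l * F l) \<le> C * M"
    by (rule trig_dualD[OF assms(1) f(1)]) (use b assms(2) in auto)
  also have "\<dots> \<le> C' * M" using f assms(3) by (simp add: mult_right_mono)
  finally show "cmod (\<Sum>l\<in>\<Lambda>. a l * F l) \<le> C' * M" .
qed (use assms in \<open>auto simp: trig_dual_def\<close>)

text \<open>Products of transforms correspond to convolutions of functionals: radii of support add
  and norms multiply. A translation by \<open>x\<close> is absorbed into the coefficients before
  \<open>G\<close> is applied; \<open>F\<close> then acts in \<open>x\<close>.\<close>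

lemma trig_dual_mult:
  assumes F: "trig_dual \<epsilon>1 C1 F" and G: "trig_dual \<epsilon>2 C2 G"
  shows "trig_dual (\<epsilon>1 + \<epsilon>2) (C1 * C2) (\<lambda>l. F l * G l)"
proof (rule trig_dualI)
  fix \<Lambda> :: "'a set" and a M
  assume f: "finite \<Lambda>" "0 \<le> M"
    and b: "\<And>y. norm y \<le> \<epsilon>1 + \<epsilon>2 \<Longrightarrow> cmod (\<Sum>l\<in>\<Lambda>. a l * cis (l \<bullet> y)) \<le> M"
  have 1: "cmod (\<Sum>l\<in>\<Lambda>. (a l * G l) * cis (l \<bullet> x)) \<le> C2 * M" if x: "norm x \<le> \<epsilon>1" for x
  proof -
    have "cmod (\<Sum>l\<in>\<Lambda>. (a l * cis (l \<bullet> x)) * G l) \<le> C2 * M"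
    proof (rule trig_dualD[OF G f(1)])
      fix y :: 'a assume "norm y \<le> \<epsilon>2"
      then have "norm (x + y) \<le> \<epsilon>1 + \<epsilon>2" using x norm_triangle_ineq[of x y] by linarith
      from b[OF this] show "cmod (\<Sum>l\<in>\<Lambda>. a l * cis (l \<bullet> x) * cis (l \<bullet> y)) \<le> M"
        by (simp add: inner_add_right mult.assoc cis_mult)
    qed
    then show ?thesis by (simp add: mult_ac)
  qed
  have "cmod (\<Sum>l\<in>\<Lambda>. (a l * G l) * F l) \<le> C1 * (C2 * M)"
    by (rule trig_dualD[OF F f(1)]) (use 1 in auto)
  then show "cmod (\<Sum>l\<in>\<Lambda>. a l * (F l * G l)) \<le> C1 * C2 * M"
    by (simp add: mult_ac)
qed (use F G in \<open>auto simp: trig_dual_def\<close>)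

lemma trig_dual_one: "0 \<le> \<epsilon> \<Longrightarrow> trig_dual \<epsilon> 1 (\<lambda>l. 1)"
proof (rule trig_dualI)
  fix \<Lambda> :: "'a set" and a M
  assume e: "0 \<le> \<epsilon>" and b: "\<And>y. norm y \<le> \<epsilon> \<Longrightarrow> cmod (\<Sum>l\<in>\<Lambda>. a l * cis (l \<bullet> y)) \<le> M"
  show "cmod (\<Sum>l\<in>\<Lambda>. a l * 1) \<le> 1 * M" using b[of 0] e by simp
qed auto

lemma trig_dual_zero: "0 \<le> \<epsilon> \<Longrightarrow> trig_dual \<epsilon> 0 (\<lambda>l. 0)"
  by (rule trig_dualI) auto

lemma trig_dual_add:
  assumes "trig_dual \<epsilon> C1 F" "trig_dual \<epsilon> C2 G"
  shows "trig_dual \<epsilon> (C1 + C2) (\<lambda>l. F l + G l)"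
proof (rule trig_dualI)
  fix \<Lambda> :: "'a set" and a M
  assume f: "finite \<Lambda>" "0 \<le> M" and b: "\<And>y. norm y \<le> \<epsilon> \<Longrightarrow> cmod (\<Sum>l\<in>\<Lambda>. a l * cis (l \<bullet> y)) \<le> M"
  have "cmod (\<Sum>l\<in>\<Lambda>. a l * F l) \<le> C1 * M" "cmod (\<Sum>l\<in>\<Lambda>. a l * G l) \<le> C2 * M"
    by (rule trig_dualD[OF assms(1) f(1) b] trig_dualD[OF assms(2) f(1) b], assumption)+
  then show "cmod (\<Sum>l\<in>\<Lambda>. a l * (F l + G l)) \<le> (C1 + C2) * M"
    by (simp add: algebra_simps sum.distrib) (meson add_mono norm_triangle_le)
qed (use assms in \<open>auto simp: trig_dual_def\<close>)

lemma trig_dual_scale: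
  assumes "trig_dual \<epsilon> C F"
  shows "trig_dual \<epsilon> (cmod c * C) (\<lambda>l. c * F l)"
proof (rule trig_dualI)
  fix \<Lambda> :: "'a set" and a M
  assume f: "finite \<Lambda>" "0 \<le> M" and b: "\<And>y. norm y \<le> \<epsilon> \<Longrightarrow> cmod (\<Sum>l\<in>\<Lambda>. a l * cis (l \<bullet> y)) \<le> M"
  have "cmod (\<Sum>l\<in>\<Lambda>. a l * F l) \<le> C * M" by (rule trig_dualD[OF assms f(1) b])
  moreover have "(\<Sum>l\<in>\<Lambda>. a l * (c * F l)) = c * (\<Sum>l\<in>\<Lambda>. a l * F l)"
    by (simp add: sum_distrib_left mult_ac)
  ultimately show "cmod (\<Sum>l\<in>\<Lambda>. a l * (c * F l)) \<le> cmod c * C * M"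
    by (simp add: norm_mult mult.assoc mult_left_mono)
qed (use assms in \<open>auto simp: trig_dual_def\<close>)

lemma trig_dual_sum:
  assumes "finite I" "0 \<le> \<epsilon>" "\<And>i. i \<in> I \<Longrightarrow> trig_dual \<epsilon> (C i) (F i)"
  shows "trig_dual \<epsilon> (\<Sum>i\<in>I. C i) (\<lambda>l. \<Sum>i\<in>I. F i l)"
  using assms
proof (induction I)
  case empty
  then show ?case by (simp add: trig_dual_zero)
next
  case (insert i I)
  then show ?case by (simp add: trig_dual_add)
qed

lemma trig_dual_prod:
  assumes "finite I" "\<And>i. i \<in> I \<Longrightarrow> trig_dual (\<epsilon> i) 1 (F i)"
  shows "trig_dual (\<Sum>i\<in>I. \<epsilon> i) 1 (\<lambda>l. \<Prod>i\<in>I. F i l)"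
  using assms
proof (induction I)
  case empty
  then show ?case by (simp add: trig_dual_one)
next
  case (insert i I)
  then have "trig_dual (\<epsilon> i + (\<Sum>i\<in>I. \<epsilon> i)) (1 * 1) (\<lambda>l. F i l * (\<Prod>i\<in>I. F i l))"
    by (intro trig_dual_mult) auto
  then show ?case using insert by simp
qed

text \<open>Translating the transform means multiplying the functional by a unimodular character,
  which changes neither its support nor its norm.\<close>

lemma trig_dual_shift:
  assumes "trig_dual \<epsilon> C F"
  shows "trig_dual \<epsilon> C (\<lambda>l. F (l - l0))"
proof (rule trig_dualI)
  fix \<Lambda> :: "'a set" and a M
  assume f: "finite \<Lambda>" "0 \<le> M" and b: "\<And>y. norm y \<le> \<epsilon> \<Longrightarrow> cmod (\<Sum>l\<in>\<Lambda>. a l * cis (l \<bullet> y)) \<le> M"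
  let ?\<Lambda> = "(\<lambda>l. l - l0) ` \<Lambda>"
  have re: "(\<Sum>l\<in>?\<Lambda>. a (l + l0) * G l) = (\<Sum>l\<in>\<Lambda>. a l * G (l - l0))" for G
    by (subst sum.reindex) (auto simp: inj_on_def)
  have "cmod (\<Sum>l\<in>?\<Lambda>. a (l + l0) * F l) \<le> C * M"
  proof (rule trig_dualD[OF assms])
    fix y :: 'a assume y: "norm y \<le> \<epsilon>"
    have "(\<Sum>l\<in>?\<Lambda>. a (l + l0) * cis (l \<bullet> y)) = (\<Sum>l\<in>\<Lambda>. a l * cis (l \<bullet> y)) * cis (- (l0 \<bullet> y))"
      unfolding re by (simp add: sum_distrib_right mult.assoc cis_mult inner_diff_left)
    then show "cmod (\<Sum>l\<in>?\<Lambda>. a (l + l0) * cis (l \<bullet> y)) \<le> M"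
      using b[OF y] by (simp add: norm_mult)
  qed (use f in auto)
  then show "cmod (\<Sum>l\<in>\<Lambda>. a l * F (l - l0)) \<le> C * M" by (simp add: re)
qed (use assms in \<open>auto simp: trig_dual_def\<close>)

lemma has_integral_cis_sinc:
  "((\<lambda>s. cis (s * c)) has_integral complex_of_real (2 * sinc c)) {-1..1}"
proof (cases "c = 0")
  case True
  have "((\<lambda>s::real. 1::complex) has_integral (measure lborel {-1..1::real}) *\<^sub>R 1) {-1..1}"
    by (rule has_integral_const_real)
  then show ?thesis using True by (simp add: scaleR_conv_of_real)
next
  case False
  let ?F = "\<lambda>s. cis (s * c) / (\<i> * c)"
  have "((\<lambda>s. cis (s * c)) has_integral (?F 1 - ?F (-1))) {-1..1}"
  proof (rule fundamental_theorem_of_calculus)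
    fix x :: real
    show "(?F has_vector_derivative cis (x * c)) (at x within {-1..1})"
      unfolding cis_conv_exp
      by (rule has_vector_derivative_real_field | rule derivative_eq_intros refl | simp)+
         (use False in \<open>auto simp: field_simps\<close>)
  qed auto
  moreover have "?F 1 - ?F (-1) = complex_of_real (2 * sinc c)"
    using False by (simp add: complex_eq_iff cis.sel Re_divide Im_divide power2_eq_square)
  ultimately show ?thesis by simp
qed

text \<open>The functional is the average over the segment from \<open>- y0\<close> to
  \<open>y0\<close>; the segment is parametrised by \<open>{-1..1}\<close>, whence the factors
  2.\<close>

lemma trig_dual_sinc:
  assumes "norm y0 \<le> \<epsilon>"
  shows "trig_dual \<epsilon> 1 (\<lambda>l. complex_of_real (sinc (l \<bullet> y0)))"
proof (rule trig_dualI)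
  show "0 \<le> \<epsilon>" using assms norm_ge_zero order_trans by blast
  fix \<Lambda> :: "'a set" and a M
  assume f: "finite \<Lambda>" "0 \<le> M" and b: "\<And>y. norm y \<le> \<epsilon> \<Longrightarrow> cmod (\<Sum>l\<in>\<Lambda>. a l * cis (l \<bullet> y)) \<le> M"
  let ?I = "\<Sum>l\<in>\<Lambda>. a l * complex_of_real (2 * sinc (l \<bullet> y0))"
  have "((\<lambda>s. \<Sum>l\<in>\<Lambda>. a l * cis (s * (l \<bullet> y0))) has_integral ?I) {-1..1}"
    by (intro has_integral_sum f has_integral_mult_right has_integral_cis_sinc)
  then have "norm ?I \<le> M * measure lborel (cbox (-1) (1::real))"
    unfolding cbox_interval[symmetric]
  proof (rule has_integral_bound[OF f(2)])
    fix s :: real assume "s \<in> cbox (-1) 1"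
    then have "\<bar>s\<bar> * norm y0 \<le> 1 * norm y0" by (intro mult_right_mono) auto
    then have "norm (s *\<^sub>R y0) \<le> \<epsilon>" using assms by simp
    from b[OF this] show "cmod (\<Sum>l\<in>\<Lambda>. a l * cis (s * (l \<bullet> y0))) \<le> M" by simp
  qed
  then have "norm ?I \<le> 2 * M" by simp
  moreover have "?I = 2 * (\<Sum>l\<in>\<Lambda>. a l * complex_of_real (sinc (l \<bullet> y0)))"
    by (simp add: sum_distrib_left mult_ac del: of_real_mult cong: if_cong) (simp add: mult_ac)
  ultimately show "cmod (\<Sum>l\<in>\<Lambda>. a l * complex_of_real (sinc (l \<bullet> y0))) \<le> 1 * M"
    by (simp only: norm_mult) simp
qed simp

section \<open>Interpolation on the paraboloid over a lattice\<close>

definition sinc2 :: "real \<Rightarrow> real" where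
  "sinc2 x = (sinc x)\<^sup>2"

lemma sinc2_0 [simp]: "sinc2 0 = 1"
  by (simp add: sinc2_def)

lemma sinc2_minus [simp]: "sinc2 (- x) = sinc2 x"
  by (simp add: sinc2_def)

lemma sinc2_nonneg [simp]: "0 \<le> sinc2 x"
  by (simp add: sinc2_def)

lemma sinc2_le_1 [simp]: "sinc2 x \<le> 1"
proof -
  have "\<bar>sin x\<bar> \<le> \<bar>x\<bar>" by (rule abs_sin_x_le_abs_x)
  then have "x \<noteq> 0 \<Longrightarrow> \<bar>sin x / x\<bar> \<le> 1" by (simp add: divide_le_eq)
  then show ?thesis by (auto simp: sinc2_def abs_square_le_1)
qed

lemma abs_sinc_le_1: "\<bar>sinc x\<bar> \<le> 1"
  using sinc2_le_1 unfolding sinc2_def abs_square_le_1 .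

lemma abs_sinc_le_inverse: "x \<noteq> 0 \<Longrightarrow> \<bar>sinc x\<bar> \<le> 1 / \<bar>x\<bar>"
  by (simp add: divide_right_mono)

lemma sinc_gap:
  assumes "s > 0"
  obtains \<rho> where "\<rho> < 1" "0 \<le> \<rho>" "\<And>x. s \<le> \<bar>x\<bar> \<Longrightarrow> sinc2 x \<le> \<rho>"
proof -
  have lt1: "sinc2 x < 1" if "0 < x" for x
  proof -
    \<comment> \<open>The double-angle formula produces a factor
      \<open>\<bar>cos y\<bar> < 1\<close>, which makes the standard bound on \<open>sin\<close>
      strict.\<close>
    define y where "y = x / 2"
    have y: "0 < y" "x = 2 * y" using that by (auto simp: y_def)
    have "\<bar>sin x\<bar> < x"
    proof (cases "x \<le> 1")
      case True
      have "\<bar>sin y\<bar> \<le> y" using abs_sin_x_le_abs_x[of y] y by simp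
      have "cos y < cos 0" using True y pi_gt3 by (intro cos_monotone_0_pi) auto
      moreover have "0 < cos y" using True y pi_gt3 by (intro cos_gt_zero) auto
      ultimately have c: "\<bar>cos y\<bar> < 1" by simp
      have "\<bar>sin x\<bar> = 2 * (\<bar>sin y\<bar> * \<bar>cos y\<bar>)" by (simp add: y(2) sin_double abs_mult)
      also have "\<dots> \<le> 2 * (y * \<bar>cos y\<bar>)" using \<open>\<bar>sin y\<bar> \<le> y\<close> by (intro mult_left_mono mult_right_mono) auto
      also have "\<dots> < 2 * (y * 1)" using c y(1) by (intro mult_strict_left_mono) auto
      finally show ?thesis using y by simp
    next
      case False
      then show ?thesis using abs_sin_le_one[of x] by linarith
    qed
    then have "\<bar>sin x / x\<bar> < 1" using that by (simp add: abs_divide)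
    then show ?thesis using that by (simp add: sinc2_def abs_square_less_1)
  qed
  obtain x0 where x0: "x0 \<in> {s..max s 2}" "\<And>y. y \<in> {s..max s 2} \<Longrightarrow> sinc2 y \<le> sinc2 x0"
  proof -
    have "continuous_on {s..max s 2} sinc2" unfolding sinc2_def by (intro continuous_intros)
    then show thesis
      using continuous_attains_sup[of "{s..max s 2}" sinc2] that by (metis atLeastAtMost_iff compact_Icc empty_iff max.cobounded1 order_refl)
  qed
  \<comment> \<open>The maximum at \<open>x0\<close> covers arguments of modulus at most 2. Beyond 2
    the decay gives at most 1/4, so any constant between 1/4 and 1 would do as second entry.\<close>
  define \<rho> where "\<rho> = max (sinc2 x0) (1/2)"
  show ?thesis
  proof
    show "\<rho> < 1" using lt1[of x0] x0(1) assms by (auto simp: \<rho>_def)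
    show "0 \<le> \<rho>" by (simp add: \<rho>_def)
    fix x :: real assume x: "s \<le> \<bar>x\<bar>"
    have e: "sinc2 x = sinc2 \<bar>x\<bar>" by (auto simp: abs_if)
    show "sinc2 x \<le> \<rho>"
    proof (cases "\<bar>x\<bar> \<le> 2")
      case True
      then have "sinc2 \<bar>x\<bar> \<le> sinc2 x0" using x by (intro x0(2)) auto
      then show ?thesis unfolding e \<rho>_def by linarith
    next
      case False
      then have "\<bar>sinc x\<bar> \<le> 1 / \<bar>x\<bar>" by (intro abs_sinc_le_inverse) auto
      also have "\<dots> \<le> 1/2" using False by (simp add: field_simps)
      finally have "\<bar>sinc x\<bar>^2 \<le> (1/2)^2" by (intro power_mono) auto
      then have "sinc2 x \<le> 1/4" unfolding sinc2_def by (simp only: power2_abs) (simp add: power2_eq_square)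
      then show ?thesis unfolding \<rho>_def by linarith
    qed
  qed
qed

lemma sinc2_int_summable:
  assumes "c > 0"
  shows "(\<lambda>n::int. sinc2 (c * of_int n)) summable_on UNIV"
proof -
  let ?s = "\<lambda>n::int. sinc2 (c * of_int n)"
  have "summable (\<lambda>n::nat. ?s (int n))"
  proof (rule summable_comparison_test')
    show "summable (\<lambda>n::nat. (1 / c\<^sup>2) * inverse ((of_nat n) ^ 2 :: real))"
      by (intro summable_mult inverse_power_summable) auto
    fix n :: nat assume n: "n \<ge> 1"
    have "\<bar>sinc (c * of_int (int n))\<bar> \<le> 1 / \<bar>c * of_int (int n)\<bar>"
      using n assms by (intro abs_sinc_le_inverse) auto
    then have "\<bar>sinc (c * of_int (int n))\<bar>\<^sup>2 \<le> (1 / \<bar>c * of_int (int n)\<bar>)\<^sup>2"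
      by (intro power_mono) auto
    then show "norm (?s (int n)) \<le> (1 / c\<^sup>2) * inverse ((of_nat n) ^ 2 :: real)"
      unfolding sinc2_def by (simp only: power2_abs) (simp add: power_divide power_mult_distrib inverse_eq_divide)
  qed
  then have 0: "(\<lambda>n::nat. ?s (int n)) summable_on UNIV"
    by (subst summable_on_UNIV_nonneg_real_iff) auto
  have 1: "?s summable_on range int"
    by (subst summable_on_reindex) (use 0 in \<open>auto simp: o_def\<close>)
  have 2: "?s summable_on range (\<lambda>n. - int n)"
    by (subst summable_on_reindex) (use 0 in \<open>auto simp: o_def inj_on_def\<close>)
  have "?s summable_on (range int \<union> range (\<lambda>n. - int n))"
    by (rule summable_on_union[OF 1 2])
  moreover have "range int \<union> range (\<lambda>n. - int n) = UNIV"
  proof -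
    have "x \<in> range int \<union> range (\<lambda>n. - int n)" for x :: int
      by (cases x rule: int_cases2) auto
    then show ?thesis by blast
  qed
  ultimately show ?thesis by simp
qed

section \<open>The dual lattice, its summable kernel, and interpolation with uniform
  constants\<close>

text \<open>These are the frequencies whose characters are invariant under translation by every
  \<open>v j\<close>. \<open>Basis\<close> acts only as an index set of the right
  cardinality.\<close>

definition dual_lattice :: "('a::euclidean_space \<Rightarrow> 'a) \<Rightarrow> 'a set" where
  "dual_lattice v = {h. \<forall>j\<in>Basis. \<exists>n::int. h \<bullet> v j = 2 * pi * of_int n}"

text \<open>Transform of the convolution of two uniform averages along each \<open>v j\<close>. The
  squares make it nonnegative and give quadratic decay in each coordinate, hence summability over
  the dual lattice.\<close>

definition lattice_kernel :: "('a::euclidean_space \<Rightarrow> 'a) \<Rightarrow> real \<Rightarrow> 'a \<Rightarrow> real" where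
  "lattice_kernel v \<sigma> h = (\<Prod>j\<in>Basis. sinc2 (\<sigma> * (h \<bullet> v j)))"

text \<open>Space-time frequency of the plane wave that solves the free equation: its inner product
  with \<open>(x, t)\<close> is the phase
  \<open>x \<bullet> m - t * (norm m)\<^sup>2\<close>.\<close>

definition paraboloid :: "'a::euclidean_space \<Rightarrow> 'a \<times> real" where
  "paraboloid m = (m, - (norm m)\<^sup>2)"

abbreviation isolable :: "real \<Rightarrow> real \<Rightarrow> 'a::euclidean_space set \<Rightarrow> 'a \<Rightarrow> bool" where
  "isolable \<epsilon> C F m0 \<equiv> \<exists>\<Phi>. trig_dual \<epsilon> C \<Phi> \<and> \<Phi> (paraboloid m0) = 1 \<and> (\<forall>m\<in>F - {m0}. \<Phi> (paraboloid m) = 0)"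

text \<open>The constant is chosen before \<open>F\<close> and \<open>m0\<close>, so it is uniform
  in the coset, in the number of frequencies and in the isolated one.\<close>

definition interp :: "('a::euclidean_space \<Rightarrow> 'a) \<Rightarrow> 'a set \<Rightarrow> real \<Rightarrow> bool" where
  "interp v X \<epsilon> \<longleftrightarrow> (\<exists>C. \<forall>F m0. finite F \<and> F \<subseteq> X \<and> (\<forall>m\<in>F. \<forall>m'\<in>F. m - m' \<in> dual_lattice v) \<and> m0 \<in> F \<longrightarrow>
     isolable \<epsilon> C F m0)"

lemma lattice_kernel_nonneg: "0 \<le> lattice_kernel v \<sigma> h"
  by (simp add: lattice_kernel_def prod_nonneg)

lemma lattice_kernel_le_1: "lattice_kernel v \<sigma> h \<le> 1"
  unfolding lattice_kernel_def by (intro prod_le_1) (use sinc2_le_1 in auto)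

lemma lattice_kernel_0: "lattice_kernel v \<sigma> 0 = 1"
  by (simp add: lattice_kernel_def)

lemma dual_lattice_diff: "h \<in> dual_lattice v \<Longrightarrow> k \<in> dual_lattice v \<Longrightarrow> h - k \<in> dual_lattice v"
  unfolding dual_lattice_def
  by (auto simp: inner_diff_left) (metis of_int_diff right_diff_distrib')

text \<open>Each \<open>v j\<close> contributes two segments of half-length
  \<open>\<sigma> * norm (v j)\<close>, which explains the factor 2 in the radius.\<close>

lemma trig_dual_lattice_kernel:
  assumes "0 < \<sigma>" "2 * \<sigma> * (\<Sum>j\<in>Basis. norm (v j)) \<le> \<epsilon>"
  shows "trig_dual \<epsilon> 1 (\<lambda>l::'a::euclidean_space \<times> real. complex_of_real (lattice_kernel v \<sigma> (fst l)))"
proof -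
  have "trig_dual (\<Sum>j\<in>Basis. \<sigma> * norm (v j) + \<sigma> * norm (v j)) 1
     (\<lambda>l::'a\<times>real. \<Prod>j\<in>Basis. complex_of_real (sinc (\<sigma> * (fst l \<bullet> v j))) * complex_of_real (sinc (\<sigma> * (fst l \<bullet> v j))))"
  proof (rule trig_dual_prod)
    fix j :: 'a assume "j \<in> Basis"
    have "trig_dual (\<sigma> * norm (v j)) 1 (\<lambda>l::'a\<times>real. complex_of_real (sinc (l \<bullet> (\<sigma> *\<^sub>R v j, 0))))"
      by (rule trig_dual_sinc) (use assms in \<open>simp add: norm_Pair\<close>)
    then have *: "trig_dual (\<sigma> * norm (v j)) 1 (\<lambda>l::'a\<times>real. complex_of_real (sinc (\<sigma> * (fst l \<bullet> v j))))"
      by (simp only: inner_prod_def fst_conv snd_conv inner_scaleR_right inner_zero_right add_0_right)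
    show "trig_dual (\<sigma> * norm (v j) + \<sigma> * norm (v j)) 1
     (\<lambda>l::'a\<times>real. complex_of_real (sinc (\<sigma> * (fst l \<bullet> v j))) * complex_of_real (sinc (\<sigma> * (fst l \<bullet> v j))))"
      using trig_dual_mult[OF * *] by simp
  qed auto
  then have 1: "trig_dual (\<Sum>j\<in>Basis. \<sigma> * norm (v j) + \<sigma> * norm (v j)) 1
     (\<lambda>l::'a\<times>real. complex_of_real (lattice_kernel v \<sigma> (fst l)))"
    by (simp only: lattice_kernel_def of_real_prod sinc2_def power2_eq_square of_real_mult)
  have 2: "(\<Sum>j\<in>Basis. \<sigma> * norm (v j) + \<sigma> * norm (v j)) = 2 * \<sigma> * (\<Sum>j\<in>Basis. norm (v j))"
    by (simp add: sum_distrib_left algebra_simps sum.distrib)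
  show ?thesis by (rule trig_dual_mono[OF 1 _ order_refl]) (unfold 2, rule assms(2))
qed

locale lattice_frame =
  fixes v :: "'a::euclidean_space \<Rightarrow> 'a"
  assumes nondeg: "\<And>h. (\<And>j. j \<in> Basis \<Longrightarrow> h \<bullet> v j = 0) \<Longrightarrow> h = 0"
begin

abbreviation "\<Gamma> \<equiv> dual_lattice v"

lemma \<Gamma>_nonzero:
  assumes "h \<in> \<Gamma>" "h \<noteq> 0"
  obtains j where "j \<in> Basis" "2 * pi \<le> \<bar>h \<bullet> v j\<bar>"
proof -
  obtain j where j: "j \<in> Basis" "h \<bullet> v j \<noteq> 0" using nondeg assms(2) by blast
  obtain n :: int where n: "h \<bullet> v j = 2 * pi * of_int n" using assms(1) j(1) by (auto simp: dual_lattice_def)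
  have "n \<noteq> 0" using n j by auto
  then have "1 \<le> \<bar>real_of_int n\<bar>" by linarith
  then have "2 * pi * 1 \<le> 2 * pi * \<bar>real_of_int n\<bar>" by (intro mult_left_mono) auto
  then show thesis using that[OF j(1)] n by (simp add: abs_mult)
qed

text \<open>Some coordinate of a nonzero \<open>h\<close> is at least \<open>2 * pi\<close> in
  modulus, so one factor of the kernel stays away from 1 while the others are at most 1.\<close>

lemma kernel_gap:
  assumes "0 < \<sigma>"
  obtains \<delta> where "0 < \<delta>" "\<And>h. h \<in> \<Gamma> \<Longrightarrow> h \<noteq> 0 \<Longrightarrow> lattice_kernel v \<sigma> h \<le> 1 - \<delta>"
proof -
  obtain \<rho> where \<rho>: "\<rho> < 1" "0 \<le> \<rho>" "\<And>x. \<sigma> * (2 * pi) \<le> \<bar>x\<bar> \<Longrightarrow> sinc2 x \<le> \<rho>"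
    using sinc_gap[of "\<sigma> * (2 * pi)"] assms by auto
  show thesis
  proof (rule that[of "1 - \<rho>"])
    show "0 < 1 - \<rho>" using \<rho> by simp
    fix h assume "h \<in> \<Gamma>" "h \<noteq> 0"
    then obtain j where j: "j \<in> Basis" "2 * pi \<le> \<bar>h \<bullet> v j\<bar>" by (rule \<Gamma>_nonzero)
    have "\<sigma> * (2 * pi) \<le> \<bar>\<sigma> * (h \<bullet> v j)\<bar>" using j(2) assms by (simp add: abs_mult)
    then have s: "sinc2 (\<sigma> * (h \<bullet> v j)) \<le> \<rho>" by (rule \<rho>(3))
    have "lattice_kernel v \<sigma> h = sinc2 (\<sigma> * (h \<bullet> v j)) * (\<Prod>j\<in>Basis - {j}. sinc2 (\<sigma> * (h \<bullet> v j)))"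
      unfolding lattice_kernel_def using j(1) by (rule prod.remove[OF finite_Basis])
    also have "\<dots> \<le> \<rho> * 1"
      by (intro mult_mono s prod_le_1 prod_nonneg) (use \<rho> sinc2_le_1 in auto)
    finally show "lattice_kernel v \<sigma> h \<le> 1 - (1 - \<rho>)" by simp
  qed
qed

text \<open>A dual vector is determined by its integer coordinates, so finite sums are dominated by
  a product of one-dimensional series.\<close>

lemma kernel_summable:
  assumes "0 < \<sigma>"
  shows "lattice_kernel v \<sigma> summable_on \<Gamma>"
proof (rule nonneg_bdd_above_summable_on)
  define s where "s = (\<lambda>n::int. sinc2 (\<sigma> * (2 * pi) * of_int n))"
  \<comment> \<open>On \<open>\<Gamma>\<close> the quotient is an integer, so the floor only selects
    it.\<close>
  define N where "N = (\<lambda>h j. \<lfloor>h \<bullet> v j / (2 * pi)\<rfloor>)"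
  have N: "h \<bullet> v j = 2 * pi * of_int (N h j)" if "h \<in> \<Gamma>" "j \<in> Basis" for h j
    using that unfolding dual_lattice_def N_def by fastforce
  have s: "s summable_on UNIV" unfolding s_def by (rule sinc2_int_summable) (use assms in simp)
  have bd: "(\<Sum>h\<in>F. lattice_kernel v \<sigma> h) \<le> (\<Prod>j\<in>(Basis::'a set). infsum s UNIV)" if F: "F \<subseteq> \<Gamma>" "finite F" for F
  proof -
    let ?r = "\<lambda>h. restrict (N h) Basis"
    let ?P = "Pi\<^sub>E Basis (\<lambda>j. (\<lambda>h. N h j) ` F)"
    have inj: "inj_on ?r F"
    proof (rule inj_onI)
      fix h k assume hk: "h \<in> F" "k \<in> F" "?r h = ?r k"
      have "(h - k) \<bullet> v j = 0" if "j \<in> Basis" for j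
      proof -
        have "N h j = N k j" using fun_cong[OF hk(3), of j] that by simp
        moreover have "h \<in> \<Gamma>" "k \<in> \<Gamma>" using hk F by auto
        ultimately show ?thesis using N[of h j] N[of k j] that by (simp add: inner_diff_left)
      qed
      then have "h - k = 0" by (rule nondeg)
      then show "h = k" by simp
    qed
    have "(\<Sum>h\<in>F. lattice_kernel v \<sigma> h) = (\<Sum>h\<in>F. \<Prod>j\<in>Basis. s (?r h j))"
    proof (intro sum.cong refl)
      fix h assume h: "h \<in> F"
      show "lattice_kernel v \<sigma> h = (\<Prod>j\<in>Basis. s (?r h j))"
        unfolding lattice_kernel_def s_def
        by (intro prod.cong refl) (use h F(1) N in \<open>auto simp: mult.assoc\<close>)
    qed
    also have "\<dots> = (\<Sum>g\<in>?r ` F. \<Prod>j\<in>Basis. s (g j))"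
      by (simp only: sum.reindex[OF inj] o_def)
    also have "\<dots> \<le> (\<Sum>g\<in>?P. \<Prod>j\<in>Basis. s (g j))"
      by (intro sum_mono2 finite_PiE) (use F in \<open>auto simp: s_def intro!: prod_nonneg\<close>)
    also have "\<dots> = (\<Prod>j\<in>Basis. \<Sum>n\<in>(\<lambda>h. N h j) ` F. s n)"
      using F by (subst prod_sum_PiE) auto
    also have "\<dots> \<le> (\<Prod>j\<in>(Basis::'a set). infsum s UNIV)"
      by (intro prod_mono conjI sum_nonneg finite_sum_le_infsum s) (use F in \<open>auto simp: s_def\<close>)
    finally show ?thesis .
  qed
  show "bdd_above (sum (lattice_kernel v \<sigma>) ` {F. F \<subseteq> \<Gamma> \<and> finite F})"
    by (rule bdd_aboveI2) (use bd in auto)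
qed (rule lattice_kernel_nonneg)

end

text \<open>Column sums bound the operator norm of \<open>E\<close> on l1, so the Neumann series for
  the inverse of \<open>1 + E\<close> converges with total norm 2. The l1 norm is the right one
  because the \<open>b m\<close> become coefficients of functionals whose norms add.\<close>

lemma neumann_column_dominant:
  fixes E :: "'i \<Rightarrow> 'i \<Rightarrow> complex"
  assumes F: "finite F" "m0 \<in> F" and E: "\<And>m'. m' \<in> F \<Longrightarrow> (\<Sum>m\<in>F. cmod (E m m')) \<le> 1/2"
  obtains b where "\<And>m. m \<in> F \<Longrightarrow> b m + (\<Sum>m'\<in>F. E m m' * b m') = (if m = m0 then 1 else 0)"
    "(\<Sum>m\<in>F. cmod (b m)) \<le> 2"
proof -
  \<comment> \<open>The k-th iterate is \<open>- E\<close>, applied k times to the unit vector at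
    \<open>m0\<close>.\<close>
  define B where "B = rec_nat (\<lambda>m. if m = m0 then 1 else 0 :: complex) (\<lambda>_ f m. - (\<Sum>m'\<in>F. E m m' * f m'))"
  have B0: "B 0 = (\<lambda>m. if m = m0 then 1 else 0)" by (simp add: B_def)
  have BS: "B (Suc k) m = - (\<Sum>m'\<in>F. E m m' * B k m')" for k m by (simp add: B_def)
  have S: "(\<Sum>m\<in>F. cmod (B k m)) \<le> (1/2)^k" for k
  proof (induction k)
    case 0
    have "(\<Sum>m\<in>F. cmod (B 0 m)) = (\<Sum>m\<in>F. if m = m0 then 1 else 0)" by (intro sum.cong) (auto simp: B0)
    then show ?case using F by simp
  next
    case (Suc k)
    have "(\<Sum>m\<in>F. cmod (B (Suc k) m)) \<le> (\<Sum>m\<in>F. \<Sum>m'\<in>F. cmod (E m m') * cmod (B k m'))"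
      unfolding BS norm_minus_cancel by (intro sum_mono order_trans[OF norm_sum]) (simp add: norm_mult)
    also have "\<dots> = (\<Sum>m'\<in>F. (\<Sum>m\<in>F. cmod (E m m')) * cmod (B k m'))"
      by (subst sum.swap) (simp add: sum_distrib_right)
    also have "\<dots> \<le> (\<Sum>m'\<in>F. 1/2 * cmod (B k m'))"
      by (intro sum_mono mult_right_mono E) auto
    also have "\<dots> \<le> (1/2) ^ Suc k" using Suc by (simp only: sum_distrib_left[symmetric] power_Suc)
    finally show ?case .
  qed
  have le: "cmod (B k m) \<le> (1/2)^k" if "m \<in> F" for k m
    using member_le_sum[of m F "\<lambda>m. cmod (B k m)"] that F S[of k] by auto
  have sn: "summable (\<lambda>k. cmod (B k m))" if "m \<in> F" for m
    by (rule summable_comparison_test'[of "\<lambda>k. (1/2)^k"]) (use le[OF that] in \<open>auto simp: summable_geometric\<close>)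
  have sm: "summable (\<lambda>k. B k m)" if "m \<in> F" for m
    by (rule summable_norm_cancel[OF sn[OF that]])
  define b where "b = (\<lambda>m. \<Sum>k. B k m)"
  show thesis
  proof (rule that[of b])
    fix m assume m: "m \<in> F"
    have "(\<Sum>m'\<in>F. E m m' * b m') = (\<Sum>k. \<Sum>m'\<in>F. E m m' * B k m')"
    proof -
      have "(\<Sum>m'\<in>F. E m m' * b m') = (\<Sum>m'\<in>F. \<Sum>k. E m m' * B k m')"
        unfolding b_def by (intro sum.cong refl suminf_mult[symmetric] sm)
      also have "\<dots> = (\<Sum>k. \<Sum>m'\<in>F. E m m' * B k m')"
        by (intro suminf_sum[symmetric] summable_mult sm)
      finally show ?thesis .
    qed
    also have "\<dots> = (\<Sum>k. - B (Suc k) m)" by (simp only: BS minus_minus)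
    also have "\<dots> = - (\<Sum>k. B (Suc k) m)"
      by (rule suminf_minus) (rule summable_Suc_iff[THEN iffD2, OF sm[OF m]])
    also have "(\<Sum>k. B (Suc k) m) = b m - B 0 m"
      unfolding b_def by (rule suminf_split_head[OF sm[OF m]])
    finally show "b m + (\<Sum>m'\<in>F. E m m' * b m') = (if m = m0 then 1 else 0)" by (simp add: B0)
  next
    have "(\<Sum>m\<in>F. cmod (b m)) \<le> (\<Sum>m\<in>F. \<Sum>k. cmod (B k m))"
      unfolding b_def by (intro sum_mono summable_norm sn)
    also have "\<dots> = (\<Sum>k. \<Sum>m\<in>F. cmod (B k m))" by (rule suminf_sum[symmetric]) (use sn in auto)
    also have "\<dots> \<le> (\<Sum>k. (1/2)^k)"
      by (intro suminf_le S summable_sum sn) (auto simp: summable_geometric)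
    also have "\<dots> = 2" by (simp add: suminf_geometric)
    finally show "(\<Sum>m\<in>F. cmod (b m)) \<le> 2" .
  qed
qed

lemma interp_mono:
  assumes "interp v Y \<epsilon>" "X \<subseteq> Y" "\<epsilon> \<le> \<epsilon>'"
  shows "interp v X \<epsilon>'"
proof -
  obtain C where C: "\<forall>F m0. finite F \<and> F \<subseteq> Y \<and> (\<forall>m\<in>F. \<forall>m'\<in>F. m - m' \<in> dual_lattice v) \<and> m0 \<in> F \<longrightarrow>
     isolable \<epsilon> C F m0"
    using assms(1) unfolding interp_def by (elim exE)
  show ?thesis unfolding interp_def
  proof (rule exI[of _ C], intro allI impI)
    fix F m0 assume F: "finite F \<and> F \<subseteq> X \<and> (\<forall>m\<in>F. \<forall>m'\<in>F. m - m' \<in> dual_lattice v) \<and> m0 \<in> F"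
    then have "finite F \<and> F \<subseteq> Y \<and> (\<forall>m\<in>F. \<forall>m'\<in>F. m - m' \<in> dual_lattice v) \<and> m0 \<in> F" using assms(2) by auto
    from C[rule_format, OF this] obtain \<Phi> where \<Phi>: "trig_dual \<epsilon> C \<Phi>" "\<Phi> (paraboloid m0) = 1" "\<forall>m\<in>F - {m0}. \<Phi> (paraboloid m) = 0"
      by (elim exE conjE)
    then show "isolable \<epsilon>' C F m0"
      using trig_dual_mono[OF \<Phi>(1) assms(3) order_refl] by (intro exI[of _ \<Phi>] conjI)
  qed
qed

lemma fst_paraboloid [simp]: "fst (paraboloid m) = m"
  by (simp add: paraboloid_def)

lemma snd_paraboloid [simp]: "snd (paraboloid m) = - (norm m)\<^sup>2"
  by (simp add: paraboloid_def)

lemma paraboloid_inject [simp]: "paraboloid m = paraboloid m' \<longleftrightarrow> m = m'"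
  by (auto simp: paraboloid_def)

context lattice_frame
begin

text \<open>The dilation for which the support of the kernel fits into a ball of radius
  \<open>\<epsilon>\<close>.\<close>

definition "kernel_width \<epsilon> = \<epsilon> / (2 * (\<Sum>j\<in>Basis. norm (v j)))"

lemma sum_norm_pos: "0 < (\<Sum>j\<in>Basis. norm (v j))"
proof -
  obtain j0 :: 'a where j0: "j0 \<in> Basis" using SOME_Basis by blast
  have "j0 \<noteq> 0" using j0 by auto
  then obtain j where "j \<in> Basis" "j0 \<bullet> v j \<noteq> 0" using nondeg by blast
  then show ?thesis by (intro sum_pos2[of Basis j]) auto
qed

lemma kernel_width_pos: "0 < \<epsilon> \<Longrightarrow> 0 < kernel_width \<epsilon>"
  using sum_norm_pos by (simp add: kernel_width_def)

lemma trig_dual_kernel: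
  "0 < \<epsilon> \<Longrightarrow> trig_dual \<epsilon> 1 (\<lambda>l::'a \<times> real. complex_of_real (lattice_kernel v (kernel_width \<epsilon>) (fst l)))"
  by (rule trig_dual_lattice_kernel[OF kernel_width_pos]) (use sum_norm_pos in \<open>simp_all add: kernel_width_def\<close>)

lemma kernel_sum_coset:
  assumes "0 < \<sigma>"
  obtains K where "0 < K" "\<And>F m0. finite F \<Longrightarrow> (\<And>m. m \<in> F \<Longrightarrow> m - m0 \<in> \<Gamma>) \<Longrightarrow>
      (\<Sum>m\<in>F. lattice_kernel v \<sigma> (m - m0)) \<le> K"
proof -
  let ?I = "infsum (lattice_kernel v \<sigma>) \<Gamma>"
  have "(\<Sum>m\<in>F. lattice_kernel v \<sigma> (m - m0)) \<le> ?I + 1" if F: "finite F" "\<And>m. m \<in> F \<Longrightarrow> m - m0 \<in> \<Gamma>" for F m0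
  proof -
    have "(\<Sum>m\<in>F. lattice_kernel v \<sigma> (m - m0)) = sum (lattice_kernel v \<sigma>) ((\<lambda>m. m - m0) ` F)"
      by (subst sum.reindex) (auto simp: inj_on_def)
    also have "\<dots> \<le> ?I"
      by (intro finite_sum_le_infsum kernel_summable assms) (use F in \<open>auto simp: lattice_kernel_nonneg\<close>)
    finally show ?thesis by simp
  qed
  moreover have "0 \<le> ?I" by (intro infsum_nonneg lattice_kernel_nonneg)
  ultimately show thesis by (intro that[of "?I + 1"]) auto
qed

text \<open>Kahane's argument: the functional \<open>\<Psi>\<close> equals 1 at \<open>m0\<close> and kills the frequencies of \<open>F2\<close>, because
  the interpolant \<open>H\<close> is multiplied by a factor that vanishes at \<open>m0\<close> only.\<close>

lemma union_step:
  assumes e: "0 < \<epsilon>" and e2: "0 \<le> \<epsilon>2" and C2: "0 \<le> C2"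
    and X2: "\<And>F m0. finite F \<Longrightarrow> F \<subseteq> X2 \<Longrightarrow> (\<And>m m'. m \<in> F \<Longrightarrow> m' \<in> F \<Longrightarrow> m - m' \<in> \<Gamma>) \<Longrightarrow> m0 \<in> F \<Longrightarrow>
     isolable \<epsilon>2 C2 F m0"
  obtains C where "0 \<le> C" "\<And>F2 m0. finite F2 \<Longrightarrow> F2 \<subseteq> X2 \<Longrightarrow> m0 \<notin> F2 \<Longrightarrow>
      (\<And>m m'. m \<in> insert m0 F2 \<Longrightarrow> m' \<in> insert m0 F2 \<Longrightarrow> m - m' \<in> \<Gamma>) \<Longrightarrow>
     \<exists>\<Psi>. trig_dual (\<epsilon>2 + \<epsilon>) C \<Psi> \<and> \<Psi> (paraboloid m0) = 1 \<and> (\<forall>m\<in>F2. \<Psi> (paraboloid m) = 0)"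
proof -
  define \<sigma> where "\<sigma> = kernel_width \<epsilon>"
  have \<sigma>: "0 < \<sigma>" using kernel_width_pos[OF e] by (simp add: \<sigma>_def)
  obtain \<delta> where \<delta>: "0 < \<delta>" "\<And>h. h \<in> \<Gamma> \<Longrightarrow> h \<noteq> 0 \<Longrightarrow> lattice_kernel v \<sigma> h \<le> 1 - \<delta>"
    using kernel_gap[OF \<sigma>] by metis
  obtain K where K: "0 < K" "\<And>F m0. finite F \<Longrightarrow> (\<And>m. m \<in> F \<Longrightarrow> m - m0 \<in> \<Gamma>) \<Longrightarrow>
      (\<Sum>m\<in>F. lattice_kernel v \<sigma> (m - m0)) \<le> K"
    by (rule kernel_sum_coset[OF \<sigma>]) blast
  let ?k = "lattice_kernel v \<sigma>"
  \<comment> \<open>Here 1 is the norm for \<open>Q\<close>, \<open>K / \<delta>\<close> bounds the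
    sum of the coefficients \<open>c m\<close>, \<open>C2\<close> is the norm of each interpolant,
    and 2 bounds the norm for \<open>1 - Q\<close>.\<close>
  define C where "C = 1 + (K / \<delta>) * C2 * 2"
  show thesis
  proof (rule that[of C])
    show "0 \<le> C" using K \<delta> C2 by (simp add: C_def)
    fix F2 m0
    assume F2: "finite F2" "F2 \<subseteq> X2" "m0 \<notin> F2"
      and cos: "\<And>m m'. m \<in> insert m0 F2 \<Longrightarrow> m' \<in> insert m0 F2 \<Longrightarrow> m - m' \<in> \<Gamma>"
    have "\<forall>m\<in>F2. isolable \<epsilon>2 C2 F2 m"
      using X2[OF F2(1,2)] cos by blast
    then obtain G where G: "\<And>m. m \<in> F2 \<Longrightarrow> trig_dual \<epsilon>2 C2 (G m)"
      "\<And>m. m \<in> F2 \<Longrightarrow> G m (paraboloid m) = 1" "\<And>m m'. m \<in> F2 \<Longrightarrow> m' \<in> F2 \<Longrightarrow> m' \<noteq> m \<Longrightarrow> G m (paraboloid m') = 0"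
      by (metis Diff_iff singletonD)
    \<comment> \<open>With \<open>k\<close> the value of \<open>Q\<close> at \<open>m\<close>, the
      coefficient solves \<open>c * (1 - k) = k\<close>; hence \<open>H * (1 - Q)\<close> cancels
      \<open>Q\<close> on \<open>F2\<close>. The kernel gap keeps the denominator away from
      0.\<close>
    define c where "c = (\<lambda>m. ?k (m - m0) / (1 - ?k (m - m0)))"
    define Q where "Q = (\<lambda>l. complex_of_real (?k (fst (l - paraboloid m0))))"
    define H where "H = (\<lambda>l. \<Sum>m\<in>F2. complex_of_real (c m) * G m l)"
    define \<Psi> where "\<Psi> = (\<lambda>l. Q l + (-1) * (H l * (1 + (-1) * Q l)))"
    have gap: "?k (m - m0) \<le> 1 - \<delta>" if "m \<in> F2" for m
      using \<delta>(2)[of "m - m0"] cos that F2(3) by auto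
    have c0: "0 \<le> c m" "c m \<le> ?k (m - m0) / \<delta>" if "m \<in> F2" for m
      using gap[OF that] \<delta>(1) lattice_kernel_nonneg[of v \<sigma> "m - m0"]
      by (auto simp: c_def intro!: divide_left_mono)
    have Qd: "trig_dual \<epsilon> 1 Q"
      unfolding Q_def \<sigma>_def by (rule trig_dual_shift[OF trig_dual_kernel[OF e]])
    have Hd: "trig_dual \<epsilon>2 (\<Sum>m\<in>F2. cmod (complex_of_real (c m)) * C2) H"
      unfolding H_def by (intro trig_dual_sum trig_dual_scale G F2 e2)
    have 1: "trig_dual \<epsilon> (1 + cmod (-1) * 1) (\<lambda>l. 1 + (-1) * Q l)"
      using e by (intro trig_dual_add trig_dual_scale Qd trig_dual_one) auto
    have "trig_dual (\<epsilon>2 + \<epsilon>) (1 + cmod (-1) * ((\<Sum>m\<in>F2. cmod (complex_of_real (c m)) * C2) * (1 + cmod (-1) * 1))) \<Psi>"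
      unfolding \<Psi>_def
      by (intro trig_dual_add trig_dual_scale trig_dual_mult[OF Hd 1] trig_dual_mono[OF Qd]) (use e2 in auto)
    moreover have "1 + cmod (-1) * ((\<Sum>m\<in>F2. cmod (complex_of_real (c m)) * C2) * (1 + cmod (-1) * 1)) \<le> C"
    proof -
      have "(\<Sum>m\<in>F2. cmod (complex_of_real (c m))) \<le> (\<Sum>m\<in>F2. ?k (m - m0) / \<delta>)"
        by (intro sum_mono) (use c0 in auto)
      also have "\<dots> = (\<Sum>m\<in>F2. ?k (m - m0)) / \<delta>" by (simp add: sum_divide_distrib)
      also have "\<dots> \<le> K / \<delta>" by (intro divide_right_mono K F2 cos) (use \<delta> in auto)
      finally have "(\<Sum>m\<in>F2. cmod (complex_of_real (c m))) * C2 \<le> K / \<delta> * C2"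
        using C2 by (rule mult_right_mono)
      then show ?thesis unfolding C_def sum_distrib_right[symmetric] norm_minus_cancel norm_one mult_1_left one_add_one
        by - (rule add_left_mono, rule mult_right_mono, assumption, simp)
    qed
    ultimately have "trig_dual (\<epsilon>2 + \<epsilon>) C \<Psi>" by (rule trig_dual_mono[OF _ order_refl])
    moreover have "\<Psi> (paraboloid m0) = 1"
      by (simp add: \<Psi>_def Q_def lattice_kernel_0)
    moreover have "\<Psi> (paraboloid m) = 0" if m: "m \<in> F2" for m
    proof -
      have "H (paraboloid m) = (\<Sum>m'\<in>F2. if m' = m then complex_of_real (c m) else 0)"
        unfolding H_def by (intro sum.cong) (use G m in auto)
      then have "H (paraboloid m) = complex_of_real (c m)" using F2 m by simp
      moreover have "Q (paraboloid m) = complex_of_real (?k (m - m0))" by (simp add: Q_def)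
      ultimately have "\<Psi> (paraboloid m) = complex_of_real (?k (m - m0) - c m * (1 - ?k (m - m0)))"
        by (simp add: \<Psi>_def)
      also have "c m * (1 - ?k (m - m0)) = ?k (m - m0)"
        using gap[OF m] \<delta>(1) by (simp add: c_def)
      finally show ?thesis by simp
    qed
    ultimately show "\<exists>\<Psi>. trig_dual (\<epsilon>2 + \<epsilon>) C \<Psi> \<and> \<Psi> (paraboloid m0) = 1 \<and> (\<forall>m\<in>F2. \<Psi> (paraboloid m) = 0)"
      by blast
  qed
qed

lemma interpE:
  assumes "interp v X \<epsilon>" "0 \<le> \<epsilon>"
  obtains C where "0 \<le> C" "\<And>F m0. finite F \<Longrightarrow> F \<subseteq> X \<Longrightarrow> (\<And>m m'. m \<in> F \<Longrightarrow> m' \<in> F \<Longrightarrow> m - m' \<in> \<Gamma>) \<Longrightarrow> m0 \<in> F \<Longrightarrow>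
     isolable \<epsilon> C F m0"
proof -
  obtain C where C: "\<And>F m0. finite F \<and> F \<subseteq> X \<and> (\<forall>m\<in>F. \<forall>m'\<in>F. m - m' \<in> dual_lattice v) \<and> m0 \<in> F \<Longrightarrow>
     isolable \<epsilon> C F m0"
    using assms(1) unfolding interp_def by (elim exE) (rule that, blast)
  show thesis
  proof (rule that[of "max C 0"])
    fix F m0 assume "finite F" "F \<subseteq> X" "\<And>m m'. m \<in> F \<Longrightarrow> m' \<in> F \<Longrightarrow> m - m' \<in> \<Gamma>" "m0 \<in> F"
    then have "isolable \<epsilon> C F m0"
      by (intro C) auto
    then obtain \<Phi> where \<Phi>: "trig_dual \<epsilon> C \<Phi>" "\<Phi> (paraboloid m0) = 1" "\<forall>m\<in>F - {m0}. \<Phi> (paraboloid m) = 0"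
      by (elim exE conjE)
    then show "isolable \<epsilon> (max C 0) F m0"
      using trig_dual_mono[OF \<Phi>(1) order_refl, of "max C 0"] by (intro exI[of _ \<Phi>] conjI) auto
  qed simp
qed

text \<open>A functional isolating \<open>m0\<close> inside its own piece is multiplied by one that
  equals 1 at \<open>m0\<close> and vanishes on the remaining frequencies. The second one comes from
  \<open>union_step\<close> and accounts for the additional \<open>\<epsilon>\<close>.\<close>

lemma interp_Un:
  assumes X1: "interp v X1 \<epsilon>1" and X2: "interp v X2 \<epsilon>2" and e: "0 \<le> \<epsilon>1" "0 \<le> \<epsilon>2" "0 < \<epsilon>"
  shows "interp v (X1 \<union> X2) (\<epsilon>1 + \<epsilon>2 + \<epsilon>)"
proof -
  obtain C1 where C1: "0 \<le> C1" "\<And>F m0. finite F \<Longrightarrow> F \<subseteq> X1 \<Longrightarrow> (\<And>m m'. m \<in> F \<Longrightarrow> m' \<in> F \<Longrightarrow> m - m' \<in> \<Gamma>) \<Longrightarrow> m0 \<in> F \<Longrightarrow>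
     isolable \<epsilon>1 C1 F m0"
    by (rule interpE[OF X1 e(1)]) blast
  obtain C2 where C2: "0 \<le> C2" "\<And>F m0. finite F \<Longrightarrow> F \<subseteq> X2 \<Longrightarrow> (\<And>m m'. m \<in> F \<Longrightarrow> m' \<in> F \<Longrightarrow> m - m' \<in> \<Gamma>) \<Longrightarrow> m0 \<in> F \<Longrightarrow>
     isolable \<epsilon>2 C2 F m0"
    by (rule interpE[OF X2 e(2)]) blast
  obtain D1 where D1: "0 \<le> D1" "\<And>F2 m0. finite F2 \<Longrightarrow> F2 \<subseteq> X1 \<Longrightarrow> m0 \<notin> F2 \<Longrightarrow>
      (\<And>m m'. m \<in> insert m0 F2 \<Longrightarrow> m' \<in> insert m0 F2 \<Longrightarrow> m - m' \<in> \<Gamma>) \<Longrightarrow>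
     \<exists>\<Psi>. trig_dual (\<epsilon>1 + \<epsilon>) D1 \<Psi> \<and> \<Psi> (paraboloid m0) = 1 \<and> (\<forall>m\<in>F2. \<Psi> (paraboloid m) = 0)"
    by (rule union_step[OF e(3,1) C1]) blast+
  obtain D2 where D2: "0 \<le> D2" "\<And>F2 m0. finite F2 \<Longrightarrow> F2 \<subseteq> X2 \<Longrightarrow> m0 \<notin> F2 \<Longrightarrow>
      (\<And>m m'. m \<in> insert m0 F2 \<Longrightarrow> m' \<in> insert m0 F2 \<Longrightarrow> m - m' \<in> \<Gamma>) \<Longrightarrow>
     \<exists>\<Psi>. trig_dual (\<epsilon>2 + \<epsilon>) D2 \<Psi> \<and> \<Psi> (paraboloid m0) = 1 \<and> (\<forall>m\<in>F2. \<Psi> (paraboloid m) = 0)"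
    by (rule union_step[OF e(3,2) C2]) blast+
  define C where "C = max (C1 * D2) (C2 * D1)"
  show ?thesis
    unfolding interp_def
  proof (rule exI[of _ C], intro allI impI)
    fix F m0
    assume "finite F \<and> F \<subseteq> X1 \<union> X2 \<and> (\<forall>m\<in>F. \<forall>m'\<in>F. m - m' \<in> \<Gamma>) \<and> m0 \<in> F"
    then have F: "finite F" "F \<subseteq> X1 \<union> X2" "\<And>m m'. m \<in> F \<Longrightarrow> m' \<in> F \<Longrightarrow> m - m' \<in> \<Gamma>" "m0 \<in> F" by auto
    show "isolable (\<epsilon>1 + \<epsilon>2 + \<epsilon>) C F m0"
    proof (cases "m0 \<in> X1")
      case True
      obtain \<Phi> where \<Phi>: "trig_dual \<epsilon>1 C1 \<Phi>" "\<Phi> (paraboloid m0) = 1" "\<forall>m\<in>F \<inter> X1 - {m0}. \<Phi> (paraboloid m) = 0"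
        using C1(2)[of "F \<inter> X1" m0] F True by auto
      obtain \<Psi> where \<Psi>: "trig_dual (\<epsilon>2 + \<epsilon>) D2 \<Psi>" "\<Psi> (paraboloid m0) = 1" "\<forall>m\<in>F - X1. \<Psi> (paraboloid m) = 0"
        using D2(2)[of "F - X1" m0] F True by auto
      have "trig_dual (\<epsilon>1 + \<epsilon>2 + \<epsilon>) C (\<lambda>l. \<Phi> l * \<Psi> l)"
        by (rule trig_dual_mono[OF trig_dual_mult[OF \<Phi>(1) \<Psi>(1)]]) (auto simp: C_def)
      moreover have "\<Phi> (paraboloid m) * \<Psi> (paraboloid m) = 0" if "m \<in> F - {m0}" for m
        using \<Phi>(3) \<Psi>(3) that by (cases "m \<in> X1") auto
      ultimately show ?thesis using \<Phi>(2) \<Psi>(2) by (intro exI[of _ "\<lambda>l. \<Phi> l * \<Psi> l"]) simp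
    next
      case False
      then have m0: "m0 \<in> X2" using F by auto
      obtain \<Phi> where \<Phi>: "trig_dual \<epsilon>2 C2 \<Phi>" "\<Phi> (paraboloid m0) = 1" "\<forall>m\<in>F \<inter> X2 - {m0}. \<Phi> (paraboloid m) = 0"
        using C2(2)[of "F \<inter> X2" m0] F m0 by auto
      obtain \<Psi> where \<Psi>: "trig_dual (\<epsilon>1 + \<epsilon>) D1 \<Psi>" "\<Psi> (paraboloid m0) = 1" "\<forall>m\<in>F - X2. \<Psi> (paraboloid m) = 0"
        using D1(2)[of "F - X2" m0] F m0 by auto
      have "trig_dual (\<epsilon>1 + \<epsilon>2 + \<epsilon>) C (\<lambda>l. \<Phi> l * \<Psi> l)"
        by (rule trig_dual_mono[OF trig_dual_mult[OF \<Phi>(1) \<Psi>(1)]]) (auto simp: C_def)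
      moreover have "\<Phi> (paraboloid m) * \<Psi> (paraboloid m) = 0" if "m \<in> F - {m0}" for m
        using \<Phi>(3) \<Psi>(3) that by (cases "m \<in> X2") auto
      ultimately show ?thesis using \<Phi>(2) \<Psi>(2) by (intro exI[of _ "\<lambda>l. \<Phi> l * \<Psi> l"]) simp
    qed
  qed
qed

lemma interp_empty: "interp v {} \<epsilon>"
  unfolding interp_def by auto

text \<open>Every union adds radii, so each piece must be interpolable at all radii; the available
  radius is then split into thirds.\<close>

lemma interp_UN:
  assumes "finite I" "\<And>i \<epsilon>. i \<in> I \<Longrightarrow> 0 < \<epsilon> \<Longrightarrow> interp v (X i) \<epsilon>" "0 < \<epsilon>"
  shows "interp v (\<Union>i\<in>I. X i) \<epsilon>"
  using assms
proof (induction I arbitrary: \<epsilon>)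
  case empty
  then show ?case by (simp add: interp_empty)
next
  case (insert i I)
  have "interp v (X i \<union> (\<Union>i\<in>I. X i)) (\<epsilon>/3 + \<epsilon>/3 + \<epsilon>/3)"
    by (rule interp_Un) (use insert in auto)
  then show ?case by simp
qed

text \<open>The translates of one functional form a matrix that is close to the identity:
  differences outside a finite set have small total kernel mass, and the finitely many others are
  damped by averaging in time because their time frequencies are far apart.\<close>

lemma interp_nonresonant:
  assumes e: "0 < \<epsilon>"
  obtains F0 R where "finite F0" "F0 \<subseteq> \<Gamma> - {0}"
    "\<And>X. (\<And>m m'. m \<in> X \<Longrightarrow> m' \<in> X \<Longrightarrow> m' - m \<in> F0 \<Longrightarrow> R \<le> \<bar>(norm m')\<^sup>2 - (norm m)\<^sup>2\<bar>) \<Longrightarrow> interp v X \<epsilon>"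
proof -
  define \<sigma> where "\<sigma> = kernel_width (\<epsilon>/2)"
  have \<sigma>: "0 < \<sigma>" using kernel_width_pos[of "\<epsilon>/2"] e by (simp add: \<sigma>_def)
  let ?k = "lattice_kernel v \<sigma>"
  obtain G where G: "finite G" "G \<subseteq> \<Gamma>" "dist (sum ?k G) (infsum ?k \<Gamma>) \<le> 1/4"
    using infsum_finite_approximation[OF kernel_summable[OF \<sigma>], of "1/4"] by auto
  define F0 where "F0 = G - {0}"
  define \<tau> where "\<tau> = \<epsilon> / 2"
  \<comment> \<open>Each of the at most \<open>card F0\<close> differences in \<open>F0\<close>
    contributes at most \<open>1 / (\<tau> * R)\<close>, so together they stay below 1/4. The kernel
    mass outside \<open>G\<close> gives the other quarter of the column bound 1/2.\<close>
  define R where "R = 4 * (card F0 + 1) / \<tau>"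
  have \<tau>: "0 < \<tau>" and R: "0 < R" using e by (auto simp: \<tau>_def R_def)
  have tail: "sum ?k A \<le> 1/4" if "finite A" "A \<subseteq> \<Gamma> - G" for A
  proof -
    have "sum ?k A + sum ?k G = sum ?k (A \<union> G)"
      using that G(1) by (subst sum.union_disjoint) auto
    also have "\<dots> \<le> infsum ?k \<Gamma>"
      by (intro finite_sum_le_infsum kernel_summable \<sigma>) (use that G in \<open>auto simp: lattice_kernel_nonneg\<close>)
    finally show ?thesis using G(3) unfolding dist_real_def by linarith
  qed
  define \<phi> where "\<phi> = (\<lambda>l::'a \<times> real. complex_of_real (?k (fst l)) * complex_of_real (sinc (\<tau> * snd l)))"
  have td: "trig_dual \<epsilon> 1 \<phi>"
  proof -
    have "trig_dual \<tau> 1 (\<lambda>l::'a \<times> real. complex_of_real (sinc (l \<bullet> (0, \<tau>))))"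
      by (rule trig_dual_sinc) (use \<tau> in \<open>simp add: norm_Pair\<close>)
    then have 1: "trig_dual \<tau> 1 (\<lambda>l::'a \<times> real. complex_of_real (sinc (\<tau> * snd l)))"
      by (simp only: inner_prod_def fst_conv snd_conv inner_zero_right add_0_left inner_real_def mult.commute)
    have "trig_dual (\<epsilon>/2) 1 (\<lambda>l::'a \<times> real. complex_of_real (?k (fst l)))"
      unfolding \<sigma>_def by (rule trig_dual_kernel) (use e in simp)
    from trig_dual_mult[OF this 1] show ?thesis by (simp add: \<phi>_def \<tau>_def)
  qed
  have \<phi>0: "\<phi> 0 = 1" by (simp add: \<phi>_def lattice_kernel_0)
  have \<phi>le: "cmod (\<phi> l) \<le> ?k (fst l)" for l
  proof -
    have "cmod (\<phi> l) = ?k (fst l) * \<bar>sinc (\<tau> * snd l)\<bar>"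
      by (simp only: \<phi>_def norm_mult norm_of_real abs_of_nonneg[OF lattice_kernel_nonneg])
    also have "\<dots> \<le> ?k (fst l) * 1" by (rule mult_left_mono[OF abs_sinc_le_1 lattice_kernel_nonneg])
    finally show ?thesis by simp
  qed
  have \<phi>R: "cmod (\<phi> l) \<le> 1 / (\<tau> * R)" if "R \<le> \<bar>snd l\<bar>" for l
  proof -
    have "\<bar>sinc (\<tau> * snd l)\<bar> \<le> 1 / \<bar>\<tau> * snd l\<bar>" using that \<tau> R by (intro abs_sinc_le_inverse) auto
    also have "\<dots> \<le> 1 / (\<tau> * R)" using that \<tau> R by (intro divide_left_mono) (auto simp: abs_mult)
    finally have s: "\<bar>sinc (\<tau> * snd l)\<bar> \<le> 1 / (\<tau> * R)" .
    have "cmod (\<phi> l) = ?k (fst l) * \<bar>sinc (\<tau> * snd l)\<bar>"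
      by (simp only: \<phi>_def norm_mult norm_of_real abs_of_nonneg[OF lattice_kernel_nonneg])
    also have "\<dots> \<le> 1 * (1 / (\<tau> * R))" by (rule mult_mono[OF lattice_kernel_le_1 s]) auto
    finally show ?thesis by simp
  qed
  show thesis
  proof (rule that[of F0 R])
    show "finite F0" "F0 \<subseteq> \<Gamma> - {0}" using G by (auto simp: F0_def)
    fix X assume X: "\<And>m m'. m \<in> X \<Longrightarrow> m' \<in> X \<Longrightarrow> m' - m \<in> F0 \<Longrightarrow> R \<le> \<bar>(norm m')\<^sup>2 - (norm m)\<^sup>2\<bar>"
    show "interp v X \<epsilon>"
      unfolding interp_def
    proof (rule exI[of _ 2], intro allI impI)
      fix F m0
      assume "finite F \<and> F \<subseteq> X \<and> (\<forall>m\<in>F. \<forall>m'\<in>F. m - m' \<in> \<Gamma>) \<and> m0 \<in> F"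
      then have F: "finite F" "F \<subseteq> X" "\<And>m m'. m \<in> F \<Longrightarrow> m' \<in> F \<Longrightarrow> m - m' \<in> \<Gamma>" "m0 \<in> F" by auto
      \<comment> \<open>The off-diagonal part of the matrix of values of the translates; its
        diagonal is 1 because \<open>\<phi> 0 = 1\<close>.\<close>
      define E where "E = (\<lambda>m m'. if m = m' then 0 else \<phi> (paraboloid m - paraboloid m'))"
      have E: "(\<Sum>m\<in>F. cmod (E m m')) \<le> 1/2" if m': "m' \<in> F" for m'
      proof -
        let ?A = "{m\<in>F. m - m' \<in> F0}" and ?B = "{m\<in>F. m - m' \<notin> F0 \<and> m \<noteq> m'}"
        have "(\<Sum>m\<in>F. cmod (E m m')) = (\<Sum>m\<in>?A \<union> ?B. cmod (E m m'))"
          by (rule sum.mono_neutral_right) (use F in \<open>auto simp: E_def\<close>)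
        also have "\<dots> = (\<Sum>m\<in>?A. cmod (E m m')) + (\<Sum>m\<in>?B. cmod (E m m'))"
          by (rule sum.union_disjoint) (use F in auto)
        also have "(\<Sum>m\<in>?B. cmod (E m m')) \<le> (\<Sum>m\<in>?B. ?k (m - m'))"
        proof (rule sum_mono)
          fix m assume "m \<in> ?B"
          then show "cmod (E m m') \<le> ?k (m - m')"
            using \<phi>le[of "paraboloid m - paraboloid m'"] by (auto simp: E_def)
        qed
        also have "\<dots> = sum ?k ((\<lambda>m. m - m') ` ?B)"
          by (subst sum.reindex) (auto simp: inj_on_def)
        also have "\<dots> \<le> 1/4" by (rule tail) (use F m' in \<open>auto simp: F0_def\<close>)
        also have "(\<Sum>m\<in>?A. cmod (E m m')) \<le> (\<Sum>m\<in>?A. 1 / (\<tau> * R))"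
        proof (rule sum_mono)
          fix m assume m: "m \<in> ?A"
          have "R \<le> \<bar>(norm m)\<^sup>2 - (norm m')\<^sup>2\<bar>" by (rule X) (use m m' F in auto)
          then have "R \<le> \<bar>snd (paraboloid m - paraboloid m')\<bar>" by (simp add: abs_minus_commute)
          from \<phi>R[OF this] show "cmod (E m m') \<le> 1 / (\<tau> * R)" using \<tau> R by (auto simp: E_def)
        qed
        also have "\<dots> \<le> real (card F0) * (1 / (\<tau> * R))"
        proof -
          have "card ((\<lambda>m. m - m') ` ?A) \<le> card F0" by (rule card_mono) (use G in \<open>auto simp: F0_def\<close>)
          moreover have "card ((\<lambda>m. m - m') ` ?A) = card ?A" by (rule card_image) (auto simp: inj_on_def)
          ultimately have "real (card ?A) \<le> real (card F0)" by simp
          then have "real (card ?A) * (1 / (\<tau> * R)) \<le> real (card F0) * (1 / (\<tau> * R))"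
            by (rule mult_right_mono) (use \<tau> R in auto)
          then show ?thesis by simp
        qed
        also have "\<dots> = real (card F0) / (4 * (real (card F0) + 1))" using \<tau> by (simp add: R_def)
        also have "\<dots> \<le> 1/4" by (simp add: field_simps)
        finally show ?thesis by simp
      qed
      obtain b where b: "\<And>m. m \<in> F \<Longrightarrow> b m + (\<Sum>m'\<in>F. E m m' * b m') = (if m = m0 then 1 else 0)"
        "(\<Sum>m\<in>F. cmod (b m)) \<le> 2"
        by (rule neumann_column_dominant[OF F(1,4) E]) auto
      define \<Phi> where "\<Phi> = (\<lambda>l. \<Sum>m'\<in>F. b m' * \<phi> (l - paraboloid m'))"
      have "trig_dual \<epsilon> (\<Sum>m'\<in>F. cmod (b m') * 1) \<Phi>"
        unfolding \<Phi>_def using e by (intro trig_dual_sum trig_dual_scale trig_dual_shift td F) auto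
      then have "trig_dual \<epsilon> 2 \<Phi>" by (rule trig_dual_mono) (use b in auto)
      moreover have "\<Phi> (paraboloid m) = (if m = m0 then 1 else 0)" if m: "m \<in> F" for m
      proof -
        have "\<Phi> (paraboloid m) = (\<Sum>m'\<in>F. (if m' = m then b m else 0) + E m m' * b m')"
          unfolding \<Phi>_def by (intro sum.cong) (auto simp: E_def \<phi>0)
        also have "\<dots> = b m + (\<Sum>m'\<in>F. E m m' * b m')" using m F by (simp add: sum.distrib)
        finally show ?thesis using b(1)[OF m] by simp
      qed
      ultimately show "isolable \<epsilon> 2 F m0"
        using F(4) by (intro exI[of _ \<Phi>]) auto
    qed
  qed
qed

end

section \<open>Resonant directions and the induction on codimension\<close>

context lattice_frame
begin

lemma \<Gamma>_min_norm:
  obtains r where "0 < r" "\<And>h. h \<in> \<Gamma> \<Longrightarrow> h \<noteq> 0 \<Longrightarrow> r \<le> norm h"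
proof (rule that[of "2 * pi / (\<Sum>j\<in>Basis. norm (v j))"])
  show "0 < 2 * pi / (\<Sum>j\<in>Basis. norm (v j))" using sum_norm_pos by simp
  fix h assume "h \<in> \<Gamma>" "h \<noteq> 0"
  then obtain j where j: "j \<in> Basis" "2 * pi \<le> \<bar>h \<bullet> v j\<bar>" by (rule \<Gamma>_nonzero)
  have "\<bar>h \<bullet> v j\<bar> \<le> norm h * norm (v j)" by (rule Cauchy_Schwarz_ineq2)
  also have "\<dots> \<le> norm h * (\<Sum>j\<in>Basis. norm (v j))"
    by (intro mult_left_mono member_le_sum) (use j in auto)
  finally show "2 * pi / (\<Sum>j\<in>Basis. norm (v j)) \<le> norm h"
    using j(2) sum_norm_pos by (simp add: pos_divide_le_eq)
qed

text \<open>On \<open>span H\<close> the sum of the moduli of the inner products with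
  \<open>H\<close> vanishes only at 0, so by compactness of the unit sphere it dominates a multiple
  of the norm. Nonzero elements of \<open>\<Gamma>\<close> have norm at least
  \<open>r\<close>.\<close>

lemma \<Gamma>_span_gap:
  assumes "finite H"
  obtains \<delta> where "0 < \<delta>" "\<And>\<gamma>. \<gamma> \<in> \<Gamma> \<Longrightarrow> \<gamma> \<in> span H \<Longrightarrow> (\<And>h. h \<in> H \<Longrightarrow> \<bar>\<gamma> \<bullet> h\<bar> < \<delta>) \<Longrightarrow> \<gamma> = 0"
proof -
  obtain r where r: "0 < r" "\<And>h. h \<in> \<Gamma> \<Longrightarrow> h \<noteq> 0 \<Longrightarrow> r \<le> norm h" using \<Gamma>_min_norm by metis
  let ?K = "sphere 0 1 \<inter> span H" and ?f = "\<lambda>\<gamma>. \<Sum>h\<in>H. \<bar>\<gamma> \<bullet> h\<bar>"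
  obtain c where c: "0 < c" "\<And>x. x \<in> ?K \<Longrightarrow> c \<le> ?f x"
  proof (cases "?K = {}")
    case True
    then show thesis using that[of 1] by auto
  next
    case False
    have "compact ?K" by (intro compact_Int_closed compact_sphere closed_span)
    moreover have "continuous_on ?K ?f" by (intro continuous_intros)
    ultimately obtain x where x: "x \<in> ?K" "\<forall>y\<in>?K. ?f x \<le> ?f y"
      using continuous_attains_inf[of ?K ?f] False by blast
    have "?f x \<noteq> 0"
    proof
      assume "?f x = 0"
      then have "\<forall>h\<in>H. x \<bullet> h = 0" using assms by (simp add: sum_nonneg_eq_0_iff)
      then have "orthogonal x y" if "y \<in> span H" for y
        using that by (intro orthogonal_to_span[of y H x]) (auto simp: orthogonal_def)
      then have "x \<bullet> x = 0" using x(1) by (auto simp: orthogonal_def)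
      then show False using x(1) by auto
    qed
    then have "0 < ?f x" by (simp add: sum_nonneg less_le)
    then show thesis using that[of "?f x"] x(2) by blast
  qed
  \<comment> \<open>Fewer than \<open>card H + 1\<close> summands below \<open>\<delta>\<close>
    cannot reach \<open>c * r\<close>; the added 1 also admits an empty \<open>H\<close>.\<close>
  define \<delta> where "\<delta> = c * r / (card H + 1)"
  show thesis
  proof (rule that[of \<delta>])
    show "0 < \<delta>" using c r by (simp add: \<delta>_def)
    fix \<gamma> assume g: "\<gamma> \<in> \<Gamma>" "\<gamma> \<in> span H" and s: "\<And>h. h \<in> H \<Longrightarrow> \<bar>\<gamma> \<bullet> h\<bar> < \<delta>"
    show "\<gamma> = 0"
    proof (rule ccontr)
      assume nz: "\<gamma> \<noteq> 0"
      have "(1 / norm \<gamma>) *\<^sub>R \<gamma> \<in> ?K" using g nz by (auto intro: span_mul)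
      from c(2)[OF this] have "c \<le> ?f \<gamma> / norm \<gamma>" by (simp add: abs_mult sum_divide_distrib)
      then have "c * norm \<gamma> \<le> ?f \<gamma>" using nz by (simp add: field_simps)
      moreover have "c * r \<le> c * norm \<gamma>" using r(2)[OF g(1) nz] c(1) by simp
      moreover have "?f \<gamma> \<le> (\<Sum>h\<in>H. \<delta>)" by (intro sum_mono less_imp_le s)
      moreover have "(\<Sum>h\<in>H. \<delta>) < c * r"
        using c(1) r(1) by (simp add: \<delta>_def field_simps)
      ultimately show False by linarith
    qed
  qed
qed

text \<open>Resonances \<open>h \<notin> span H\<close> confine \<open>m \<bullet> h\<close> to a bounded set, so that \<open>h\<close> can be added to \<open>H\<close>;
  on pieces where all \<open>m \<bullet> h\<close> nearly agree there are no resonances \<open>h \<in> span H\<close>.\<close>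

lemma interp_bounded_inner:
  assumes "finite H" "\<And>h. h \<in> H \<Longrightarrow> \<exists>B. \<forall>m\<in>X. \<bar>m \<bullet> h\<bar> \<le> B" "0 < \<epsilon>"
  shows "interp v X \<epsilon>"
  using assms
\<comment> \<open>A direction outside \<open>span H\<close> raises the dimension by one, so the
  hypothesis applies to the slab \<open>Z h\<close>. If \<open>span H\<close> is the whole space
  there is no such direction and \<open>bad\<close> is empty, so no base case is needed.\<close>
proof (induction "DIM('a) - dim H" arbitrary: H X \<epsilon> rule: less_induct)
  case less
  note H = less.prems(1) and bd = less.prems(2)
  obtain \<delta> where \<delta>: "0 < \<delta>" "\<And>\<gamma>. \<gamma> \<in> \<Gamma> \<Longrightarrow> \<gamma> \<in> span H \<Longrightarrow> (\<And>h. h \<in> H \<Longrightarrow> \<bar>\<gamma> \<bullet> h\<bar> < \<delta>) \<Longrightarrow> \<gamma> = 0"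
    using \<Gamma>_span_gap[OF H] by metis
  have thin: "interp v Y \<epsilon>" if e: "0 < \<epsilon>" and YX: "Y \<subseteq> X"
    and Y: "\<And>m m' h. m \<in> Y \<Longrightarrow> m' \<in> Y \<Longrightarrow> h \<in> H \<Longrightarrow> \<bar>m \<bullet> h - m' \<bullet> h\<bar> < \<delta>" for Y \<epsilon>
  proof -
    have "0 < \<epsilon>/3" using e by simp
    then obtain F0 R where F0: "finite F0" "F0 \<subseteq> \<Gamma> - {0}"
      "\<And>X. (\<And>m m'. m \<in> X \<Longrightarrow> m' \<in> X \<Longrightarrow> m' - m \<in> F0 \<Longrightarrow> R \<le> \<bar>(norm m')\<^sup>2 - (norm m)\<^sup>2\<bar>) \<Longrightarrow> interp v X (\<epsilon>/3)"
      using interp_nonresonant by metis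
    define Z where "Z = (\<lambda>h. {m\<in>Y. \<bar>(norm (m + h))\<^sup>2 - (norm m)\<^sup>2\<bar> < R})"
    define bad where "bad = (\<Union>h\<in>F0 - span H. Z h)"
    have "interp v bad (\<epsilon>/3)"
      unfolding bad_def
    proof (rule interp_UN)
      fix h \<epsilon>' assume h: "h \<in> F0 - span H" and e': "0 < (\<epsilon>'::real)"
      show "interp v (Z h) \<epsilon>'"
      proof (rule less.hyps[of "insert h H"])
        have "dim (insert h H) = dim H + 1" using h by (simp add: dim_insert)
        moreover have "dim (insert h H) \<le> DIM('a)" by (rule dim_subset_UNIV)
        ultimately show "DIM('a) - dim (insert h H) < DIM('a) - dim H" by linarith
        fix k assume "k \<in> insert h H"
        then show "\<exists>B. \<forall>m\<in>Z h. \<bar>m \<bullet> k\<bar> \<le> B"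
        proof
          assume k: "k = h"
          have "\<bar>m \<bullet> h\<bar> \<le> R + (norm h)\<^sup>2" if "m \<in> Z h" for m
          proof -
            have "(norm (m + h))\<^sup>2 = (norm m)\<^sup>2 + 2 * (m \<bullet> h) + (norm h)\<^sup>2"
              by (simp add: power2_norm_eq_inner inner_add_left inner_add_right inner_commute)
            then have "\<bar>2 * (m \<bullet> h) + (norm h)\<^sup>2\<bar> < R" using that by (simp add: Z_def)
            then show ?thesis using zero_le_power2[of "norm h"] by linarith
          qed
          then show ?thesis using k by blast
        next
          assume "k \<in> H"
          then obtain B where "\<forall>m\<in>X. \<bar>m \<bullet> k\<bar> \<le> B" using bd by blast
          then show ?thesis using YX by (intro exI[of _ B]) (auto simp: Z_def)
        qed
      qed (use H e' in auto)
    qed (use F0 e in auto)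
    moreover have "interp v (Y - bad) (\<epsilon>/3)"
    proof (rule F0(3))
      fix m m' assume m: "m \<in> Y - bad" "m' \<in> Y - bad" "m' - m \<in> F0"
      have "m' - m \<notin> span H"
      proof
        assume "m' - m \<in> span H"
        then have "m' - m = 0"
          using F0(2) m Y[of m' m] by (intro \<delta>(2)) (auto simp: inner_diff_left)
        then show False using F0(2) m by auto
      qed
      then have "m \<notin> Z (m' - m)" using m unfolding bad_def by blast
      then show "R \<le> \<bar>(norm m')\<^sup>2 - (norm m)\<^sup>2\<bar>" using m by (simp add: Z_def)
    qed
    ultimately have "interp v ((Y - bad) \<union> bad) (\<epsilon>/3 + \<epsilon>/3 + \<epsilon>/3)"
      using e by (intro interp_Un) auto
    then show ?thesis by (rule interp_mono) (use e in auto)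
  qed
  have "\<exists>B. \<forall>h\<in>H. \<forall>m\<in>X. \<bar>m \<bullet> h\<bar> \<le> B h" using bd by (intro bchoice) blast
  then obtain B where B: "\<And>h m. h \<in> H \<Longrightarrow> m \<in> X \<Longrightarrow> \<bar>m \<bullet> h\<bar> \<le> B h" by blast
  \<comment> \<open>The cell of \<open>m\<close> records its inner products with \<open>H\<close> up
    to an error below \<open>\<delta>\<close>. Boundedness of these inner products on
    \<open>X\<close> leaves finitely many cells.\<close>
  define c where "c = (\<lambda>m. restrict (\<lambda>h. \<lfloor>m \<bullet> h / \<delta>\<rfloor>) H)"
  have "c ` X \<subseteq> Pi\<^sub>E H (\<lambda>h. {\<lfloor>- B h / \<delta>\<rfloor>..\<lfloor>B h / \<delta>\<rfloor>})"
  proof -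
    have "\<lfloor>- B h / \<delta>\<rfloor> \<le> \<lfloor>m \<bullet> h / \<delta>\<rfloor> \<and> \<lfloor>m \<bullet> h / \<delta>\<rfloor> \<le> \<lfloor>B h / \<delta>\<rfloor>" if "m \<in> X" "h \<in> H" for m h
      using B[OF that(2,1)] \<delta>(1) by (intro conjI floor_mono divide_right_mono) auto
    then show ?thesis by (auto simp: c_def)
  qed
  then have fin: "finite (c ` X)" by (rule finite_subset) (use H in \<open>auto intro!: finite_PiE\<close>)
  have "interp v (\<Union>g\<in>c ` X. {m\<in>X. c m = g}) \<epsilon>"
  proof (rule interp_UN[OF fin])
    fix g and \<epsilon>'::real assume e': "0 < \<epsilon>'"
    show "interp v {m\<in>X. c m = g} \<epsilon>'"
    proof (rule thin[OF e'])
      fix m m' h assume m: "m \<in> {m\<in>X. c m = g}" "m' \<in> {m\<in>X. c m = g}" and h: "h \<in> H"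
      have "c m h = c m' h" using m by simp
      then have "\<lfloor>m \<bullet> h / \<delta>\<rfloor> = \<lfloor>m' \<bullet> h / \<delta>\<rfloor>" using h by (simp add: c_def)
      then have "\<bar>m \<bullet> h / \<delta> - m' \<bullet> h / \<delta>\<bar> < 1" by linarith
      then have "\<bar>(m \<bullet> h - m' \<bullet> h) / \<delta>\<bar> < 1" by (simp add: diff_divide_distrib)
      then show "\<bar>m \<bullet> h - m' \<bullet> h\<bar> < \<delta>" using \<delta>(1) by (simp add: abs_divide)
    qed auto
  qed (rule less.prems(3))
  then show ?case by (rule interp_mono) auto
qed

text \<open>With no directions prescribed, the boundedness hypothesis is vacuous.\<close>

lemma interp_UNIV: "0 < \<epsilon> \<Longrightarrow> interp v UNIV \<epsilon>"
  by (rule interp_bounded_inner[of "{}"]) auto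

text \<open>A functional that isolates \<open>m0\<close> returns exactly the coefficient
  \<open>a m0\<close> when it is applied to the sum.\<close>

lemma coefficient_bound_sup:
  assumes e: "0 < \<epsilon>"
  obtains C where "0 \<le> C" "\<And>F m0 a M. finite F \<Longrightarrow> (\<And>m m'. m \<in> F \<Longrightarrow> m' \<in> F \<Longrightarrow> m - m' \<in> \<Gamma>) \<Longrightarrow> m0 \<in> F \<Longrightarrow>
     (\<And>y. norm y \<le> \<epsilon> \<Longrightarrow> cmod (\<Sum>m\<in>F. a m * cis (paraboloid m \<bullet> y)) \<le> M) \<Longrightarrow> cmod (a m0) \<le> C * M"
proof -
  obtain C where C: "0 \<le> C" "\<And>F m0. finite F \<Longrightarrow> F \<subseteq> UNIV \<Longrightarrow> (\<And>m m'. m \<in> F \<Longrightarrow> m' \<in> F \<Longrightarrow> m - m' \<in> \<Gamma>) \<Longrightarrow> m0 \<in> F \<Longrightarrow>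
     isolable \<epsilon> C F m0"
    by (rule interpE[OF interp_UNIV[OF e]]) (use e in \<open>auto\<close>)
  show thesis
  proof (rule that[OF C(1)])
    fix F m0 a M
    assume F: "finite F" "\<And>m m'. m \<in> F \<Longrightarrow> m' \<in> F \<Longrightarrow> m - m' \<in> \<Gamma>" "m0 \<in> F"
      and b: "\<And>y. norm y \<le> \<epsilon> \<Longrightarrow> cmod (\<Sum>m\<in>F. a m * cis (paraboloid m \<bullet> y)) \<le> M"
    obtain \<Phi> where \<Phi>: "trig_dual \<epsilon> C \<Phi>" "\<Phi> (paraboloid m0) = 1" "\<forall>m\<in>F - {m0}. \<Phi> (paraboloid m) = 0"
      using C(2)[OF F(1) _ F(2,3)] by auto
    have re: "(\<Sum>l\<in>paraboloid ` F. a (fst l) * G l) = (\<Sum>m\<in>F. a m * G (paraboloid m))" for G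
      by (subst sum.reindex) (auto simp: inj_on_def)
    have "cmod (\<Sum>l\<in>paraboloid ` F. a (fst l) * \<Phi> l) \<le> C * M"
      by (rule trig_dualD[OF \<Phi>(1)]) (use F b in \<open>auto simp: re\<close>)
    moreover have "(\<Sum>m\<in>F. a m * \<Phi> (paraboloid m)) = (\<Sum>m\<in>F. if m = m0 then a m0 else 0)"
      by (intro sum.cong) (use \<Phi> in auto)
    ultimately show "cmod (a m0) \<le> C * M" using F by (simp add: re)
  qed
qed

end

text \<open>This is nonnegativity of the variance of \<open>g\<close> about its mean
  \<open>c\<close>.\<close>

lemma set_average_square_le:
  fixes g :: "'b::euclidean_space \<Rightarrow> real"
  assumes Z: "compact Z" "0 < measure lborel Z" and g: "continuous_on Z g"
  shows "((LINT z:Z|lborel. g z) / measure lborel Z)\<^sup>2 \<le> (LINT z:Z|lborel. (g z)\<^sup>2) / measure lborel Z"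
proof -
  define \<mu> where "\<mu> = measure lborel Z"
  define c where "c = (LINT z:Z|lborel. g z) / \<mu>"
  have i: "set_integrable lborel Z f" if "continuous_on Z f" for f :: "'b \<Rightarrow> real"
    using borel_integrable_compact[OF Z(1) that] by (simp add: set_integrable_def)
  have k: "(LINT z:Z|lborel. k) = k * \<mu>" for k :: real
    using Z emeasure_compact_finite[OF Z(1)]
    by (simp add: set_lebesgue_integral_def \<mu>_def borel_compact mult.commute)
  have "0 \<le> (LINT z:Z|lborel. (g z - c)\<^sup>2)"
    unfolding set_lebesgue_integral_def by (intro Bochner_Integration.integral_nonneg) auto
  also have "(LINT z:Z|lborel. (g z - c)\<^sup>2) = (LINT z:Z|lborel. ((g z)\<^sup>2 - (2 * c) * g z) + c\<^sup>2)"
    by (simp add: power2_diff algebra_simps)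
  also have "\<dots> = ((LINT z:Z|lborel. (g z)\<^sup>2) - (2 * c) * (LINT z:Z|lborel. g z)) + c\<^sup>2 * \<mu>"
  proof -
    have "(LINT z:Z|lborel. ((g z)\<^sup>2 - (2 * c) * g z) + c\<^sup>2) = (LINT z:Z|lborel. (g z)\<^sup>2 - (2 * c) * g z) + (LINT z:Z|lborel. c\<^sup>2)"
      by (intro set_integral_add i continuous_intros g)
    also have "(LINT z:Z|lborel. (g z)\<^sup>2 - (2 * c) * g z) = (LINT z:Z|lborel. (g z)\<^sup>2) - (LINT z:Z|lborel. (2 * c) * g z)"
      by (intro set_integral_diff i continuous_intros g)
    also have "(LINT z:Z|lborel. (2 * c) * g z) = (2 * c) * (LINT z:Z|lborel. g z)"
      by (rule set_integral_mult_right)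
    finally show ?thesis by (simp only: k)
  qed
  finally have "2 * c * (LINT z:Z|lborel. g z) - c\<^sup>2 * \<mu> \<le> (LINT z:Z|lborel. (g z)\<^sup>2)" by simp
  moreover have "(LINT z:Z|lborel. g z) = c * \<mu>" using Z by (simp add: c_def \<mu>_def)
  ultimately have "c\<^sup>2 * \<mu> \<le> (LINT z:Z|lborel. (g z)\<^sup>2)" by (simp add: power2_eq_square algebra_simps)
  then show ?thesis using Z by (simp add: c_def \<mu>_def pos_le_divide_eq)
qed

section \<open>Single coefficients of exponential sums\<close>

context lattice_frame
begin

text \<open>A sup bound becomes an L2 bound by averaging: half of the radius goes into translations,
  half into the averaging ball. Demodulating at \<open>m0\<close> first keeps the modulus of that
  coefficient. The centre \<open>y0\<close> only introduces phases, so the constant does not depend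
  on it.\<close>

lemma coefficient_bound_L2:
  assumes e: "0 < \<epsilon>"
  obtains C where "0 \<le> C" "\<And>F m0 a y0. finite F \<Longrightarrow> (\<And>m m'. m \<in> F \<Longrightarrow> m' \<in> F \<Longrightarrow> m - m' \<in> \<Gamma>) \<Longrightarrow> m0 \<in> F \<Longrightarrow>
     ennreal ((cmod (a m0))\<^sup>2) \<le> ennreal C *
       (\<integral>\<^sup>+y\<in>cball y0 \<epsilon>. ennreal ((cmod (\<Sum>m\<in>F. a m * cis (paraboloid m \<bullet> y)))\<^sup>2) \<partial>lborel)"
proof -
  define Z where "Z = cball (0::'a \<times> real) (\<epsilon>/2)"
  define \<mu> where "\<mu> = measure lborel Z"
  have Z: "compact Z" by (simp add: Z_def)
  have \<mu>: "0 < \<mu>" unfolding \<mu>_def Z_def by (rule content_cball_pos) (use e in simp)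
  \<comment> \<open>The transform of the uniform probability measure on \<open>Z\<close>, which is 1
    at frequency 0.\<close>
  define A where "A = (\<lambda>l::'a \<times> real. (LINT z:Z|lborel. cis (l \<bullet> z)) / complex_of_real \<mu>)"
  have ic: "set_integrable lborel Z f" if "continuous_on Z f" for f :: "'a \<times> real \<Rightarrow> complex"
    using borel_integrable_compact[OF Z that] by (simp add: set_integrable_def)
  have A0: "A 0 = 1"
    using \<mu> Z emeasure_compact_finite[OF Z] by (simp add: A_def set_lebesgue_integral_def borel_compact \<mu>_def scaleR_conv_of_real)
  have "0 < \<epsilon>/2" using e by simp
  then obtain C where C: "0 \<le> C" "\<And>F m0 a M. finite F \<Longrightarrow> (\<And>m m'. m \<in> F \<Longrightarrow> m' \<in> F \<Longrightarrow> m - m' \<in> \<Gamma>) \<Longrightarrow> m0 \<in> F \<Longrightarrow>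
     (\<And>y. norm y \<le> \<epsilon>/2 \<Longrightarrow> cmod (\<Sum>m\<in>F. a m * cis (paraboloid m \<bullet> y)) \<le> M) \<Longrightarrow> cmod (a m0) \<le> C * M"
    by (rule coefficient_bound_sup) blast
  show thesis
  proof (rule that[of "C\<^sup>2 / \<mu>"])
    show "0 \<le> C\<^sup>2 / \<mu>" using \<mu> by simp
    fix F m0 a y0
    assume F: "finite F" "\<And>m m'. m \<in> F \<Longrightarrow> m' \<in> F \<Longrightarrow> m - m' \<in> \<Gamma>" "m0 \<in> F"
    define u where "u = (\<lambda>y. \<Sum>m\<in>F. a m * cis (paraboloid m \<bullet> y))"
    have u: "continuous_on S u" for S unfolding u_def by (intro continuous_intros)
    define I where "I = (LINT y:cball y0 \<epsilon>|lborel. (cmod (u y))\<^sup>2)"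
    have Ii: "integrable lborel (\<lambda>y. indicator (cball y0 \<epsilon>) y *\<^sub>R (cmod (u y))\<^sup>2)"
      by (rule borel_integrable_compact) (auto intro!: continuous_intros u)
    have I0: "0 \<le> I" unfolding I_def set_lebesgue_integral_def by (intro Bochner_Integration.integral_nonneg) auto
    \<comment> \<open>Coefficients of the demodulated average of \<open>u\<close> around
      \<open>y0\<close>; at \<open>m0\<close> the factor \<open>A\<close> is 1, so only a phase
      distinguishes \<open>a' m0\<close> from \<open>a m0\<close>.\<close>
    define a' where "a' = (\<lambda>m. a m * cis (paraboloid m \<bullet> y0) * A (paraboloid m - paraboloid m0))"
    have bd: "cmod (\<Sum>m\<in>F. a' m * cis (paraboloid m \<bullet> y)) \<le> sqrt (I / \<mu>)" if y: "norm y \<le> \<epsilon>/2" for y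
    proof -
      define w where "w = y0 + y"
      have uw: "continuous_on Z (\<lambda>z. u (w + z))"
        by (rule continuous_on_compose2[OF u[of UNIV]]) (auto intro!: continuous_intros)
      have "(\<Sum>m\<in>F. a' m * cis (paraboloid m \<bullet> y)) * of_real \<mu> =
          (\<Sum>m\<in>F. LINT z:Z|lborel. (a m * cis (paraboloid m \<bullet> w)) * cis ((paraboloid m - paraboloid m0) \<bullet> z))"
        unfolding set_integral_mult_right a'_def A_def w_def inner_add_right cis_mult[symmetric]
        unfolding sum_distrib_right by (intro sum.cong refl) (use \<mu> in simp)
      also have "\<dots> = (LINT z:Z|lborel. \<Sum>m\<in>F. (a m * cis (paraboloid m \<bullet> w)) * cis ((paraboloid m - paraboloid m0) \<bullet> z))"
        unfolding set_lebesgue_integral_def scaleR_sum_right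
        by (rule Bochner_Integration.integral_sum[symmetric])
           (intro ic[unfolded set_integrable_def] continuous_intros)
      also have "\<dots> = (LINT z:Z|lborel. cis (- (paraboloid m0 \<bullet> z)) * u (w + z))"
      proof -
        have c: "cis ((l - l0) \<bullet> z) = cis (- (l0 \<bullet> z)) * cis (l \<bullet> z)" for l l0 z :: "'a \<times> real"
          by (simp only: cis_mult inner_diff_left) simp
        have "(\<Sum>m\<in>F. (a m * cis (paraboloid m \<bullet> w)) * cis ((paraboloid m - paraboloid m0) \<bullet> z)) =
            cis (- (paraboloid m0 \<bullet> z)) * u (w + z)" for z
          unfolding u_def sum_distrib_left
          by (intro sum.cong refl) (simp only: c inner_add_right cis_mult[symmetric] mult_ac)
        then show ?thesis by simp
      qed
      finally have eq: "(\<Sum>m\<in>F. a' m * cis (paraboloid m \<bullet> y)) * of_real \<mu> = (LINT z:Z|lborel. cis (- (paraboloid m0 \<bullet> z)) * u (w + z))" .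
      have "cmod (\<Sum>m\<in>F. a' m * cis (paraboloid m \<bullet> y)) * \<mu> = cmod (LINT z:Z|lborel. cis (- (paraboloid m0 \<bullet> z)) * u (w + z))"
        unfolding eq[symmetric] norm_mult norm_of_real using \<mu> by simp
      also have "\<dots> \<le> (LINT z:Z|lborel. cmod (cis (- (paraboloid m0 \<bullet> z)) * u (w + z)))"
        by (rule set_integral_norm_bound) (intro ic continuous_intros uw)
      also have "\<dots> = (LINT z:Z|lborel. cmod (u (w + z)))" by (simp add: norm_mult)
      finally have "cmod (\<Sum>m\<in>F. a' m * cis (paraboloid m \<bullet> y)) \<le> (LINT z:Z|lborel. cmod (u (w + z))) / \<mu>"
        using \<mu> by (simp add: pos_le_divide_eq)
      then have "(cmod (\<Sum>m\<in>F. a' m * cis (paraboloid m \<bullet> y)))\<^sup>2 \<le> ((LINT z:Z|lborel. cmod (u (w + z))) / \<mu>)\<^sup>2"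
        by (rule power_mono) simp
      also have "\<dots> \<le> (LINT z:Z|lborel. (cmod (u (w + z)))\<^sup>2) / \<mu>"
        unfolding \<mu>_def by (rule set_average_square_le[OF Z]) (use \<mu> in \<open>auto simp: \<mu>_def intro!: continuous_intros uw\<close>)
      also have "\<dots> \<le> I / \<mu>"
      proof (rule divide_right_mono)
        let ?f = "\<lambda>x. indicator Z (x - w) *\<^sub>R (cmod (u x))\<^sup>2"
        have m[measurable]: "u \<in> borel_measurable borel"
          using u[of UNIV] by (rule borel_measurable_continuous_onI)
        have [measurable]: "Z \<in> sets borel" using Z by (rule borel_compact)
        have "(LINT z:Z|lborel. (cmod (u (w + z)))\<^sup>2) = (LINT z|lborel. ?f (w + z))"
          by (simp add: set_lebesgue_integral_def)
        also have "\<dots> = (LINT x|distr lborel borel ((+) w). ?f x)"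
          by (rule integral_distr[symmetric]) auto
        also have "\<dots> = (LINT x|lborel. ?f x)" by (simp add: lborel_distr_plus)
        also have "\<dots> \<le> I"
          unfolding I_def set_lebesgue_integral_def
        proof (rule integral_mono_AE')
          have "indicator Z (x - w) *\<^sub>R (cmod (u x))\<^sup>2 \<le> indicator (cball y0 \<epsilon>) x *\<^sub>R (cmod (u x))\<^sup>2" for x
          proof (cases "x - w \<in> Z")
            case True
            then have "norm (x - w) \<le> \<epsilon>/2" by (simp add: Z_def dist_norm norm_minus_commute)
            then have "norm (x - y0) \<le> \<epsilon>" using y norm_triangle_ineq[of "x - w" y] by (simp add: w_def)
            then show ?thesis by (simp add: dist_norm norm_minus_commute indicator_def)
          qed auto
          then show "AE x in lborel. indicator Z (x - w) *\<^sub>R (cmod (u x))\<^sup>2 \<le> indicator (cball y0 \<epsilon>) x *\<^sub>R (cmod (u x))\<^sup>2"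
            by auto
        qed (use Ii in auto)
        finally show "(LINT z:Z|lborel. (cmod (u (w + z)))\<^sup>2) \<le> I" .
      qed (use \<mu> in simp)
      finally show ?thesis by (rule real_le_rsqrt)
    qed
    have "cmod (a' m0) \<le> C * sqrt (I / \<mu>)" by (rule C(2)[OF F]) (use bd in auto)
    then have "cmod (a m0) \<le> C * sqrt (I / \<mu>)" by (simp add: a'_def A0 norm_mult)
    then have "(cmod (a m0))\<^sup>2 \<le> (C * sqrt (I / \<mu>))\<^sup>2" by (rule power_mono) simp
    also have "\<dots> = C\<^sup>2 / \<mu> * I" using I0 \<mu> by (simp add: power_mult_distrib)
    finally have "ennreal ((cmod (a m0))\<^sup>2) \<le> ennreal (C\<^sup>2 / \<mu>) * ennreal I"
      using \<mu> I0 by (simp add: ennreal_mult[symmetric] del: times_divide_eq_left)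
    also have "ennreal I = (\<integral>\<^sup>+y. ennreal (indicator (cball y0 \<epsilon>) y *\<^sub>R (cmod (u y))\<^sup>2) \<partial>lborel)"
      unfolding I_def set_lebesgue_integral_def by (rule nn_integral_eq_integral[symmetric]) (use Ii in auto)
    also have "\<dots> = (\<integral>\<^sup>+y\<in>cball y0 \<epsilon>. ennreal ((cmod (u y))\<^sup>2) \<partial>lborel)"
      by (intro nn_integral_cong) (auto simp: indicator_def)
    finally show "ennreal ((cmod (a m0))\<^sup>2) \<le> ennreal (C\<^sup>2 / \<mu>) *
       (\<integral>\<^sup>+y\<in>cball y0 \<epsilon>. ennreal ((cmod (\<Sum>m\<in>F. a m * cis (paraboloid m \<bullet> y)))\<^sup>2) \<partial>lborel)"
      unfolding u_def .
  qed
qed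

end

section \<open>The Fourier transform\<close>

definition gaussian :: "'a::euclidean_space \<Rightarrow> real" where
  "gaussian z = exp (- (norm z)\<^sup>2 / 2)"

text \<open>The value is read off from the characteristic function of the standard normal
  distribution.\<close>

lemma integral_gaussian_1d:
  "integrable lborel (\<lambda>x::real. cis (t * x) * complex_of_real (exp (- x\<^sup>2 / 2)))"
  "(\<integral>x. cis (t * x) * complex_of_real (exp (- x\<^sup>2 / 2)) \<partial>lborel) = complex_of_real (sqrt (2 * pi) * exp (- t\<^sup>2 / 2))"
proof -
  have d: "std_normal_density x = exp (- x\<^sup>2 / 2) / sqrt (2 * pi)" for x
    by (simp add: normal_density_def)
  have i: "integrable lborel (\<lambda>x::real. exp (- x\<^sup>2 / 2))"
    using integrable_mult_left[OF integrable_normal_density[of 1 0], of "sqrt (2*pi)"]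
    unfolding d by simp
  show "integrable lborel (\<lambda>x::real. cis (t * x) * complex_of_real (exp (- x\<^sup>2 / 2)))"
    by (rule Bochner_Integration.integrable_bound[OF i]) (auto simp: norm_mult intro!: borel_measurable_continuous_onI continuous_intros)
  have "complex_of_real (exp (- (t^2) / 2)) = char std_normal_distribution t"
    by (simp add: char_std_normal_distribution)
  also have "\<dots> = (\<integral>x. std_normal_density x *\<^sub>R cis (t * x) \<partial>lborel)"
    unfolding char_def
    by (subst integral_density) (auto simp: cis_conv_exp intro!: borel_measurable_continuous_onI continuous_intros)
  also have "\<dots> = (\<integral>x. complex_of_real (1 / sqrt (2 * pi)) * (cis (t * x) * complex_of_real (exp (- x\<^sup>2 / 2))) \<partial>lborel)"
    unfolding d by (simp add: scaleR_conv_of_real mult_ac)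
  also have "\<dots> = complex_of_real (1 / sqrt (2 * pi)) * (\<integral>x. cis (t * x) * complex_of_real (exp (- x\<^sup>2 / 2)) \<partial>lborel)"
    by (rule integral_mult_right_zero)
  finally show "(\<integral>x. cis (t * x) * complex_of_real (exp (- x\<^sup>2 / 2)) \<partial>lborel) = complex_of_real (sqrt (2 * pi) * exp (- t\<^sup>2 / 2))"
    by (simp add: field_simps)
qed

interpretation lborel_product: product_sigma_finite "\<lambda>_::'a::euclidean_space. lborel :: real measure" ..

text \<open>\<open>lborel\<close> is the image of a product of one-dimensional Lebesgue measures
  under the coordinate map, where integrals of products factor.\<close>

lemma euclidean_product_integral:
  fixes f :: "'a::euclidean_space \<Rightarrow> real \<Rightarrow> complex"
  assumes f: "\<And>b. b \<in> Basis \<Longrightarrow> integrable lborel (f b)"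
  shows "integrable lborel (\<lambda>x::'a. \<Prod>b\<in>Basis. f b (x \<bullet> b))"
    and "(\<integral>x. (\<Prod>b\<in>Basis. f b (x \<bullet> b)) \<partial>lborel) = (\<Prod>b\<in>Basis. (\<integral>x. f b x \<partial>lborel))"
proof -
  let ?T = "\<lambda>g::'a \<Rightarrow> real. \<Sum>b\<in>Basis. g b *\<^sub>R b"
  have T: "?T \<in> measurable (Pi\<^sub>M Basis (\<lambda>_. lborel)) borel" by measurable
  have [measurable]: "f b \<in> borel_measurable borel" if "b \<in> Basis" for b
    using borel_measurable_integrable[OF f[OF that]] by simp
  have m: "(\<lambda>x::'a. \<Prod>b\<in>Basis. f b (x \<bullet> b)) \<in> borel_measurable borel" by measurable
  have e: "(\<Prod>b\<in>Basis. f b (?T g \<bullet> b)) = (\<Prod>b\<in>Basis. f b (g b))" for g :: "'a \<Rightarrow> real"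
    by (intro prod.cong refl) (simp add: inner_sum_left inner_Basis if_distrib cong: if_cong)
  have "integrable (Pi\<^sub>M Basis (\<lambda>_. lborel)) (\<lambda>g. \<Prod>b\<in>Basis. f b (g b))"
    by (rule lborel_product.product_integrable_prod) (use f in auto)
  then show "integrable lborel (\<lambda>x::'a. \<Prod>b\<in>Basis. f b (x \<bullet> b))"
    by (subst lborel_eq[where 'a='a], subst integrable_distr_eq[OF T m]) (simp only: e)
  have "(\<integral>x. (\<Prod>b\<in>Basis. f b (x \<bullet> b)) \<partial>lborel) = (\<integral>g. (\<Prod>b\<in>Basis. f b (g b)) \<partial>Pi\<^sub>M Basis (\<lambda>_. lborel))"
    by (subst lborel_eq[where 'a='a], subst integral_distr[OF T m]) (simp only: e)
  also have "\<dots> = (\<Prod>b\<in>Basis. (\<integral>x. f b x \<partial>lborel))"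
    by (rule lborel_product.product_integral_prod) (use f in auto)
  finally show "(\<integral>x. (\<Prod>b\<in>Basis. f b (x \<bullet> b)) \<partial>lborel) = (\<Prod>b\<in>Basis. (\<integral>x. f b x \<partial>lborel))" .
qed

lemma norm_sq_Basis: "(norm (x::'a::euclidean_space))\<^sup>2 = (\<Sum>b\<in>Basis. (x \<bullet> b)\<^sup>2)"
  by (subst power2_norm_eq_inner, subst euclidean_inner) (simp add: power2_eq_square)

lemma gaussian_prod: "gaussian z = (\<Prod>b\<in>Basis. exp (- (z \<bullet> b)\<^sup>2 / 2))"
  by (simp add: gaussian_def norm_sq_Basis exp_sum[symmetric] sum_negf sum_divide_distrib[symmetric])

definition gaussian_mass :: "'a::euclidean_space itself \<Rightarrow> real" where
  "gaussian_mass _ = sqrt (2 * pi) ^ DIM('a)"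

lemma cis_sum: "finite A \<Longrightarrow> cis (\<Sum>b\<in>A. g b) = (\<Prod>b\<in>A. cis (g b))"
  by (induction A rule: finite_induct) (auto simp: cis_mult[symmetric])

lemma fourier_gaussian:
  fixes \<zeta> :: "'a::euclidean_space"
  shows "integrable lborel (\<lambda>z::'a. cis (z \<bullet> \<zeta>) * complex_of_real (gaussian z))" (is ?A)
    and "(\<integral>z. cis (z \<bullet> \<zeta>) * complex_of_real (gaussian z) \<partial>lborel) = complex_of_real (gaussian_mass TYPE('a) * gaussian \<zeta>)" (is ?B)
proof -
  let ?f = "\<lambda>b x. cis ((\<zeta> \<bullet> b) * x) * complex_of_real (exp (- x\<^sup>2 / 2))"
  have e: "cis (z \<bullet> \<zeta>) * complex_of_real (gaussian z) = (\<Prod>b\<in>Basis. ?f b (z \<bullet> b))" for z :: 'a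
    by (subst euclidean_inner) (simp add: cis_sum gaussian_prod prod.distrib mult.commute)
  show ?A unfolding e by (rule euclidean_product_integral integral_gaussian_1d)+
  have "(\<integral>z. cis (z \<bullet> \<zeta>) * complex_of_real (gaussian z) \<partial>lborel) = (\<Prod>b\<in>Basis. (\<integral>x. ?f b x \<partial>lborel))"
    unfolding e by (rule euclidean_product_integral integral_gaussian_1d)+
  also have "\<dots> = complex_of_real (gaussian_mass TYPE('a) * gaussian \<zeta>)"
    unfolding integral_gaussian_1d gaussian_mass_def gaussian_prod
    by (simp add: prod.distrib)
  finally show ?B .
qed

lemma gaussian_nonneg [simp]: "0 \<le> gaussian z" and gaussian_pos: "0 < gaussian z"
  by (auto simp: gaussian_def)

lemma gaussian_le_1: "gaussian z \<le> 1"
  by (simp add: gaussian_def)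

lemma gaussian_0 [simp]: "gaussian 0 = 1"
  by (simp add: gaussian_def)

lemma gaussian_minus [simp]: "gaussian (- z) = gaussian z"
  by (simp add: gaussian_def)

lemma continuous_on_gaussian [continuous_intros]:
  "continuous_on S f \<Longrightarrow> continuous_on S (\<lambda>x. gaussian (f x))"
  unfolding gaussian_def by (intro continuous_intros) auto

lemma isCont_gaussian: "isCont gaussian x"
  unfolding gaussian_def by (intro continuous_intros) auto

lemma gaussian_scaled_tendsto: "(\<lambda>n. gaussian ((1 / real (Suc n)) *\<^sub>R z)) \<longlonglongrightarrow> 1"
proof -
  have "(\<lambda>n. (1 / real (Suc n)) *\<^sub>R z) \<longlonglongrightarrow> 0 *\<^sub>R z"
    using LIMSEQ_inverse_real_of_nat by (intro tendsto_intros) (simp add: inverse_eq_divide)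
  from isCont_tendsto_compose[OF isCont_gaussian this] show ?thesis by simp
qed

lemma borel_measurable_gaussian [measurable]: "gaussian \<in> borel_measurable borel"
  by (intro borel_measurable_continuous_onI continuous_intros)

lemma gaussian_mass_pos: "0 < gaussian_mass TYPE('a::euclidean_space)"
  by (simp add: gaussian_mass_def)

lemma gaussian_mass_sq: "(gaussian_mass TYPE('a::euclidean_space))\<^sup>2 = (2 * pi) ^ DIM('a)"
  by (simp add: gaussian_mass_def power_mult[symmetric] mult.commute[of _ 2]) (simp add: power_mult)

lemma integral_gaussian:
  "integrable lborel (gaussian :: 'a::euclidean_space \<Rightarrow> real)"
  "(\<integral>z. gaussian (z::'a) \<partial>lborel) = gaussian_mass TYPE('a::euclidean_space)"
proof -
  have "integrable lborel (\<lambda>z::'a. complex_of_real (gaussian z))"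
    using fourier_gaussian(1)[of "0::'a"] by simp
  then show i: "integrable lborel (gaussian :: 'a::euclidean_space \<Rightarrow> real)"
    by (simp add: complex_of_real_integrable_eq)
  have "complex_of_real (\<integral>z. gaussian (z::'a) \<partial>lborel) = complex_of_real (gaussian_mass TYPE('a::euclidean_space))"
    using fourier_gaussian(2)[of "0::'a"] by simp
  then show "(\<integral>z. gaussian (z::'a) \<partial>lborel) = gaussian_mass TYPE('a::euclidean_space)" by (simp only: of_real_eq_iff)
qed

lemma integral_affine:
  fixes f :: "'a::euclidean_space \<Rightarrow> 'b::{banach, second_countable_topology}" and c :: real
  assumes c: "c \<noteq> 0" and f[measurable]: "f \<in> borel_measurable borel"
  shows "(\<integral>x. f x \<partial>lborel) = \<bar>c\<bar> ^ DIM('a) *\<^sub>R (\<integral>x. f (t + c *\<^sub>R x) \<partial>lborel)"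
  by (subst lborel_affine[OF c, of t])
     (simp add: integral_density integral_distr integral_scaleR_right)

lemma integrable_affine:
  fixes f :: "'a::euclidean_space \<Rightarrow> 'b::{banach, second_countable_topology}" and c :: real
  assumes f: "integrable lborel f" and c: "c \<noteq> 0"
  shows "integrable lborel (\<lambda>x. f (t + c *\<^sub>R x))"
proof -
  have m[measurable]: "f \<in> borel_measurable borel" using borel_measurable_integrable[OF f] by simp
  have "integrable (density (distr lborel borel (\<lambda>x. t + c *\<^sub>R x)) (\<lambda>_. \<bar>c\<bar>^DIM('a))) f"
    using f lborel_affine[OF c, of t] by simp
  then have "integrable (distr lborel borel (\<lambda>x. t + c *\<^sub>R x)) (\<lambda>x. \<bar>c\<bar>^DIM('a) *\<^sub>R f x)"
    by (subst (asm) integrable_density) auto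
  then have "integrable lborel (\<lambda>x. \<bar>c\<bar>^DIM('a) *\<^sub>R f (t + c *\<^sub>R x))"
    by (subst (asm) integrable_distr_eq) auto
  then have "integrable lborel (\<lambda>x. (1 / \<bar>c\<bar>^DIM('a)) *\<^sub>R \<bar>c\<bar>^DIM('a) *\<^sub>R f (t + c *\<^sub>R x))"
    by (rule integrable_scaleR_right)
  then show ?thesis using c by simp
qed

lemma continuous_on_parametric_integral:
  fixes f :: "'p::{first_countable_topology, t2_space} \<Rightarrow> 'x \<Rightarrow> complex"
  assumes "\<And>p. f p \<in> borel_measurable M" "integrable M G"
    "\<And>p x. cmod (f p x) \<le> G x" "\<And>x. continuous_on UNIV (\<lambda>p. f p x)"
  shows "continuous_on S (\<lambda>p. \<integral>x. f p x \<partial>M)"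
proof (rule continuous_on_subset[OF _ subset_UNIV], rule continuous_on_sequentiallyI)
  fix u :: "nat \<Rightarrow> 'p" and a assume u: "u \<longlonglongrightarrow> a"
  show "(\<lambda>n. \<integral>x. f (u n) x \<partial>M) \<longlonglongrightarrow> (\<integral>x. f a x \<partial>M)"
  proof (rule integral_dominated_convergence[of _ _ _ G])
    have "(\<lambda>n. f (u n) x) \<longlonglongrightarrow> f a x" for x
      using assms(4)[of x] u by (auto simp: continuous_on_eq_continuous_at intro: isCont_tendsto_compose[of a "\<lambda>p. f p x"])
    then show "AE x in M. (\<lambda>n. f (u n) x) \<longlonglongrightarrow> f a x" by simp
  qed (use assms in auto)
qed

section \<open>Plancherel's identity and Fourier inversion\<close>

text \<open>No power of \<open>2 * pi\<close> is built in; the normalisation appears explicitly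
  wherever two transforms are composed.\<close>

definition inv_ft :: "('a::euclidean_space \<Rightarrow> complex) \<Rightarrow> 'a \<Rightarrow> complex" where
  "inv_ft g z = (\<integral>\<xi>. cis (z \<bullet> \<xi>) * g \<xi> \<partial>lborel)"

lemma borel_measurable_cis [measurable]: "cis \<in> borel_measurable borel"
  by (intro borel_measurable_continuous_onI continuous_intros)

lemma borel_measurable_cnj [measurable]: "cnj \<in> borel_measurable borel"
  by (intro borel_measurable_continuous_onI continuous_intros)

lemma integrable_cis_mult:
  fixes g :: "'a::euclidean_space \<Rightarrow> complex"
  assumes "integrable lborel g" "f \<in> borel_measurable borel"
  shows "integrable lborel (\<lambda>\<xi>. cis (f \<xi>) * g \<xi>)"
proof (rule Bochner_Integration.integrable_bound[OF assms(1)])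
  have [measurable]: "g \<in> borel_measurable borel" using borel_measurable_integrable[OF assms(1)] by simp
  show "(\<lambda>\<xi>. cis (f \<xi>) * g \<xi>) \<in> borel_measurable lborel" using assms(2) by simp
qed (simp add: norm_mult)

lemma continuous_on_inv_ft [continuous_intros]:
  assumes g: "integrable lborel g" and "continuous_on S f"
  shows "continuous_on S (\<lambda>x. inv_ft g (f x))"
proof -
  have [measurable]: "g \<in> borel_measurable borel" using borel_measurable_integrable[OF g] by simp
  have "continuous_on UNIV (inv_ft g)"
    unfolding inv_ft_def
    by (rule continuous_on_parametric_integral[where G = "\<lambda>x. cmod (g x)"])
       (use g in \<open>auto simp: norm_mult intro!: continuous_intros\<close>)
  from continuous_on_compose2[OF this assms(2)] show ?thesis by auto
qed

lemma inv_ft_measurable [measurable]: "integrable lborel g \<Longrightarrow> inv_ft g \<in> borel_measurable borel"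
  by (intro borel_measurable_continuous_onI continuous_intros)

lemma inv_ft_bound: "cmod (inv_ft g z) \<le> (\<integral>\<xi>. cmod (g \<xi>) \<partial>lborel)"
proof -
  have "cmod (inv_ft g z) \<le> (\<integral>\<xi>. cmod (cis (z \<bullet> \<xi>) * g \<xi>) \<partial>lborel)"
    unfolding inv_ft_def by (rule integral_norm_bound)
  then show ?thesis by (simp add: norm_mult)
qed

text \<open>Fubini for a kernel symmetric in \<open>z\<close> and \<open>\<xi>\<close>;
  integrability of both functions makes the double integral absolutely convergent.\<close>

lemma inv_ft_multiplication:
  fixes g k :: "'a::euclidean_space \<Rightarrow> complex"
  assumes g: "integrable lborel g" and k: "integrable lborel k"
  shows "(\<integral>z. inv_ft g z * k z \<partial>lborel) = (\<integral>\<xi>. g \<xi> * inv_ft k \<xi> \<partial>lborel)"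
proof -
  have [measurable]: "g \<in> borel_measurable borel" "k \<in> borel_measurable borel"
    using borel_measurable_integrable[OF g] borel_measurable_integrable[OF k] by simp_all
  let ?f = "\<lambda>z \<xi>. cis (z \<bullet> \<xi>) * g \<xi> * k z"
  have "integrable (lborel \<Otimes>\<^sub>M lborel) (\<lambda>(z, \<xi>). ?f z \<xi>)"
  proof (rule lborel_pair.Fubini_integrable)
    show "integrable lborel (\<lambda>z. \<integral>\<xi>. norm (case (z, \<xi>) of (z, \<xi>) \<Rightarrow> ?f z \<xi>) \<partial>lborel)"
      using k by (simp add: norm_mult integrable_mult_right)
    show "AE z in lborel. integrable lborel (\<lambda>\<xi>. case (z, \<xi>) of (z, \<xi>) \<Rightarrow> ?f z \<xi>)"
      by (auto intro!: integrable_mult_left integrable_cis_mult g)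
  qed measurable
  then have "(\<integral>\<xi>. (\<integral>z. ?f z \<xi> \<partial>lborel) \<partial>lborel) = (\<integral>z. (\<integral>\<xi>. ?f z \<xi> \<partial>lborel) \<partial>lborel)"
    by (rule lborel_pair.Fubini_integral)
  moreover have "(\<integral>\<xi>. ?f z \<xi> \<partial>lborel) = inv_ft g z * k z" for z
    unfolding inv_ft_def by (rule integral_mult_left_zero)
  moreover have "(\<integral>z. ?f z \<xi> \<partial>lborel) = g \<xi> * inv_ft k \<xi>" for \<xi>
    unfolding inv_ft_def integral_mult_right_zero[symmetric]
    by (intro Bochner_Integration.integral_cong refl) (simp add: inner_commute mult_ac)
  ultimately show ?thesis by (simp only:)
qed

lemma integrable_gaussian_scaled:
  assumes "\<epsilon> \<noteq> 0"
  shows "integrable lborel (\<lambda>z::'a::euclidean_space. gaussian (\<epsilon> *\<^sub>R z))"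
  using integrable_affine[OF integral_gaussian(1) assms, of 0] by simp

lemma inv_ft_gaussian_scaled:
  fixes x :: "'a::euclidean_space"
  assumes \<epsilon>: "0 < \<epsilon>"
  shows "inv_ft (\<lambda>z. cis (z \<bullet> x) * complex_of_real (gaussian (\<epsilon> *\<^sub>R z))) \<eta> =
     complex_of_real (gaussian_mass TYPE('a) / \<epsilon> ^ DIM('a) * gaussian ((1/\<epsilon>) *\<^sub>R (\<eta> + x)))"
proof -
  let ?\<zeta> = "(1/\<epsilon>) *\<^sub>R (\<eta> + x)"
  have "inv_ft (\<lambda>z. cis (z \<bullet> x) * complex_of_real (gaussian (\<epsilon> *\<^sub>R z))) \<eta> = 
    (\<integral>z. cis (z \<bullet> (\<eta> + x)) * complex_of_real (gaussian (\<epsilon> *\<^sub>R z)) \<partial>lborel)"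
    unfolding inv_ft_def by (simp add: inner_add_right cis_mult[symmetric] inner_commute mult_ac)
  also have "\<dots> = \<bar>1/\<epsilon>\<bar> ^ DIM('a) *\<^sub>R (\<integral>z. cis ((0 + (1/\<epsilon>) *\<^sub>R z) \<bullet> (\<eta> + x)) * complex_of_real (gaussian (\<epsilon> *\<^sub>R (0 + (1/\<epsilon>) *\<^sub>R z))) \<partial>lborel)"
    by (rule integral_affine) (use \<epsilon> in auto)
  also have "(\<integral>z. cis ((0 + (1/\<epsilon>) *\<^sub>R z) \<bullet> (\<eta> + x)) * complex_of_real (gaussian (\<epsilon> *\<^sub>R (0 + (1/\<epsilon>) *\<^sub>R z))) \<partial>lborel)
     = (\<integral>z. cis (z \<bullet> ?\<zeta>) * complex_of_real (gaussian z) \<partial>lborel)"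
    using \<epsilon> by simp
  also have "\<dots> = complex_of_real (gaussian_mass TYPE('a) * gaussian ?\<zeta>)" by (rule fourier_gaussian)
  finally show ?thesis using \<epsilon> by (simp add: scaleR_conv_of_real power_one_over field_simps)
qed

text \<open>A transform need not be integrable, so a Gaussian factor is inserted before inverting.
  The multiplication formula moves the transform onto that factor, where it becomes a narrow
  Gaussian, so the result is a mollification of \<open>g\<close>.\<close>

lemma gaussian_regularised_inversion:
  fixes g :: "'a::euclidean_space \<Rightarrow> complex"
  assumes g: "integrable lborel g" and \<epsilon>: "0 < \<epsilon>"
  shows "inv_ft (\<lambda>z. inv_ft (\<lambda>\<eta>. g (- \<eta>)) z * complex_of_real (gaussian (\<epsilon> *\<^sub>R z))) x =
     complex_of_real (gaussian_mass TYPE('a)) * (\<integral>\<zeta>. g (x - \<epsilon> *\<^sub>R \<zeta>) * complex_of_real (gaussian \<zeta>) \<partial>lborel)"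
proof -
  have [measurable]: "g \<in> borel_measurable borel" using borel_measurable_integrable[OF g] by simp
  have g': "integrable lborel (\<lambda>\<eta>. g (- \<eta>))" using integrable_affine[OF g, of "-1" 0] by simp
  have k: "integrable lborel (\<lambda>z::'a. cis (z \<bullet> x) * complex_of_real (gaussian (\<epsilon> *\<^sub>R z)))"
    by (rule integrable_cis_mult) (use integrable_gaussian_scaled[of \<epsilon>] \<epsilon> in \<open>auto simp: complex_of_real_integrable_eq\<close>)
  have "inv_ft (\<lambda>z. inv_ft (\<lambda>\<eta>. g (- \<eta>)) z * complex_of_real (gaussian (\<epsilon> *\<^sub>R z))) x =
     (\<integral>z. inv_ft (\<lambda>\<eta>. g (- \<eta>)) z * (cis (z \<bullet> x) * complex_of_real (gaussian (\<epsilon> *\<^sub>R z))) \<partial>lborel)"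
    by (subst inv_ft_def) (simp add: inner_commute mult_ac)
  also have "\<dots> = (\<integral>\<eta>. g (- \<eta>) * inv_ft (\<lambda>z. cis (z \<bullet> x) * complex_of_real (gaussian (\<epsilon> *\<^sub>R z))) \<eta> \<partial>lborel)"
    by (rule inv_ft_multiplication[OF g' k])
  also have "\<dots> = (\<integral>\<eta>. g (- \<eta>) * complex_of_real (gaussian_mass TYPE('a) / \<epsilon> ^ DIM('a) * gaussian ((1/\<epsilon>) *\<^sub>R (\<eta> + x))) \<partial>lborel)"
    by (simp only: inv_ft_gaussian_scaled[OF \<epsilon>])
  also have "\<dots> = \<bar>\<epsilon>\<bar> ^ DIM('a) *\<^sub>R (\<integral>\<zeta>. g (- (- x + \<epsilon> *\<^sub>R \<zeta>)) * complex_of_real (gaussian_mass TYPE('a) / \<epsilon> ^ DIM('a) * gaussian ((1/\<epsilon>) *\<^sub>R ((- x + \<epsilon> *\<^sub>R \<zeta>) + x))) \<partial>lborel)"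
    by (rule integral_affine) (use \<epsilon> in auto)
  also have "\<dots> = \<epsilon> ^ DIM('a) *\<^sub>R (\<integral>\<zeta>. complex_of_real (gaussian_mass TYPE('a) / \<epsilon> ^ DIM('a)) * (g (x - \<epsilon> *\<^sub>R \<zeta>) * complex_of_real (gaussian \<zeta>)) \<partial>lborel)"
    using \<epsilon> by (simp add: mult_ac)
  also have "\<dots> = complex_of_real (gaussian_mass TYPE('a)) * (\<integral>\<zeta>. g (x - \<epsilon> *\<^sub>R \<zeta>) * complex_of_real (gaussian \<zeta>) \<partial>lborel)"
    unfolding integral_mult_right_zero using \<epsilon> by (simp add: scaleR_conv_of_real)
  finally show ?thesis .
qed

lemma gaussian_mollifier_bound:
  fixes g :: "'a::euclidean_space \<Rightarrow> complex"
  assumes "\<And>x. cmod (g x) \<le> B"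
  shows "cmod (\<integral>\<zeta>. g (x - \<epsilon> *\<^sub>R \<zeta>) * complex_of_real (gaussian \<zeta>) \<partial>lborel) \<le> B * gaussian_mass TYPE('a)"
proof -
  have "cmod (\<integral>\<zeta>. g (x - \<epsilon> *\<^sub>R \<zeta>) * complex_of_real (gaussian \<zeta>) \<partial>lborel)
      \<le> (\<integral>\<zeta>. cmod (g (x - \<epsilon> *\<^sub>R \<zeta>) * complex_of_real (gaussian \<zeta>)) \<partial>lborel)"
    by (rule integral_norm_bound)
  also have "\<dots> \<le> (\<integral>\<zeta>. B * gaussian (\<zeta>::'a) \<partial>lborel)"
  proof (rule integral_mono_AE')
    have "0 \<le> B" using assms[of 0] norm_ge_zero order_trans by blast
    then show "AE \<zeta>::'a in lborel. 0 \<le> B * gaussian \<zeta>" by simp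
  qed (auto simp: norm_mult intro!: mult_right_mono assms integral_gaussian)
  finally show ?thesis by (simp add: integral_gaussian)
qed

lemma gaussian_mollifier_limit:
  fixes g :: "'a::euclidean_space \<Rightarrow> complex"
  assumes B: "\<And>x. cmod (g x) \<le> B" and g: "continuous_on UNIV g"
  shows "(\<lambda>n. \<integral>\<zeta>. g (x - (1 / real (Suc n)) *\<^sub>R \<zeta>) * complex_of_real (gaussian \<zeta>) \<partial>lborel)
     \<longlonglongrightarrow> complex_of_real (gaussian_mass TYPE('a)) * g x"
proof -
  have [measurable]: "g \<in> borel_measurable borel" using g by (rule borel_measurable_continuous_onI)
  have "(\<lambda>n. \<integral>\<zeta>. g (x - (1 / real (Suc n)) *\<^sub>R \<zeta>) * complex_of_real (gaussian \<zeta>) \<partial>lborel)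
     \<longlonglongrightarrow> (\<integral>\<zeta>. g x * complex_of_real (gaussian (\<zeta>::'a)) \<partial>lborel)"
  proof (rule integral_dominated_convergence[where w = "\<lambda>\<zeta>::'a. B * gaussian \<zeta>"])
    have "(\<lambda>n. g (x - (1 / real (Suc n)) *\<^sub>R \<zeta>) * complex_of_real (gaussian \<zeta>)) \<longlonglongrightarrow> g x * complex_of_real (gaussian \<zeta>)" for \<zeta>
    proof (intro tendsto_mult tendsto_const)
      have "(\<lambda>n. x - (1 / real (Suc n)) *\<^sub>R \<zeta>) \<longlonglongrightarrow> x - 0 *\<^sub>R \<zeta>"
        using LIMSEQ_inverse_real_of_nat by (intro tendsto_intros) (simp add: inverse_eq_divide)
      then show "(\<lambda>n. g (x - (1 / real (Suc n)) *\<^sub>R \<zeta>)) \<longlonglongrightarrow> g x"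
        using g by (auto simp: continuous_on_eq_continuous_at intro: isCont_tendsto_compose)
    qed
    then show "AE \<zeta> in lborel. (\<lambda>n. g (x - (1 / real (Suc n)) *\<^sub>R \<zeta>) * complex_of_real (gaussian \<zeta>)) \<longlonglongrightarrow> g x * complex_of_real (gaussian \<zeta>)"
      by simp
  qed (auto simp: norm_mult intro!: mult_right_mono B integral_gaussian integrable_mult_right)
  moreover have "(\<integral>\<zeta>. g x * complex_of_real (gaussian (\<zeta>::'a)) \<partial>lborel) = complex_of_real (gaussian_mass TYPE('a)) * g x"
    using integral_gaussian(2)[where 'a='a]
    by (simp only: integral_mult_right_zero integral_complex_of_real) simp
  ultimately show ?thesis by (simp only:)
qed

text \<open>The energy with a Gaussian weight equals a pairing of \<open>g\<close> with its
  mollified conjugate. As the weight tends to 1, that pairing tends to the energy of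
  \<open>g\<close> times \<open>(gaussian_mass TYPE('a))\<^sup>2\<close>, which is
  \<open>(2 * pi) ^ DIM('a)\<close>.\<close>

lemma plancherel:
  fixes g :: "'a::euclidean_space \<Rightarrow> complex"
  assumes g: "integrable lborel g" "continuous_on UNIV g" and B: "\<And>x. cmod (g x) \<le> B"
  shows "integrable lborel (\<lambda>\<xi>. (cmod (g \<xi>))\<^sup>2)"
    and "(\<integral>\<^sup>+z. ennreal ((cmod (inv_ft g z))\<^sup>2) \<partial>lborel) = ennreal ((2 * pi) ^ DIM('a) * (\<integral>\<xi>. (cmod (g \<xi>))\<^sup>2 \<partial>lborel))"
proof -
  have [measurable]: "g \<in> borel_measurable borel" using g(2) by (rule borel_measurable_continuous_onI)
  have [measurable]: "inv_ft g \<in> borel_measurable borel" by (rule inv_ft_measurable[OF g(1)])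
  have B0: "0 \<le> B" using B[of 0] norm_ge_zero order_trans by blast
  show gi: "integrable lborel (\<lambda>\<xi>. (cmod (g \<xi>))\<^sup>2)"
  proof (rule Bochner_Integration.integrable_bound)
    show "integrable lborel (\<lambda>\<xi>. B * cmod (g \<xi>))" using g(1) by (intro integrable_mult_right integrable_norm)
    show "AE \<xi> in lborel. norm ((cmod (g \<xi>))\<^sup>2) \<le> norm (B * cmod (g \<xi>))"
      using B B0 by (auto simp: power2_eq_square mult_right_mono)
  qed simp
  define e where "e = (\<lambda>n. 1 / real (Suc n))"
  have e: "0 < e n" for n by (simp add: e_def)
  define N where "N = (\<integral>\<xi>. cmod (g \<xi>) \<partial>lborel)"
  define J where "J = (\<lambda>n. \<integral>z. (cmod (inv_ft g z))\<^sup>2 * gaussian (e n *\<^sub>R z) \<partial>lborel)"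
  have Ji: "integrable lborel (\<lambda>z. (cmod (inv_ft g z))\<^sup>2 * gaussian (e n *\<^sub>R z))" for n
  proof (rule Bochner_Integration.integrable_bound)
    show "integrable lborel (\<lambda>z::'a. N\<^sup>2 * gaussian (e n *\<^sub>R z))"
      using e[of n] by (intro integrable_mult_right integrable_gaussian_scaled) auto
    have "(cmod (inv_ft g z))\<^sup>2 \<le> N\<^sup>2" for z unfolding N_def by (intro power_mono inv_ft_bound) auto
    then show "AE z in lborel. norm ((cmod (inv_ft g z))\<^sup>2 * gaussian (e n *\<^sub>R z)) \<le> norm (N\<^sup>2 * gaussian (e n *\<^sub>R z))"
      by (auto simp: abs_mult intro!: mult_right_mono)
  qed measurable
  have Jc: "complex_of_real (J n) = complex_of_real (gaussian_mass TYPE('a)) *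
     (\<integral>\<xi>. g \<xi> * (\<integral>\<zeta>. cnj (g (\<xi> - e n *\<^sub>R \<zeta>)) * complex_of_real (gaussian \<zeta>) \<partial>lborel) \<partial>lborel)" for n
  proof -
    let ?k = "\<lambda>z. inv_ft (\<lambda>\<eta>. cnj (g (- \<eta>))) z * complex_of_real (gaussian (e n *\<^sub>R z))"
    have cg: "integrable lborel (\<lambda>x. cnj (g x))" using g(1) by simp
    have cg': "integrable lborel (\<lambda>x. cnj (g (- x)))" using integrable_affine[OF cg, of "-1" 0] by simp
    have cosc: "inv_ft (\<lambda>\<eta>. cnj (g (- \<eta>))) z = cnj (inv_ft g z)" for z
    proof -
      have "cnj (inv_ft g z) = (\<integral>\<xi>. cnj (cis (z \<bullet> \<xi>) * g \<xi>) \<partial>lborel)" unfolding inv_ft_def by (rule Bochner_Integration.integral_cnj[symmetric])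
      also have "\<dots> = \<bar>-1::real\<bar> ^ DIM('a) *\<^sub>R (\<integral>\<xi>. cnj (cis (z \<bullet> (0 + (-1) *\<^sub>R \<xi>)) * g (0 + (-1) *\<^sub>R \<xi>)) \<partial>lborel)"
        by (rule integral_affine) (simp, measurable)
      also have "\<dots> = inv_ft (\<lambda>\<eta>. cnj (g (- \<eta>))) z" unfolding inv_ft_def by (simp add: cis_cnj)
      finally show ?thesis by simp
    qed
    have k: "integrable lborel ?k"
    proof (rule Bochner_Integration.integrable_bound)
      show "integrable lborel (\<lambda>z::'a. N * gaussian (e n *\<^sub>R z))"
        using e[of n] by (intro integrable_mult_right integrable_gaussian_scaled) auto
      have "0 \<le> N" unfolding N_def by simp
      then show "AE z in lborel. norm (?k z) \<le> norm (N * gaussian (e n *\<^sub>R z))"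
        using inv_ft_bound[of g] by (auto simp: cosc norm_mult N_def intro!: mult_right_mono)
      show "?k \<in> borel_measurable lborel" unfolding cosc by measurable
    qed
    have "complex_of_real (J n) = (\<integral>z. complex_of_real ((cmod (inv_ft g z))\<^sup>2 * gaussian (e n *\<^sub>R z)) \<partial>lborel)"
      unfolding J_def by (rule integral_complex_of_real[symmetric])
    also have "\<dots> = (\<integral>z. inv_ft g z * ?k z \<partial>lborel)"
      by (simp only: cosc of_real_mult complex_norm_square mult.assoc)
    also have "\<dots> = (\<integral>\<xi>. g \<xi> * inv_ft ?k \<xi> \<partial>lborel)" by (rule inv_ft_multiplication[OF g(1) k])
    also have "\<dots> = (\<integral>\<xi>. complex_of_real (gaussian_mass TYPE('a)) * (g \<xi> * (\<integral>\<zeta>. cnj (g (\<xi> - e n *\<^sub>R \<zeta>)) * complex_of_real (gaussian \<zeta>) \<partial>lborel)) \<partial>lborel)"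
      by (simp only: gaussian_regularised_inversion[OF cg e]) (simp only: mult_ac)
    also have "\<dots> = complex_of_real (gaussian_mass TYPE('a)) * (\<integral>\<xi>. g \<xi> * (\<integral>\<zeta>. cnj (g (\<xi> - e n *\<^sub>R \<zeta>)) * complex_of_real (gaussian \<zeta>) \<partial>lborel) \<partial>lborel)"
      by (rule integral_mult_right_zero)
    finally show ?thesis .
  qed
  have lim: "J \<longlonglongrightarrow> (2 * pi) ^ DIM('a) * (\<integral>\<xi>. (cmod (g \<xi>))\<^sup>2 \<partial>lborel)"
  proof -
    let ?P = "\<lambda>n \<xi>. \<integral>\<zeta>. cnj (g (\<xi> - e n *\<^sub>R \<zeta>)) * complex_of_real (gaussian \<zeta>) \<partial>lborel"
    have cB: "cmod (cnj (g x)) \<le> B" for x using B by simp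
    have cc: "continuous_on UNIV (\<lambda>x. cnj (g x))" by (intro continuous_intros g)
    have "(\<lambda>n. \<integral>\<xi>. g \<xi> * ?P n \<xi> \<partial>lborel) \<longlonglongrightarrow> (\<integral>\<xi>. g \<xi> * (complex_of_real (gaussian_mass TYPE('a)) * cnj (g \<xi>)) \<partial>lborel)"
    proof (rule integral_dominated_convergence[of _ _ _ "\<lambda>\<xi>. cmod (g \<xi>) * (B * gaussian_mass TYPE('a))"])
      have "(\<lambda>n. g \<xi> * ?P n \<xi>) \<longlonglongrightarrow> g \<xi> * (complex_of_real (gaussian_mass TYPE('a)) * cnj (g \<xi>))" for \<xi>
        unfolding e_def by (intro tendsto_mult tendsto_const gaussian_mollifier_limit[OF cB cc])
      then show "AE \<xi> in lborel. (\<lambda>n. g \<xi> * ?P n \<xi>) \<longlonglongrightarrow> g \<xi> * (complex_of_real (gaussian_mass TYPE('a)) * cnj (g \<xi>))" by simp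
      show "AE \<xi> in lborel. norm (g \<xi> * ?P n \<xi>) \<le> cmod (g \<xi>) * (B * gaussian_mass TYPE('a))" for n
        using gaussian_mollifier_bound[where g = "\<lambda>x. cnj (g x)", OF cB] by (auto simp: norm_mult intro!: mult_left_mono)
    qed (use g in \<open>auto intro!: integrable_mult_left\<close>)
    then have "(\<lambda>n. complex_of_real (gaussian_mass TYPE('a)) * (\<integral>\<xi>. g \<xi> * ?P n \<xi> \<partial>lborel)) \<longlonglongrightarrow>
       complex_of_real (gaussian_mass TYPE('a)) * (\<integral>\<xi>. g \<xi> * (complex_of_real (gaussian_mass TYPE('a)) * cnj (g \<xi>)) \<partial>lborel)"
      by (intro tendsto_mult tendsto_const)
    also have "complex_of_real (gaussian_mass TYPE('a)) * (\<integral>\<xi>. g \<xi> * (complex_of_real (gaussian_mass TYPE('a)) * cnj (g \<xi>)) \<partial>lborel)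
       = complex_of_real ((gaussian_mass TYPE('a))\<^sup>2 * (\<integral>\<xi>. (cmod (g \<xi>))\<^sup>2 \<partial>lborel))"
    proof -
      have "(\<integral>\<xi>. g \<xi> * (complex_of_real (gaussian_mass TYPE('a)) * cnj (g \<xi>)) \<partial>lborel) =
         (\<integral>\<xi>. complex_of_real (gaussian_mass TYPE('a)) * complex_of_real ((cmod (g \<xi>))\<^sup>2) \<partial>lborel)"
        by (simp only: complex_norm_square mult_ac)
      also have "\<dots> = complex_of_real (gaussian_mass TYPE('a)) * (\<integral>\<xi>. complex_of_real ((cmod (g \<xi>))\<^sup>2) \<partial>lborel)"
        by (rule integral_mult_right_zero)
      also have "(\<integral>\<xi>. complex_of_real ((cmod (g \<xi>))\<^sup>2) \<partial>lborel) = complex_of_real (\<integral>\<xi>. (cmod (g \<xi>))\<^sup>2 \<partial>lborel)"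
        by (rule integral_complex_of_real)
      finally show ?thesis
        by (simp only: power2_eq_square[of "gaussian_mass TYPE('a)"] of_real_mult mult.assoc)
    qed
    finally have "(\<lambda>n. complex_of_real (J n)) \<longlonglongrightarrow> complex_of_real ((gaussian_mass TYPE('a))\<^sup>2 * (\<integral>\<xi>. (cmod (g \<xi>))\<^sup>2 \<partial>lborel))"
      by (simp only: Jc)
    then show ?thesis by (simp only: tendsto_of_real_iff gaussian_mass_sq)
  qed
  \<comment> \<open>Square integrability of \<open>inv_ft g\<close> is not known yet, so the weight
    is removed by monotone convergence of extended integrals; the weights increase with
    \<open>n\<close>.\<close>
  have "(\<lambda>n. \<integral>\<^sup>+z. ennreal ((cmod (inv_ft g z))\<^sup>2 * gaussian (e n *\<^sub>R z)) \<partial>lborel) \<longlonglongrightarrow>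
     (\<integral>\<^sup>+z. ennreal ((cmod (inv_ft g z))\<^sup>2) \<partial>lborel)"
  proof (rule nn_integral_LIMSEQ)
    have "gaussian (e n *\<^sub>R z) \<le> gaussian (e (Suc n) *\<^sub>R z)" for n and z :: 'a
    proof -
      have "e (Suc n) \<le> e n" by (simp add: e_def divide_left_mono)
      then have "(e (Suc n) * norm z)\<^sup>2 \<le> (e n * norm z)\<^sup>2"
        using e[of n] e[of "Suc n"] by (intro power_mono mult_right_mono) (auto simp: less_imp_le)
      then show ?thesis using e[of n] e[of "Suc n"] by (simp add: gaussian_def)
    qed
    then show "incseq (\<lambda>n z. ennreal ((cmod (inv_ft g z))\<^sup>2 * gaussian (e n *\<^sub>R z)))"
      by (auto intro!: incseq_SucI le_funI ennreal_leI mult_left_mono)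
    show "(\<lambda>z. ennreal ((cmod (inv_ft g z))\<^sup>2 * gaussian (e n *\<^sub>R z))) \<in> borel_measurable lborel" for n by measurable
    show "(\<lambda>n. ennreal ((cmod (inv_ft g z))\<^sup>2 * gaussian (e n *\<^sub>R z))) \<longlonglongrightarrow> ennreal ((cmod (inv_ft g z))\<^sup>2)" for z
    proof -
      have "(\<lambda>n. gaussian (e n *\<^sub>R z)) \<longlonglongrightarrow> 1" unfolding e_def by (rule gaussian_scaled_tendsto)
      then have "(\<lambda>n. (cmod (inv_ft g z))\<^sup>2 * gaussian (e n *\<^sub>R z)) \<longlonglongrightarrow> (cmod (inv_ft g z))\<^sup>2 * 1"
        by (intro tendsto_intros)
      then show ?thesis by (intro tendsto_ennrealI) simp
    qed
  qed
  moreover have "(\<integral>\<^sup>+z. ennreal ((cmod (inv_ft g z))\<^sup>2 * gaussian (e n *\<^sub>R z)) \<partial>lborel) = ennreal (J n)" for n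
    unfolding J_def by (rule nn_integral_eq_integral[OF Ji]) simp
  moreover have "(\<lambda>n. ennreal (J n)) \<longlonglongrightarrow> ennreal ((2 * pi) ^ DIM('a) * (\<integral>\<xi>. (cmod (g \<xi>))\<^sup>2 \<partial>lborel))"
    by (rule tendsto_ennrealI[OF lim])
  ultimately show "(\<integral>\<^sup>+z. ennreal ((cmod (inv_ft g z))\<^sup>2) \<partial>lborel) = ennreal ((2 * pi) ^ DIM('a) * (\<integral>\<xi>. (cmod (g \<xi>))\<^sup>2 \<partial>lborel))"
    using LIMSEQ_unique by simp
qed

text \<open>Open sets are stable under intersection and generate the Borel sets, so the vanishing
  spreads to all Borel sets; uniqueness of densities concludes.\<close>

lemma AE_eq_0_if_open_integrals_0:
  fixes f :: "'a::euclidean_space \<Rightarrow> real"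
  assumes f: "integrable lborel f" and 0: "\<And>U. open U \<Longrightarrow> (\<integral>x. indicator U x * f x \<partial>lborel) = 0"
  shows "AE x in lborel. f x = 0"
proof (rule density_unique_real[OF f])
  have [measurable]: "f \<in> borel_measurable borel" using borel_measurable_integrable[OF f] by simp
  have ii: "integrable lborel (\<lambda>x. indicator A x * f x)" if "A \<in> sets borel" for A
    using integrable_mult_indicator[OF _ f, of A] that by simp
  fix A :: "'a set" assume "A \<in> sets lborel"
  then have A: "A \<in> sigma_sets UNIV {U. open U}" by (simp add: borel_def)
  have "Int_stable {U::'a set. open U}" "{U::'a set. open U} \<subseteq> Pow UNIV" by (auto simp: Int_stable_def)
  from this A have "(\<integral>x. indicator A x * f x \<partial>lborel) = 0"
  proof (induction rule: sigma_sets_induct_disjoint)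
    case (basic A)
    then show ?case using 0 by simp
  next
    case empty
    then show ?case by simp
  next
    case (compl A)
    then have A: "A \<in> sets borel" by (simp add: borel_def)
    have "(\<integral>x. indicator (UNIV - A) x * f x \<partial>lborel) = (\<integral>x. f x - indicator A x * f x \<partial>lborel)"
      by (intro Bochner_Integration.integral_cong) (auto simp: indicator_def)
    also have "\<dots> = (\<integral>x. f x \<partial>lborel) - (\<integral>x. indicator A x * f x \<partial>lborel)"
      by (rule Bochner_Integration.integral_diff[OF f ii[OF A]])
    also have "\<dots> = 0" using 0[of UNIV] compl by simp
    finally show ?case .
  next
    case (union A)
    then have A: "A i \<in> sets borel" for i by (auto simp: borel_def)
    have "(\<integral>x\<in>(\<Union>i. A i). f x \<partial>lborel) = (\<Sum>i. (\<integral>x\<in>A i. f x \<partial>lborel))"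
      by (rule lebesgue_integral_countable_add)
         (use A ii[of "\<Union>i. A i"] union(1) in \<open>auto simp: set_integrable_def disjoint_family_on_def\<close>)
    then show ?case using union(3) by (simp add: set_lebesgue_integral_def)
  qed
  then show "(\<integral>x\<in>A. f x \<partial>lborel) = (\<integral>x\<in>A. 0 \<partial>lborel)"
    by (simp add: set_lebesgue_integral_def)
qed simp

text \<open>Truncated multiples of the distance to the complement increase to the indicator of a
  bounded open set, and dominated convergence passes to that indicator. Balls exhaust the space, and
  real and imaginary parts are treated separately.\<close>

lemma AE_eq_0_if_test_integrals_0:
  fixes r :: "'a::euclidean_space \<Rightarrow> complex"
  assumes r[measurable]: "r \<in> borel_measurable borel"
    and loc: "\<And>K. bounded K \<Longrightarrow> open K \<Longrightarrow> integrable lborel (\<lambda>x. indicator K x *\<^sub>R r x)"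
    and 0: "\<And>w::'a \<Rightarrow> real. continuous_on UNIV w \<Longrightarrow> bounded {x. w x \<noteq> 0} \<Longrightarrow> (\<And>x. 0 \<le> w x \<and> w x \<le> 1) \<Longrightarrow>
        (\<integral>x. r x * complex_of_real (w x) \<partial>lborel) = 0"
  shows "AE x in lborel. r x = 0"
proof -
  have U: "(\<integral>x. indicator U x *\<^sub>R r x \<partial>lborel) = 0" if "open U" "bounded U" for U :: "'a set"
  proof -
    define w where "w = (\<lambda>n x. min 1 (real n * infdist x (- U)))"
    \<comment> \<open>\<open>infdist\<close> to the empty set is 0 by convention, which would make
      every \<open>w n\<close> vanish.\<close>
    have ne: "- U \<noteq> {}" using that(2) by (metis Compl_empty_eq double_compl not_bounded_UNIV)
    have wU: "w n x = 0" if "x \<notin> U" for n x using that by (simp add: w_def)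
    have w01: "0 \<le> w n x \<and> w n x \<le> 1" for n x by (simp add: w_def infdist_nonneg)
    have z: "(\<integral>x. r x * complex_of_real (w n x) \<partial>lborel) = 0" for n
    proof (rule 0)
      show "continuous_on UNIV (w n)" unfolding w_def by (intro continuous_intros)
      show "bounded {x. w n x \<noteq> 0}" by (rule bounded_subset[OF that(2)]) (use wU in auto)
    qed (rule w01)
    have [measurable]: "w n \<in> borel_measurable borel" for n
      unfolding w_def by (intro borel_measurable_continuous_onI continuous_intros)
    have [measurable]: "U \<in> sets borel" using that by simp
    have "(\<lambda>n. \<integral>x. r x * complex_of_real (w n x) \<partial>lborel) \<longlonglongrightarrow> (\<integral>x. indicator U x *\<^sub>R r x \<partial>lborel)"
    proof (rule integral_dominated_convergence[where w = "\<lambda>x. norm (indicator U x *\<^sub>R r x)"])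
      show "integrable lborel (\<lambda>x. norm (indicator U x *\<^sub>R r x))" by (rule integrable_norm[OF loc[OF that(2,1)]])
      have "(\<lambda>n. r x * complex_of_real (w n x)) \<longlonglongrightarrow> indicator U x *\<^sub>R r x" for x
      proof (cases "x \<in> U")
        case True
        then have "0 < infdist x (- U)"
          using in_closed_iff_infdist_zero[OF _ ne, of x] that(1) infdist_nonneg[of x "- U"]
          by (metis ComplD closed_Compl less_le)
        then obtain N :: nat where N: "1 \<le> real N * infdist x (- U)"
          using reals_Archimedean3[of "infdist x (- U)"] less_le by blast
        have "w n x = 1" if "n \<ge> N" for n
        proof -
          have "real N * infdist x (- U) \<le> real n * infdist x (- U)" using that by (simp add: mult_right_mono infdist_nonneg)
          then show ?thesis using N by (simp add: w_def)
        qed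
        then have "eventually (\<lambda>n. r x * complex_of_real (w n x) = indicator U x *\<^sub>R r x) sequentially"
          using True by (auto simp: eventually_sequentially)
        then show ?thesis by (rule tendsto_eventually)
      next
        case False
        then show ?thesis by (simp add: wU)
      qed
      then show "AE x in lborel. (\<lambda>n. r x * complex_of_real (w n x)) \<longlonglongrightarrow> indicator U x *\<^sub>R r x" by simp
      show "AE x in lborel. norm (r x * complex_of_real (w n x)) \<le> norm (indicator U x *\<^sub>R r x)" for n
      proof (rule AE_I2)
        fix x show "norm (r x * complex_of_real (w n x)) \<le> norm (indicator U x *\<^sub>R r x)"
          using w01[of n x] wU[of x n] by (cases "x \<in> U") (auto simp: norm_mult intro: mult_left_le)
      qed
    qed measurable
    then show ?thesis using z LIMSEQ_unique tendsto_const by (simp add: LIMSEQ_const_iff)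
  qed
  have "AE x in lborel. indicator (ball 0 (real n)) x *\<^sub>R r x = 0" for n :: nat
  proof -
    let ?B = "ball (0::'a) (real n)"
    have i: "integrable lborel (\<lambda>x. indicator ?B x *\<^sub>R r x)" by (rule loc) auto
    have iU: "(\<integral>x. indicator V x *\<^sub>R (indicator ?B x *\<^sub>R r x) \<partial>lborel) = 0" if "open V" for V
    proof -
      have "(\<integral>x. indicator (V \<inter> ?B) x *\<^sub>R r x \<partial>lborel) = 0" by (rule U) (use that in auto)
      then show ?thesis by (simp add: indicator_inter_arith mult.assoc)
    qed
    have iV: "integrable lborel (\<lambda>x. indicator V x *\<^sub>R (indicator ?B x *\<^sub>R r x))" if "open V" for V
      by (rule integrable_mult_indicator[OF _ i]) (use that in simp)
    have "AE x in lborel. Re (indicator ?B x *\<^sub>R r x) = 0"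
    proof (rule AE_eq_0_if_open_integrals_0)
      fix V :: "'a set" assume V: "open V"
      have "(\<integral>x. indicator V x * Re (indicator ?B x *\<^sub>R r x) \<partial>lborel) = (\<integral>x. Re (indicator V x *\<^sub>R (indicator ?B x *\<^sub>R r x)) \<partial>lborel)"
        by (simp add: mult.assoc)
      also have "\<dots> = Re (\<integral>x. indicator V x *\<^sub>R (indicator ?B x *\<^sub>R r x) \<partial>lborel)"
        by (rule integral_Re[OF iV[OF V]])
      finally show "(\<integral>x. indicator V x * Re (indicator ?B x *\<^sub>R r x) \<partial>lborel) = 0" using iU[OF V] by simp
    qed (rule integrable_Re[OF i])
    moreover have "AE x in lborel. Im (indicator ?B x *\<^sub>R r x) = 0"
    proof (rule AE_eq_0_if_open_integrals_0)
      fix V :: "'a set" assume V: "open V"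
      have "(\<integral>x. indicator V x * Im (indicator ?B x *\<^sub>R r x) \<partial>lborel) = (\<integral>x. Im (indicator V x *\<^sub>R (indicator ?B x *\<^sub>R r x)) \<partial>lborel)"
        by (simp add: mult.assoc)
      also have "\<dots> = Im (\<integral>x. indicator V x *\<^sub>R (indicator ?B x *\<^sub>R r x) \<partial>lborel)"
        by (rule integral_Im[OF iV[OF V]])
      finally show "(\<integral>x. indicator V x * Im (indicator ?B x *\<^sub>R r x) \<partial>lborel) = 0" using iU[OF V] by simp
    qed (rule integrable_Im[OF i])
    ultimately show ?thesis by eventually_elim (simp add: complex_eq_iff)
  qed
  then have "AE x in lborel. \<forall>n::nat. indicator (ball 0 (real n)) x *\<^sub>R r x = 0" by (subst AE_all_countable) blast
  then show ?thesis
  proof eventually_elim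
    case (elim x)
    obtain n :: nat where "norm x < real n" using reals_Archimedean2 by blast
    then show ?case using elim[rule_format, of n] by (simp add: indicator_def split: if_splits)
  qed
qed

lemma fourier_inv_ft: "fourier \<psi> \<xi> = inv_ft \<psi> (- \<xi>)"
  unfolding fourier_def inv_ft_def by (simp add: cis_conv_exp inner_commute)

lemma continuous_on_fourier: "integrable lborel \<psi> \<Longrightarrow> continuous_on S (fourier \<psi>)"
  unfolding fourier_inv_ft[abs_def] by (intro continuous_intros)

lemma fourier_bound: "cmod (fourier \<psi> \<xi>) \<le> (\<integral>x. cmod (\<psi> x) \<partial>lborel)"
  unfolding fourier_inv_ft by (rule inv_ft_bound)

text \<open>Both sides are compared by pairing with continuous test functions \<open>w\<close> of
  bounded support. The transform of such a \<open>w\<close> need not be integrable, hence the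
  Gaussian regularisation.\<close>

lemma fourier_inversion_AE:
  fixes \<psi> :: "'a::euclidean_space \<Rightarrow> complex"
  assumes \<psi>: "integrable lborel \<psi>" and h: "integrable lborel (fourier \<psi>)"
  shows "AE x in lborel. inv_ft (fourier \<psi>) x = complex_of_real ((2 * pi) ^ DIM('a)) * \<psi> x"
proof -
  let ?c = "complex_of_real ((2 * pi) ^ DIM('a))"
  have [measurable]: "\<psi> \<in> borel_measurable borel" "fourier \<psi> \<in> borel_measurable borel"
    using borel_measurable_integrable[OF \<psi>] borel_measurable_integrable[OF h] by simp_all
  have [measurable]: "inv_ft (fourier \<psi>) \<in> borel_measurable borel" by (rule inv_ft_measurable[OF h])
  have weak: "(\<integral>x. inv_ft (fourier \<psi>) x * w x \<partial>lborel) = ?c * (\<integral>x. \<psi> x * w x \<partial>lborel)"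
    if w: "integrable lborel w" "continuous_on UNIV w" "\<And>x. cmod (w x) \<le> 1" for w :: "'a \<Rightarrow> complex"
  proof -
    have [measurable]: "w \<in> borel_measurable borel" using w(2) by (rule borel_measurable_continuous_onI)
    have [measurable]: "inv_ft w \<in> borel_measurable borel" by (rule inv_ft_measurable[OF w(1)])
    define N where "N = (\<integral>x. cmod (w x) \<partial>lborel)"
    have N: "cmod (inv_ft w z) \<le> N" for z unfolding N_def by (rule inv_ft_bound)
    have N0: "0 \<le> N" unfolding N_def by simp
    define e where "e = (\<lambda>n. 1 / real (Suc n))"
    have e: "0 < e n" for n by (simp add: e_def)
    \<comment> \<open>One regularised pairing with two descriptions: as the weight tends to 1 it
      gives the pairing of the transforms, and after both transforms are moved onto \<open>w\<close>
      it is a mollification of \<open>w\<close> integrated against \<open>\<psi>\<close>.\<close>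
    define I where "I = (\<lambda>n. \<integral>\<xi>. fourier \<psi> \<xi> * (inv_ft w \<xi> * complex_of_real (gaussian (e n *\<^sub>R \<xi>))) \<partial>lborel)"
    have 1: "I \<longlonglongrightarrow> (\<integral>\<xi>. fourier \<psi> \<xi> * (inv_ft w \<xi> * 1) \<partial>lborel)"
      unfolding I_def
    proof (rule integral_dominated_convergence[where w = "\<lambda>\<xi>. cmod (fourier \<psi> \<xi>) * N"])
      show "integrable lborel (\<lambda>\<xi>. cmod (fourier \<psi> \<xi>) * N)" by (intro integrable_mult_left integrable_norm h)
      have "(\<lambda>n. fourier \<psi> \<xi> * (inv_ft w \<xi> * complex_of_real (gaussian (e n *\<^sub>R \<xi>)))) \<longlonglongrightarrow> fourier \<psi> \<xi> * (inv_ft w \<xi> * 1)" for \<xi>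
      proof -
        have "(\<lambda>n. gaussian (e n *\<^sub>R \<xi>)) \<longlonglongrightarrow> 1" unfolding e_def by (rule gaussian_scaled_tendsto)
        then have "(\<lambda>n. complex_of_real (gaussian (e n *\<^sub>R \<xi>))) \<longlonglongrightarrow> complex_of_real 1" by (rule tendsto_of_real)
        then show ?thesis by (intro tendsto_mult tendsto_const) simp
      qed
      then show "AE \<xi> in lborel. (\<lambda>n. fourier \<psi> \<xi> * (inv_ft w \<xi> * complex_of_real (gaussian (e n *\<^sub>R \<xi>)))) \<longlonglongrightarrow> fourier \<psi> \<xi> * (inv_ft w \<xi> * 1)" by simp
      show "AE \<xi> in lborel. norm (fourier \<psi> \<xi> * (inv_ft w \<xi> * complex_of_real (gaussian (e n *\<^sub>R \<xi>)))) \<le> cmod (fourier \<psi> \<xi>) * N" for n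
      proof (rule AE_I2)
        fix \<xi>
        have "cmod (inv_ft w \<xi>) * gaussian (e n *\<^sub>R \<xi>) \<le> N * 1"
          by (rule mult_mono[OF N gaussian_le_1 N0]) simp
        then show "norm (fourier \<psi> \<xi> * (inv_ft w \<xi> * complex_of_real (gaussian (e n *\<^sub>R \<xi>)))) \<le> cmod (fourier \<psi> \<xi>) * N"
          by (simp add: norm_mult mult_left_mono)
      qed
    qed measurable
    have In: "I n = (\<integral>x. \<psi> x * (complex_of_real (gaussian_mass TYPE('a)) * (\<integral>\<zeta>. w (x - e n *\<^sub>R \<zeta>) * complex_of_real (gaussian \<zeta>) \<partial>lborel)) \<partial>lborel)" for n
    proof -
      let ?k = "\<lambda>z. inv_ft (\<lambda>\<eta>. w (- \<eta>)) z * complex_of_real (gaussian (e n *\<^sub>R z))"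
      have w': "integrable lborel (\<lambda>x. w (- x))" using integrable_affine[OF w(1), of "-1" 0] by simp
      have flip: "inv_ft (\<lambda>\<eta>. w (- \<eta>)) z = inv_ft w (- z)" for z
      proof -
        have "inv_ft w (- z) = \<bar>-1::real\<bar> ^ DIM('a) *\<^sub>R (\<integral>\<xi>. cis ((- z) \<bullet> (0 + (-1) *\<^sub>R \<xi>)) * w (0 + (-1) *\<^sub>R \<xi>) \<partial>lborel)"
          unfolding inv_ft_def by (rule integral_affine) (simp, measurable)
        then show ?thesis unfolding inv_ft_def by simp
      qed
      have k: "integrable lborel ?k"
      proof (rule Bochner_Integration.integrable_bound)
        show "integrable lborel (\<lambda>z::'a. N * gaussian (e n *\<^sub>R z))"
          using e[of n] by (intro integrable_mult_right integrable_gaussian_scaled) auto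
        show "AE z in lborel. norm (?k z) \<le> norm (N * gaussian (e n *\<^sub>R z))"
          using N N0 by (auto simp: flip norm_mult intro!: mult_right_mono)
        show "?k \<in> borel_measurable lborel" unfolding flip by measurable
      qed
      have "I n = \<bar>-1::real\<bar> ^ DIM('a) *\<^sub>R (\<integral>\<xi>. fourier \<psi> (0 + (-1) *\<^sub>R \<xi>) * (inv_ft w (0 + (-1) *\<^sub>R \<xi>) * complex_of_real (gaussian (e n *\<^sub>R (0 + (-1) *\<^sub>R \<xi>)))) \<partial>lborel)"
        unfolding I_def by (rule integral_affine) (simp, measurable)
      also have "\<dots> = (\<integral>\<xi>. inv_ft \<psi> \<xi> * ?k \<xi> \<partial>lborel)" by (simp add: fourier_inv_ft flip)
      also have "\<dots> = (\<integral>x. \<psi> x * inv_ft ?k x \<partial>lborel)" by (rule inv_ft_multiplication[OF \<psi> k])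
      finally show ?thesis by (simp only: gaussian_regularised_inversion[OF w(1) e])
    qed
    have 2: "I \<longlonglongrightarrow> (\<integral>x. \<psi> x * (complex_of_real (gaussian_mass TYPE('a)) * (complex_of_real (gaussian_mass TYPE('a)) * w x)) \<partial>lborel)"
      unfolding In
    proof (rule integral_dominated_convergence[where w = "\<lambda>x. cmod (\<psi> x) * (gaussian_mass TYPE('a) * (1 * gaussian_mass TYPE('a)))"])
      show "integrable lborel (\<lambda>x. cmod (\<psi> x) * (gaussian_mass TYPE('a) * (1 * gaussian_mass TYPE('a))))" by (intro integrable_mult_left integrable_norm \<psi>)
      have "(\<lambda>n. \<psi> x * (complex_of_real (gaussian_mass TYPE('a)) * (\<integral>\<zeta>. w (x - e n *\<^sub>R \<zeta>) * complex_of_real (gaussian \<zeta>) \<partial>lborel))) \<longlonglongrightarrow>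
          \<psi> x * (complex_of_real (gaussian_mass TYPE('a)) * (complex_of_real (gaussian_mass TYPE('a)) * w x))" for x
        unfolding e_def by (intro tendsto_mult tendsto_const gaussian_mollifier_limit[OF w(3,2)])
      then show "AE x in lborel. (\<lambda>n. \<psi> x * (complex_of_real (gaussian_mass TYPE('a)) * (\<integral>\<zeta>. w (x - e n *\<^sub>R \<zeta>) * complex_of_real (gaussian \<zeta>) \<partial>lborel))) \<longlonglongrightarrow>
          \<psi> x * (complex_of_real (gaussian_mass TYPE('a)) * (complex_of_real (gaussian_mass TYPE('a)) * w x))" by simp
      show "AE x in lborel. norm (\<psi> x * (complex_of_real (gaussian_mass TYPE('a)) * (\<integral>\<zeta>. w (x - e n *\<^sub>R \<zeta>) * complex_of_real (gaussian \<zeta>) \<partial>lborel)))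
          \<le> cmod (\<psi> x) * (gaussian_mass TYPE('a) * (1 * gaussian_mass TYPE('a)))" for n
        unfolding norm_mult norm_of_real abs_of_pos[OF gaussian_mass_pos]
        using gaussian_mass_pos[where 'a='a] by (intro AE_I2 mult_left_mono gaussian_mollifier_bound w(3)) auto
    qed measurable
    have "(\<integral>x. inv_ft (fourier \<psi>) x * w x \<partial>lborel) = (\<integral>\<xi>. fourier \<psi> \<xi> * inv_ft w \<xi> \<partial>lborel)"
      by (rule inv_ft_multiplication[OF h w(1)])
    also have "\<dots> = (\<integral>x. \<psi> x * (complex_of_real (gaussian_mass TYPE('a)) * (complex_of_real (gaussian_mass TYPE('a)) * w x)) \<partial>lborel)"
      using LIMSEQ_unique[OF 1 2] by simp
    also have "\<dots> = (\<integral>x. ?c * (\<psi> x * w x) \<partial>lborel)"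
      unfolding gaussian_mass_sq[symmetric] by (simp add: power2_eq_square mult_ac)
    also have "\<dots> = ?c * (\<integral>x. \<psi> x * w x \<partial>lborel)" by (rule integral_mult_right_zero)
    finally show ?thesis .
  qed
  have "AE x in lborel. inv_ft (fourier \<psi>) x - ?c * \<psi> x = 0"
  proof (rule AE_eq_0_if_test_integrals_0)
    show "(\<lambda>x. inv_ft (fourier \<psi>) x - ?c * \<psi> x) \<in> borel_measurable borel" by measurable
    have io: "integrable lborel (\<lambda>x. indicator K x *\<^sub>R inv_ft (fourier \<psi>) x)" if K: "bounded K" "K \<in> sets borel" for K :: "'a set"
    proof -
      obtain r where r: "K \<subseteq> cball 0 r" using K(1) by (auto simp: bounded_iff subset_iff)
      have "integrable lborel (\<lambda>x. indicator (cball 0 r) x *\<^sub>R inv_ft (fourier \<psi>) x)"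
        by (rule borel_integrable_compact) (auto intro!: continuous_intros h)
      then have "integrable lborel (\<lambda>x. indicator K x *\<^sub>R (indicator (cball 0 r) x *\<^sub>R inv_ft (fourier \<psi>) x))"
        by (rule integrable_mult_indicator[rotated]) (use K in simp)
      also have "(\<lambda>x. indicator K x *\<^sub>R (indicator (cball 0 r) x *\<^sub>R inv_ft (fourier \<psi>) x)) = (\<lambda>x. indicator K x *\<^sub>R inv_ft (fourier \<psi>) x)"
        using r by (auto simp: fun_eq_iff indicator_def)
      finally show ?thesis .
    qed
    have ip: "integrable lborel (\<lambda>x. indicator K x *\<^sub>R (?c * \<psi> x))" if "K \<in> sets borel" for K :: "'a set"
      by (rule integrable_mult_indicator) (use \<psi> that in \<open>auto intro: integrable_mult_right\<close>)
    show "integrable lborel (\<lambda>x. indicator K x *\<^sub>R (inv_ft (fourier \<psi>) x - ?c * \<psi> x))" if "bounded K" "open K" for K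
      unfolding scaleR_diff_right by (intro Bochner_Integration.integrable_diff io ip) (use that in auto)
    fix w :: "'a \<Rightarrow> real"
    assume w: "continuous_on UNIV w" "bounded {x. w x \<noteq> 0}" "\<And>x. 0 \<le> w x \<and> w x \<le> 1"
    obtain r where r: "{x. w x \<noteq> 0} \<subseteq> cball 0 r" using w(2) by (auto simp: bounded_iff subset_iff)
    have "integrable lborel (\<lambda>x. indicator (cball 0 r) x *\<^sub>R complex_of_real (w x))"
      by (rule borel_integrable_compact) (auto intro!: continuous_intros continuous_on_subset[OF w(1)])
    also have "(\<lambda>x. indicator (cball 0 r) x *\<^sub>R complex_of_real (w x)) = (\<lambda>x. complex_of_real (w x))"
    proof
      fix x show "indicator (cball 0 r) x *\<^sub>R complex_of_real (w x) = complex_of_real (w x)"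
        using r by (cases "w x = 0") (auto simp: indicator_def)
    qed
    finally have wi: "integrable lborel (\<lambda>x. complex_of_real (w x))" .
    have [measurable]: "w \<in> borel_measurable borel" using w(1) by (rule borel_measurable_continuous_onI)
    have "cmod (complex_of_real (w x)) \<le> 1" for x using w(3)[of x] by simp
    note weak = weak[OF wi _ this]
    have i1: "integrable lborel (\<lambda>x. inv_ft (fourier \<psi>) x * complex_of_real (w x))"
    proof (rule Bochner_Integration.integrable_bound)
      let ?N = "\<integral>\<xi>. cmod (fourier \<psi> \<xi>) \<partial>lborel"
      show "integrable lborel (\<lambda>x. ?N * w x)" using wi by (simp add: complex_of_real_integrable_eq)
      show "AE x in lborel. norm (inv_ft (fourier \<psi>) x * complex_of_real (w x)) \<le> norm (?N * w x)"
        using inv_ft_bound[of "fourier \<psi>"] by (auto simp: norm_mult abs_mult intro!: mult_right_mono)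
    qed measurable
    have i2: "integrable lborel (\<lambda>x. ?c * (\<psi> x * complex_of_real (w x)))"
    proof (rule integrable_mult_right, rule Bochner_Integration.integrable_bound[OF \<psi>])
      show "AE x in lborel. norm (\<psi> x * complex_of_real (w x)) \<le> norm (\<psi> x)"
        using w(3) by (auto simp: norm_mult intro!: mult_left_le)
    qed measurable
    have "(\<integral>x. (inv_ft (fourier \<psi>) x - ?c * \<psi> x) * complex_of_real (w x) \<partial>lborel) =
       (\<integral>x. inv_ft (fourier \<psi>) x * complex_of_real (w x) - ?c * (\<psi> x * complex_of_real (w x)) \<partial>lborel)"
      by (simp only: left_diff_distrib mult.assoc)
    also have "\<dots> = (\<integral>x. inv_ft (fourier \<psi>) x * complex_of_real (w x) \<partial>lborel) - (\<integral>x. ?c * (\<psi> x * complex_of_real (w x)) \<partial>lborel)"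
      by (rule Bochner_Integration.integral_diff[OF i1 i2])
    also have "\<dots> = 0" unfolding integral_mult_right_zero using weak w(1) by (auto intro!: continuous_intros)
    finally show "(\<integral>x. (inv_ft (fourier \<psi>) x - ?c * \<psi> x) * complex_of_real (w x) \<partial>lborel) = 0" .
  qed
  then show ?thesis by eventually_elim simp
qed

section \<open>Observability\<close>

text \<open>The free evolution described by its symbol on the Fourier side, without the factor
  \<open>(2 * pi) powr (- real DIM('a))\<close> of \<open>schr_free\<close>.\<close>

definition evol :: "('a::euclidean_space \<Rightarrow> complex) \<Rightarrow> real \<Rightarrow> 'a \<Rightarrow> complex" where
  "evol h t = inv_ft (\<lambda>\<xi>. cis (- (t * (norm \<xi>)\<^sup>2)) * h \<xi>)"

lemma integrable_evol_symbol:
  "integrable lborel h \<Longrightarrow> integrable lborel (\<lambda>\<xi>::'a::euclidean_space. cis (- (t * (norm \<xi>)\<^sup>2)) * h \<xi>)"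
  by (rule integrable_cis_mult) auto

lemma evol_eq: "evol h t x = (\<integral>\<xi>. cis (x \<bullet> \<xi> - t * (norm \<xi>)\<^sup>2) * h \<xi> \<partial>lborel)"
proof -
  have "cis (x \<bullet> \<xi>) * (cis (- (t * (norm \<xi>)\<^sup>2)) * h \<xi>) = cis (x \<bullet> \<xi> - t * (norm \<xi>)\<^sup>2) * h \<xi>" for \<xi>
    unfolding mult.assoc[symmetric] cis_mult by simp
  then show ?thesis unfolding evol_def inv_ft_def by (simp only:)
qed

lemma continuous_on_evol:
  assumes h: "integrable lborel h"
  shows "continuous_on S (\<lambda>p. evol h (fst p) (snd p))"
proof -
  have [measurable]: "h \<in> borel_measurable borel" using borel_measurable_integrable[OF h] by simp
  show ?thesis
    unfolding evol_eq
    by (rule continuous_on_parametric_integral[where G = "\<lambda>x. cmod (h x)"])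
       (use h in \<open>auto simp: norm_mult intro!: continuous_intros\<close>)
qed

lemma evol_measurable [measurable]:
  assumes h: "integrable lborel h"
  shows "(\<lambda>(t, x). evol h t x) \<in> borel_measurable borel"
proof -
  have "(\<lambda>p. evol h (fst p) (snd p)) \<in> borel_measurable borel"
    by (rule borel_measurable_continuous_onI[OF continuous_on_evol[OF h]])
  then show ?thesis by (simp add: case_prod_unfold)
qed

lemma evol_measurable2 [measurable]:
  assumes h: "integrable lborel h" and [measurable]: "f \<in> borel_measurable M" "g \<in> borel_measurable M"
  shows "(\<lambda>x. evol h (f x) (g x)) \<in> borel_measurable M"
proof -
  have "(\<lambda>x. (f x, g x)) \<in> borel_measurable M" by (rule borel_measurable_Pair) (use assms in auto)
  from measurable_compose[OF this evol_measurable[OF h]] show ?thesis by simp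
qed

text \<open>The class to which \<open>plancherel\<close> applies; it contains the Fourier transforms
  of test functions and is stable under evolution and under forming packets.\<close>

definition regular_symbol :: "('a::euclidean_space \<Rightarrow> complex) \<Rightarrow> bool" where
  "regular_symbol h \<longleftrightarrow> integrable lborel h \<and> continuous_on UNIV h \<and> (\<exists>B. \<forall>x. cmod (h x) \<le> B)"

lemma regular_symbol_evol_symbol: "regular_symbol h \<Longrightarrow> regular_symbol (\<lambda>\<xi>. cis (- (t * (norm \<xi>)\<^sup>2)) * h \<xi>)"
  unfolding regular_symbol_def by (auto simp: norm_mult intro!: continuous_intros integrable_evol_symbol)

lemma plancherel_regular_symbol:
  fixes g :: "'a::euclidean_space \<Rightarrow> complex"
  assumes "regular_symbol g"
  shows "integrable lborel (\<lambda>\<xi>. (cmod (g \<xi>))\<^sup>2)"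
    and "(\<integral>\<^sup>+z. ennreal ((cmod (inv_ft g z))\<^sup>2) \<partial>lborel) = ennreal ((2 * pi) ^ DIM('a) * (\<integral>\<xi>. (cmod (g \<xi>))\<^sup>2 \<partial>lborel))"
  using assms plancherel[of g] unfolding regular_symbol_def by blast+

lemma plancherel_evol:
  fixes h :: "'a::euclidean_space \<Rightarrow> complex"
  assumes "regular_symbol h"
  shows "(\<integral>\<^sup>+z. ennreal ((cmod (evol h t z))\<^sup>2) \<partial>lborel) = ennreal ((2 * pi) ^ DIM('a) * (\<integral>\<xi>. (cmod (h \<xi>))\<^sup>2 \<partial>lborel))"
  unfolding evol_def plancherel_regular_symbol(2)[OF regular_symbol_evol_symbol[OF assms]] by (simp add: norm_mult)

lemma nn_integral_translate:
  fixes f :: "'a::euclidean_space \<Rightarrow> ennreal"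
  assumes [measurable]: "f \<in> borel_measurable borel"
  shows "(\<integral>\<^sup>+x. f (t + x) \<partial>lborel) = (\<integral>\<^sup>+x. f x \<partial>lborel)"
proof -
  have "(\<integral>\<^sup>+x. f x \<partial>lborel) = (\<integral>\<^sup>+x. f x \<partial>distr lborel borel ((+) t))" by (simp add: lborel_distr_plus)
  also have "\<dots> = (\<integral>\<^sup>+x. f (t + x) \<partial>lborel)" by (rule nn_integral_distr) auto
  finally show ?thesis by simp
qed

lemma integral_translate:
  fixes f :: "'a::euclidean_space \<Rightarrow> complex"
  assumes [measurable]: "f \<in> borel_measurable borel"
  shows "(\<integral>x. f (t + x) \<partial>lborel) = (\<integral>x. f x \<partial>lborel)"
  using integral_affine[of 1 f t] by simp

lemma norm_half_one_plus_cis: "cmod ((1 + cis s) / 2) = \<bar>cos (s / 2)\<bar>"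
proof -
  have "(cmod (1 + cis s))\<^sup>2 = (1 + cos s)\<^sup>2 + (sin s)\<^sup>2" by (simp add: cmod_power2)
  also have "\<dots> = 2 + 2 * cos s" using sin_cos_squared_add[of s] by (simp add: power2_eq_square algebra_simps)
  also have "\<dots> = (2 * \<bar>cos (s / 2)\<bar>)\<^sup>2" using cos_double_cos[of "s / 2"] by (simp add: power_mult_distrib)
  finally have "cmod (1 + cis s) = 2 * \<bar>cos (s / 2)\<bar>" by (rule power2_eq_imp_eq) auto
  then show ?thesis by (simp add: norm_divide)
qed

lemma polynomial_times_geometric_small:
  assumes q: "0 \<le> q" "q < 1" and d: "0 < d" and K: "0 \<le> K"
  shows "\<exists>n. K * q ^ (2 * n) * (real n + 1) ^ (2 * d) \<le> 1/2"
proof -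
  \<comment> \<open>Taking the \<open>d\<close>-th root turns the whole expression into the power
    \<open>2 * d\<close> of \<open>(n + 1) * s ^ n\<close>, which tends to 0.\<close>
  define s where "s = root d q"
  have s: "0 \<le> s" "s < 1" "s ^ d = q" using q d by (auto simp: s_def)
  have "(\<lambda>n. real n * s ^ n + s ^ n) \<longlonglongrightarrow> 0 + 0"
    by (intro tendsto_add powser_times_n_limit_0 LIMSEQ_realpow_zero) (use s in auto)
  then have "(\<lambda>n. K * (real n * s ^ n + s ^ n) ^ (2 * d)) \<longlonglongrightarrow> K * (0 + 0) ^ (2 * d)"
    by (intro tendsto_mult tendsto_power tendsto_const)
  then have "(\<lambda>n. K * (real n * s ^ n + s ^ n) ^ (2 * d)) \<longlonglongrightarrow> 0" using d by (simp add: power_0_left)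
  then have "eventually (\<lambda>n. K * (real n * s ^ n + s ^ n) ^ (2 * d) < 1/2) sequentially"
    by (rule order_tendstoD) simp
  then obtain n where n: "K * (real n * s ^ n + s ^ n) ^ (2 * d) < 1/2" by (auto simp: eventually_sequentially)
  have "(real n * s ^ n + s ^ n) ^ (2 * d) = (s ^ n * (real n + 1)) ^ (2 * d)" by (simp add: algebra_simps)
  also have "\<dots> = (s ^ d) ^ (2 * n) * (real n + 1) ^ (2 * d)"
    by (simp add: power_mult_distrib flip: power_mult) (simp add: mult_ac)
  finally show ?thesis using n s(3) by (intro exI[of _ n]) (simp add: mult.assoc)
qed

section \<open>A trigonometric polynomial that peaks at the lattice points\<close>

text \<open>\<open>b\<close> is \<open>2 * pi\<close> times the dual basis of \<open>v\<close>. The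
  second assumption encodes that the \<open>v j\<close> span the space, through the expansion
  actually used.\<close>

locale dual_frame =
  fixes v b :: "'a::euclidean_space \<Rightarrow> 'a"
  assumes dual: "\<And>i j. i \<in> Basis \<Longrightarrow> j \<in> Basis \<Longrightarrow> b i \<bullet> v j = (if i = j then 2 * pi else 0)"
    and expand: "\<And>z. z = (\<Sum>j\<in>Basis. (b j \<bullet> z / (2 * pi)) *\<^sub>R v j)"
begin

sublocale lattice_frame v
proof
  fix h assume h: "\<And>j. j \<in> Basis \<Longrightarrow> h \<bullet> v j = 0"
  have "h \<bullet> h = h \<bullet> (\<Sum>j\<in>Basis. (b j \<bullet> h / (2 * pi)) *\<^sub>R v j)" using expand[of h] by simp
  also have "\<dots> = 0" using h by (simp add: inner_sum_right)
  finally show "h = 0" by simp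
qed

text \<open>The modulus of each factor is \<open>\<bar>cos (b j \<bullet> z / 2)\<bar>\<close>, so
  the modulus of the product is 1 exactly on integer combinations of the \<open>v j\<close>.\<close>

definition peak :: "'a \<Rightarrow> complex" where
  "peak z = (\<Prod>j\<in>Basis. (1 + cis (b j \<bullet> z)) / 2)"

lemma peak_le_1: "cmod (peak z) \<le> 1"
  unfolding peak_def prod_norm[symmetric] norm_half_one_plus_cis by (intro prod_le_1) auto

lemma peak_localised:
  assumes \<rho>: "0 < \<rho>"
  obtains q where "0 \<le> q" "q < 1" "\<And>z. q < cmod (peak z) \<Longrightarrow> \<exists>n::'a \<Rightarrow> int. norm (z - (\<Sum>j\<in>Basis. of_int (n j) *\<^sub>R v j)) < \<rho>"
proof -
  define V where "V = (\<Sum>j\<in>Basis. norm (v j))"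
  have V: "0 < V" using sum_norm_pos by (simp add: V_def)
  \<comment> \<open>Allowed distance of each coordinate to the nearest integer: the second entry
    keeps the resulting displacement below \<open>\<rho>\<close>, while 1/2 keeps
    \<open>pi * \<eta>\<close> in the range where \<open>cos\<close> is nonnegative.\<close>
  define \<eta> where "\<eta> = min (1/2) (\<rho> / (2 * V))"
  have \<eta>: "0 < \<eta>" "\<eta> \<le> 1/2" "\<eta> * V < \<rho>"
  proof -
    show "0 < \<eta>" "\<eta> \<le> 1/2" using \<rho> V by (auto simp: \<eta>_def)
    have "\<eta> * V \<le> \<rho> / (2 * V) * V" using V by (intro mult_right_mono) (auto simp: \<eta>_def)
    also have "\<dots> < \<rho>" using V \<rho> by simp
    finally show "\<eta> * V < \<rho>" .
  qed
  define q where "q = cos (pi * \<eta>)"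
  show thesis
  proof (rule that[of q])
    have "pi * \<eta> \<le> pi * (1/2)" using \<eta> by (intro mult_left_mono) auto
    then show "0 \<le> q" unfolding q_def using \<eta> by (intro cos_ge_zero) (auto intro: order_trans[of _ 0])
    have "cos (pi * \<eta>) < cos 0" using \<eta> \<open>pi * \<eta> \<le> pi * (1/2)\<close> pi_gt_zero by (intro cos_monotone_0_pi) auto
    then show "q < 1" by (simp add: q_def)
    fix z assume z: "q < cmod (peak z)"
    define n where "n = (\<lambda>j. round (b j \<bullet> z / (2 * pi)))"
    define e where "e = (\<lambda>j. b j \<bullet> z / (2 * pi) - of_int (n j))"
    have e: "\<bar>e j\<bar> \<le> \<eta>" if j: "j \<in> Basis" for j
    proof (rule ccontr)
      assume "\<not> \<bar>e j\<bar> \<le> \<eta>"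
      have e2: "\<bar>e j\<bar> \<le> 1/2" unfolding e_def n_def using of_int_round_abs_le[of "b j \<bullet> z / (2 * pi)"] by (simp add: abs_minus_commute)
      have eq: "b j \<bullet> z / 2 = pi * of_int (n j) + pi * e j" by (simp add: e_def field_simps)
      have "\<bar>cos (b j \<bullet> z / 2)\<bar> = \<bar>cos (pi * e j)\<bar>"
        unfolding eq cos_add sin_npi_int cos_npi_int by simp
      also have "\<dots> = \<bar>cos (pi * \<bar>e j\<bar>)\<bar>" by (simp add: abs_if)
      also have "\<dots> = cos (pi * \<bar>e j\<bar>)"
      proof -
        have "pi * \<bar>e j\<bar> \<le> pi * (1/2)" using e2 by (intro mult_left_mono) auto
        then show ?thesis by (intro abs_of_nonneg cos_ge_zero) (auto intro: order_trans[of _ 0])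
      qed
      also have "\<dots> \<le> q"
      proof -
        have "pi * \<bar>e j\<bar> \<le> pi * 1" using e2 by (intro mult_left_mono) auto
        then show ?thesis unfolding q_def using \<open>\<not> \<bar>e j\<bar> \<le> \<eta>\<close> \<eta> by (intro cos_monotone_0_pi_le) auto
      qed
      finally have 1: "cmod ((1 + cis (b j \<bullet> z)) / 2) \<le> q" by (simp only: norm_half_one_plus_cis)
      have "cmod (peak z) = cmod ((1 + cis (b j \<bullet> z)) / 2) * (\<Prod>j\<in>Basis - {j}. cmod ((1 + cis (b j \<bullet> z)) / 2))"
        unfolding peak_def prod_norm[symmetric] by (rule prod.remove) (use j in auto)
      also have "\<dots> \<le> q * 1"
        by (intro mult_mono 1 prod_le_1 prod_nonneg \<open>0 \<le> q\<close>) (auto simp only: norm_half_one_plus_cis abs_cos_le_one norm_ge_zero abs_ge_zero)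
      finally show False using z by simp
    qed
    have "z - (\<Sum>j\<in>Basis. of_int (n j) *\<^sub>R v j) = (\<Sum>j\<in>Basis. e j *\<^sub>R v j)"
      by (subst (1) expand) (simp add: e_def sum_subtractf[symmetric] scaleR_diff_left)
    then have "norm (z - (\<Sum>j\<in>Basis. of_int (n j) *\<^sub>R v j)) \<le> (\<Sum>j\<in>Basis. \<eta> * norm (v j))"
      using e by (auto intro!: order_trans[OF norm_sum] sum_mono mult_right_mono)
    also have "\<dots> = \<eta> * V" by (simp add: V_def sum_distrib_left)
    finally show "\<exists>n::'a \<Rightarrow> int. norm (z - (\<Sum>j\<in>Basis. of_int (n j) *\<^sub>R v j)) < \<rho>"
      using \<eta>(3) by (intro exI[of _ n]) linarith
  qed
qed

text \<open>The binomial theorem in each factor gives \<open>(n + 1) ^ DIM('a)\<close> nonnegative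
  coefficients. They sum to \<open>peak 0 ^ n = 1\<close>, so one of them is at least the
  average.\<close>

lemma peak_power_expansion:
  obtains G c g0 where "finite G" "G \<subseteq> \<Gamma>" "\<And>z. peak z ^ n = (\<Sum>g\<in>G. complex_of_real (c g) * cis (g \<bullet> z))"
    "g0 \<in> G" "1 / (real n + 1) ^ DIM('a) \<le> c g0"
proof -
  define P where "P = Pi\<^sub>E (Basis::'a set) (\<lambda>_. {..n})"
  define k where "k = (\<lambda>f. \<Sum>j\<in>Basis. real (f j) *\<^sub>R b j)"
  define c where "c = (\<lambda>f. \<Prod>j\<in>(Basis::'a set). real (n choose f j) / 2 ^ n)"
  have P: "finite P" unfolding P_def by (intro finite_PiE) auto
  have kv: "k f \<bullet> v j = 2 * pi * real (f j)" if "j \<in> Basis" for f j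
  proof -
    have "k f \<bullet> v j = (\<Sum>i\<in>Basis. if i = j then 2 * pi * real (f j) else 0)"
      unfolding k_def inner_sum_left by (intro sum.cong refl) (use dual that in auto)
    then show ?thesis using that by simp
  qed
  have inj: "inj_on k P"
  proof (rule inj_onI)
    fix f f' assume f: "f \<in> P" "f' \<in> P" "k f = k f'"
    have "f j = f' j" if "j \<in> Basis" for j using kv[OF that, of f] kv[OF that, of f'] f(3) by simp
    then show "f = f'" using f unfolding P_def by (intro PiE_ext) auto
  qed
  have cis_k: "cis (k f \<bullet> z) = (\<Prod>j\<in>Basis. cis (b j \<bullet> z) ^ f j)" for f z
    unfolding k_def inner_sum_left inner_scaleR_left by (simp add: cis_sum Complex.DeMoivre)
  have exp: "peak z ^ n = (\<Sum>f\<in>P. complex_of_real (c f) * cis (k f \<bullet> z))" for z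
  proof -
    have 1: "((1 + w) / 2) ^ n = (\<Sum>i\<le>n. complex_of_real (real (n choose i) / 2 ^ n) * w ^ i)" for w :: complex
    proof -
      have "(w + 1) ^ n = (\<Sum>i\<le>n. of_nat (n choose i) * w ^ i)" using binomial_ring[of w 1 n] by simp
      then show ?thesis by (simp add: power_divide sum_divide_distrib add.commute)
    qed
    have "peak z ^ n = (\<Prod>j\<in>Basis. \<Sum>i\<le>n. complex_of_real (real (n choose i) / 2 ^ n) * cis (b j \<bullet> z) ^ i)"
      unfolding peak_def prod_power_distrib 1 ..
    also have "\<dots> = (\<Sum>f\<in>P. \<Prod>j\<in>Basis. complex_of_real (real (n choose f j) / 2 ^ n) * cis (b j \<bullet> z) ^ f j)"
      unfolding P_def by (rule prod_sum_PiE) auto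
    also have "\<dots> = (\<Sum>f\<in>P. complex_of_real (c f) * cis (k f \<bullet> z))"
      unfolding cis_k c_def of_real_prod prod.distrib ..
    finally show ?thesis .
  qed
  define N where "N = (real n + 1) ^ DIM('a)"
  have card: "real (card P) = N" by (simp add: P_def card_PiE N_def add.commute)
  have N: "0 < N" by (simp add: N_def)
  have sum1: "(\<Sum>f\<in>P. c f) = 1"
  proof -
    have "complex_of_real (\<Sum>f\<in>P. c f) = peak 0 ^ n" unfolding exp by simp
    also have "\<dots> = 1" by (simp add: peak_def)
    finally show ?thesis using of_real_eq_1_iff by blast
  qed
  have "\<exists>f0\<in>P. 1 / N \<le> c f0"
  proof (rule ccontr)
    assume "\<not> (\<exists>f0\<in>P. 1 / N \<le> c f0)"
    then have "(\<Sum>f\<in>P. c f) < (\<Sum>f\<in>P. 1 / N)"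
      using P card N by (intro sum_strict_mono) auto
    also have "\<dots> = 1" using card N by simp
    finally show False using sum1 by simp
  qed
  then obtain f0 where f0: "f0 \<in> P" "1 / N \<le> c f0" by blast
  let ?c = "\<lambda>g. c (inv_into P k g)"
  show thesis
  proof (rule that[of "k ` P" ?c "k f0"])
    show "finite (k ` P)" "k f0 \<in> k ` P" using P f0 by auto
    show "k ` P \<subseteq> \<Gamma>"
    proof -
      have "k f \<in> \<Gamma>" for f unfolding dual_lattice_def using kv by (auto intro!: exI[of _ "int (f _)"])
      then show ?thesis by auto
    qed
    show "peak z ^ n = (\<Sum>g\<in>k ` P. complex_of_real (?c g) * cis (g \<bullet> z))" for z
      unfolding exp by (subst sum.reindex[OF inj]) (auto intro!: sum.cong simp: inv_into_f_f[OF inj])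
    show "1 / (real n + 1) ^ DIM('a) \<le> ?c (k f0)" using f0 by (simp add: inv_into_f_f[OF inj] N_def)
  qed
qed

end

section \<open>Packets and the observability estimate\<close>

context dual_frame
begin

text \<open>It is read in two ways: for fixed \<open>\<xi>\<close> as an exponential sum in
  \<open>y\<close> with frequencies over \<open>\<xi> + G\<close>, and for fixed \<open>y\<close> as
  a symbol in \<open>\<xi>\<close> to which Plancherel applies.\<close>

definition packet :: "('a \<Rightarrow> real) \<Rightarrow> 'a set \<Rightarrow> ('a \<Rightarrow> complex) \<Rightarrow> 'a \<times> real \<Rightarrow> 'a \<Rightarrow> complex" where
  "packet c G h y \<xi> = (\<Sum>g\<in>G. complex_of_real (c g) * h (\<xi> + g) * cis (paraboloid (\<xi> + g) \<bullet> y))"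

lemma paraboloid_inner: "paraboloid m \<bullet> (x, t) = x \<bullet> m - t * (norm m)\<^sup>2"
  by (simp add: paraboloid_def inner_commute mult.commute)

lemma continuous_on_packet:
  assumes h: "continuous_on UNIV h"
  shows "continuous_on S (\<lambda>p. packet c G h (fst p) (snd p))"
proof -
  have "continuous_on S (\<lambda>p. h (snd p + g))" for S :: "(('a \<times> real) \<times> 'a) set" and g
    by (rule continuous_on_compose2[OF h]) (auto intro!: continuous_intros)
  then show ?thesis
    unfolding packet_def paraboloid_def by (intro continuous_intros)
qed

lemma regular_symbol_packet:
  assumes h: "regular_symbol h" and G: "finite G"
  shows "regular_symbol (packet c G h y)"
  unfolding regular_symbol_def
proof (intro conjI)
  obtain B where hi: "integrable lborel h" and hc: "continuous_on UNIV h" and B: "\<And>x. cmod (h x) \<le> B"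
    using h unfolding regular_symbol_def by blast
  have [measurable]: "h \<in> borel_measurable borel" using hc by (rule borel_measurable_continuous_onI)
  have i: "integrable lborel (\<lambda>\<xi>. h (\<xi> + g))" for g
    using integrable_affine[OF hi, of 1 g] by (simp add: add.commute)
  have c1: "continuous_on UNIV (\<lambda>m::'a. paraboloid m \<bullet> y)"
    unfolding paraboloid_def by (intro continuous_intros)
  have m1: "(\<lambda>\<xi>::'a. paraboloid (\<xi> + g) \<bullet> y) \<in> borel_measurable borel" for g
    unfolding paraboloid_def by (intro borel_measurable_continuous_onI continuous_intros)
  have "integrable lborel (\<lambda>\<xi>. complex_of_real (c g) * (cis (paraboloid (\<xi> + g) \<bullet> y) * h (\<xi> + g)))" for g
    by (intro integrable_mult_right integrable_cis_mult i m1)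
  then have "integrable lborel (\<lambda>\<xi>. complex_of_real (c g) * h (\<xi> + g) * cis (paraboloid (\<xi> + g) \<bullet> y))" for g
    by (simp add: mult_ac)
  then show "integrable lborel (packet c G h y)"
    unfolding packet_def by (intro Bochner_Integration.integrable_sum)
  have "continuous_on UNIV (\<lambda>\<xi>. packet c G h (fst (y, \<xi>)) (snd (y, \<xi>)))"
    by (rule continuous_on_compose2[OF continuous_on_packet[OF hc, of UNIV]]) (auto intro!: continuous_intros)
  then show "continuous_on UNIV (packet c G h y)" by simp
  have "cmod (packet c G h y \<xi>) \<le> (\<Sum>g\<in>G. \<bar>c g\<bar> * B)" for \<xi>
    unfolding packet_def by (intro order_trans[OF norm_sum] sum_mono) (simp add: norm_mult mult_left_mono B)
  then show "\<exists>B. \<forall>x. cmod (packet c G h y x) \<le> B" by blast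
qed

text \<open>Shifting the frequency by \<open>g\<close> is multiplication by a character in space, so the packet is the
  Fourier transform of the evolution multiplied by a trigonometric weight.\<close>

lemma inv_ft_packet:
  assumes h: "regular_symbol h" and G: "finite G"
    and w: "\<And>z. w z = (\<Sum>g\<in>G. complex_of_real (c g) * cis (g \<bullet> z))"
  shows "inv_ft (packet c G h (x, t)) z = w (- z) * evol h t (x + z)"
proof -
  have hi: "integrable lborel h" using h by (simp add: regular_symbol_def)
  have [measurable]: "h \<in> borel_measurable borel" using borel_measurable_integrable[OF hi] by simp
  let ?e = "\<lambda>\<eta>. cis ((x + z) \<bullet> \<eta> - t * (norm \<eta>)\<^sup>2) * h \<eta>"
  have ei: "integrable lborel ?e" by (rule integrable_cis_mult[OF hi]) measurable
  have em[measurable]: "?e \<in> borel_measurable borel" using borel_measurable_integrable[OF ei] by simp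
  have t: "cis (z \<bullet> \<xi>) * (complex_of_real (c g) * h (\<xi> + g) * cis (paraboloid (\<xi> + g) \<bullet> (x, t))) =
     complex_of_real (c g) * cis (g \<bullet> (- z)) * ?e (g + \<xi>)" for \<xi> g
  proof -
    have "cis (z \<bullet> \<xi>) * cis (paraboloid (\<xi> + g) \<bullet> (x, t)) = cis (g \<bullet> (- z)) * cis ((x + z) \<bullet> (g + \<xi>) - t * (norm (g + \<xi>))\<^sup>2)"
      unfolding cis_mult paraboloid_inner
      by (rule arg_cong[of _ _ cis]) (simp add: inner_add_left inner_add_right inner_commute add.commute)
    then show ?thesis by (simp add: mult_ac add.commute)
  qed
  have ig: "integrable lborel (\<lambda>\<xi>. ?e (g + \<xi>))" for g
    using integrable_affine[OF ei, of 1 g] by simp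
  have "inv_ft (packet c G h (x, t)) z = (\<integral>\<xi>. (\<Sum>g\<in>G. complex_of_real (c g) * cis (g \<bullet> (- z)) * ?e (g + \<xi>)) \<partial>lborel)"
    unfolding inv_ft_def packet_def sum_distrib_left t ..
  also have "\<dots> = (\<Sum>g\<in>G. (\<integral>\<xi>. complex_of_real (c g) * cis (g \<bullet> (- z)) * ?e (g + \<xi>) \<partial>lborel))"
    by (rule Bochner_Integration.integral_sum) (intro integrable_mult_right ig)
  also have "\<dots> = (\<Sum>g\<in>G. complex_of_real (c g) * cis (g \<bullet> (- z)) * evol h t (x + z))"
    unfolding integral_mult_right_zero integral_translate[OF em] evol_eq ..
  also have "\<dots> = w (- z) * evol h t (x + z)" unfolding w sum_distrib_right ..
  finally show ?thesis .
qed

text \<open>One coefficient of the packet recovers \<open>h\<close> up to the factor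
  \<open>c g0\<close>. The packet's energy is that of the evolution weighted by a power of
  \<open>peak\<close>, which is tiny off \<open>S\<close>; this error is absorbed into the left-hand
  side.\<close>

lemma observability:
  assumes S: "open S" "x0 \<in> S" and per: "\<And>x n. x \<in> S \<Longrightarrow> x + (\<Sum>j\<in>Basis. of_int (n j :: int) *\<^sub>R v j) \<in> S" and T: "0 < T"
  obtains C where "0 < C" "\<And>h. regular_symbol h \<Longrightarrow> ennreal (\<integral>\<xi>. (cmod (h \<xi>))\<^sup>2 \<partial>lborel) \<le>
     ennreal C * (\<integral>\<^sup>+t\<in>{-T<..<0}. (\<integral>\<^sup>+z\<in>S. ennreal ((cmod (evol h t z))\<^sup>2) \<partial>lborel) \<partial>lborel)"
proof -
  obtain \<rho> where \<rho>: "0 < \<rho>" "ball x0 \<rho> \<subseteq> S" using S openE by blast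
  \<comment> \<open>The other half of \<open>\<rho>\<close> is reserved for the distance to the
    lattice; \<open>T / 4\<close> keeps the ball \<open>D\<close>, centred at time
    \<open>- (T / 2)\<close>, inside the time window.\<close>
  define r where "r = min (\<rho> / 2) (T / 4)"
  have r: "0 < r" "r \<le> \<rho> / 2" "r < T / 2" using \<rho> T by (auto simp: r_def)
  define D where "D = cball (x0, - (T / 2)) r"
  have D: "dist x x0 \<le> r \<and> - T < t \<and> t < 0" if "(x, t) \<in> D" for x t
  proof -
    have "dist (x, t) (x0, - (T / 2)) \<le> r" using that by (simp add: D_def dist_commute)
    then have "dist x x0 \<le> r" "dist t (- (T / 2)) \<le> r"
      using dist_fst_le[of "(x, t)" "(x0, - (T / 2))"] dist_snd_le[of "(x, t)" "(x0, - (T / 2))"] by auto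
    then show ?thesis using r by (auto simp: dist_real_def abs_le_iff)
  qed
  have [measurable]: "D \<in> sets borel" unfolding D_def by simp
  have [measurable]: "S \<in> sets borel" using S by simp
  have "0 < \<rho> / 2" using \<rho> by simp
  then obtain q where q: "0 \<le> q" "q < 1" "\<And>z. q < cmod (peak z) \<Longrightarrow> \<exists>n::'a \<Rightarrow> int. norm (z - (\<Sum>j\<in>Basis. of_int (n j) *\<^sub>R v j)) < \<rho> / 2"
    by (rule peak_localised) blast
  \<comment> \<open>If \<open>- z\<close> is near a lattice point \<open>l\<close>, then
    \<open>x + z + l\<close> is near \<open>x0\<close> and hence in \<open>S\<close>; translating
    back by \<open>l\<close> does not leave \<open>S\<close>.\<close>
  have peakS: "x + z \<in> S" if x: "dist x x0 \<le> r" and z: "q < cmod (peak (- z))" for x z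
  proof -
    obtain n :: "'a \<Rightarrow> int" where n: "norm (- z - (\<Sum>j\<in>Basis. of_int (n j) *\<^sub>R v j)) < \<rho> / 2" using q(3)[OF z] by blast
    let ?l = "\<Sum>j\<in>Basis. of_int (n j) *\<^sub>R v j"
    have "norm (z + ?l) < \<rho> / 2" using n norm_minus_cancel[of "z + ?l"] by simp
    then have "dist (x + z + ?l) x0 < \<rho>"
      using x r(2) norm_triangle_ineq[of "x - x0" "z + ?l"] by (simp add: dist_norm algebra_simps)
    then have "x + z + ?l \<in> S" using \<rho>(2) by (auto simp: dist_commute)
    from per[OF this, of "\<lambda>j. - n j"] show ?thesis by (simp add: sum_negf)
  qed
  obtain C0 where C0: "0 \<le> C0" "\<And>F m0 a y0. finite F \<Longrightarrow> (\<And>m m'. m \<in> F \<Longrightarrow> m' \<in> F \<Longrightarrow> m - m' \<in> \<Gamma>) \<Longrightarrow> m0 \<in> F \<Longrightarrow>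
     ennreal ((cmod (a m0))\<^sup>2) \<le> ennreal C0 *
       (\<integral>\<^sup>+y\<in>cball y0 r. ennreal ((cmod (\<Sum>m\<in>F. a m * cis (paraboloid m \<bullet> y)))\<^sup>2) \<partial>lborel)"
    by (rule coefficient_bound_L2[OF r(1)]) blast
  define \<mu>1 where "\<mu>1 = measure lborel (cball x0 r)"
  define \<mu> where "\<mu> = measure lborel D"
  have e1: "emeasure lborel (cball x0 r) = ennreal \<mu>1"
    unfolding \<mu>1_def by (rule emeasure_eq_ennreal_measure) (use emeasure_compact_finite[of "cball x0 r"] in auto)
  have e2: "emeasure lborel D = ennreal \<mu>"
    unfolding \<mu>_def D_def by (rule emeasure_eq_ennreal_measure) (use emeasure_compact_finite[of "cball (x0, - (T / 2)) r"] in auto)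
  define d where "d = DIM('a)"
  \<comment> \<open>The part of the error that does not depend on \<open>n\<close>: the coefficient
    constant, the volume of \<open>D\<close> and the Plancherel factor.\<close>
  define K where "K = C0 * \<mu> * (2 * pi) ^ d"
  have K: "0 \<le> K" using C0 by (simp add: K_def \<mu>_def)
  have dpos: "0 < d" by (simp add: d_def)
  obtain n where n: "K * q ^ (2 * n) * (real n + 1) ^ (2 * d) \<le> 1/2"
    using polynomial_times_geometric_small[OF q(1,2) dpos K] by blast
  define N where "N = (real n + 1) ^ (2 * d)"
  have N: "0 < N" by (simp add: N_def)
  obtain G c g0 where G: "finite G" "G \<subseteq> \<Gamma>" "\<And>z. peak z ^ n = (\<Sum>g\<in>G. complex_of_real (c g) * cis (g \<bullet> z))"
    "g0 \<in> G" "1 / (real n + 1) ^ DIM('a) \<le> c g0"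
    by (rule peak_power_expansion[of n]) (rule that)
  \<comment> \<open>The factor 2 comes from absorbing half of \<open>H\<close>; the summand 1 only
    secures positivity.\<close>
  define C where "C = 2 * N * C0 * \<mu>1 + 1"
  show thesis
  proof (rule that[of C])
    show "0 < C" using N C0 by (simp add: C_def \<mu>1_def add_nonneg_pos)
    fix h :: "'a \<Rightarrow> complex" assume h: "regular_symbol h"
    have hi: "integrable lborel h" and hc: "continuous_on UNIV h" using h by (auto simp: regular_symbol_def)
    have [measurable]: "h \<in> borel_measurable borel" using hc by (rule borel_measurable_continuous_onI)
    note [measurable] = hi
    define H where "H = (\<integral>\<xi>. (cmod (h \<xi>))\<^sup>2 \<partial>lborel)"
    have H0: "0 \<le> H" by (simp add: H_def)
    define Ob where "Ob = (\<lambda>t. \<integral>\<^sup>+z\<in>S. ennreal ((cmod (evol h t z))\<^sup>2) \<partial>lborel)"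
    have Obm[measurable]: "Ob \<in> borel_measurable borel" unfolding Ob_def by measurable
    define Obs where "Obs = (\<integral>\<^sup>+t\<in>{-T<..<0}. Ob t \<partial>lborel)"
    \<comment> \<open>The coefficient bound is applied at \<open>m0 = \<xi> + g0\<close>, where the
      coefficient is \<open>c g0 * h (g0 + \<xi>)\<close> and \<open>(c g0)\<^sup>2\<close> is at
      least \<open>1 / N\<close>.\<close>
    have step1: "ennreal (1 / N * (cmod (h (g0 + \<xi>)))\<^sup>2) \<le>
        ennreal C0 * (\<integral>\<^sup>+y\<in>D. ennreal ((cmod (packet c G h y \<xi>))\<^sup>2) \<partial>lborel)" for \<xi>
    proof -
      let ?F = "(\<lambda>g. \<xi> + g) ` G" and ?a = "\<lambda>m. complex_of_real (c (m - \<xi>)) * h m"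
      have eq: "(\<Sum>m\<in>?F. ?a m * cis (paraboloid m \<bullet> y)) = packet c G h y \<xi>" for y
        unfolding packet_def by (subst sum.reindex) (auto simp: inj_on_def)
      have main: "ennreal ((cmod (?a (\<xi> + g0)))\<^sup>2) \<le> ennreal C0 *
         (\<integral>\<^sup>+y\<in>D. ennreal ((cmod (\<Sum>m\<in>?F. ?a m * cis (paraboloid m \<bullet> y)))\<^sup>2) \<partial>lborel)"
        unfolding D_def
      proof (rule C0(2))
        fix m m' assume "m \<in> ?F" "m' \<in> ?F"
        then obtain g g' where g: "g \<in> G" "g' \<in> G" "m = \<xi> + g" "m' = \<xi> + g'" by auto
        have "g - g' \<in> \<Gamma>" using G(2) g by (intro dual_lattice_diff) auto
        then show "m - m' \<in> \<Gamma>" using g by simp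
      qed (use G in auto)
      have "1 / N * (cmod (h (g0 + \<xi>)))\<^sup>2 \<le> (cmod (?a (\<xi> + g0)))\<^sup>2"
      proof -
        have "(1 / (real n + 1) ^ d)\<^sup>2 \<le> (c g0)\<^sup>2" using G(5) unfolding d_def by (intro power_mono) auto
        moreover have "(1 / (real n + 1) ^ d)\<^sup>2 = 1 / N"
          by (simp add: N_def power_one_over power_mult[symmetric] mult.commute)
        ultimately have "1 / N * (cmod (h (g0 + \<xi>)))\<^sup>2 \<le> (c g0)\<^sup>2 * (cmod (h (g0 + \<xi>)))\<^sup>2"
          by (intro mult_right_mono) auto
        then show ?thesis by (simp add: norm_mult power_mult_distrib add.commute)
      qed
      from order_trans[OF ennreal_leI[OF this] main] show ?thesis by (simp only: eq)
    qed
    have step2: "(\<integral>\<^sup>+\<xi>. ennreal ((cmod (packet c G h (x, t) \<xi>))\<^sup>2) \<partial>lborel) \<le> Ob t + ennreal (q ^ (2 * n) * ((2 * pi) ^ d * H))"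
      if x: "dist x x0 \<le> r" for x t
    proof -
      have np: "regular_symbol (packet c G h (x, t))" by (rule regular_symbol_packet[OF h G(1)])
      have "(\<integral>\<^sup>+\<xi>. ennreal ((cmod (packet c G h (x, t) \<xi>))\<^sup>2) \<partial>lborel) = ennreal (\<integral>\<xi>. (cmod (packet c G h (x, t) \<xi>))\<^sup>2 \<partial>lborel)"
        by (rule nn_integral_eq_integral[OF plancherel_regular_symbol(1)[OF np]]) simp
      \<comment> \<open>The inserted factor is at least 1, so it may be added to reach the form of
        Plancherel's identity.\<close>
      also have "\<dots> \<le> ennreal ((2 * pi) ^ DIM('a) * (\<integral>\<xi>. (cmod (packet c G h (x, t) \<xi>))\<^sup>2 \<partial>lborel))"
      proof (rule ennreal_leI)
        have "1 \<le> (2 * pi) ^ DIM('a)" using pi_gt3 by (intro one_le_power) auto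
        then have "1 * (\<integral>\<xi>. (cmod (packet c G h (x, t) \<xi>))\<^sup>2 \<partial>lborel) \<le> (2 * pi) ^ DIM('a) * (\<integral>\<xi>. (cmod (packet c G h (x, t) \<xi>))\<^sup>2 \<partial>lborel)"
          by (rule mult_right_mono) simp
        then show "(\<integral>\<xi>. (cmod (packet c G h (x, t) \<xi>))\<^sup>2 \<partial>lborel) \<le> (2 * pi) ^ DIM('a) * (\<integral>\<xi>. (cmod (packet c G h (x, t) \<xi>))\<^sup>2 \<partial>lborel)" by simp
      qed
      also have "\<dots> = (\<integral>\<^sup>+z. ennreal ((cmod (inv_ft (packet c G h (x, t)) z))\<^sup>2) \<partial>lborel)"
        by (rule plancherel_regular_symbol(2)[OF np, symmetric])
      also have "\<dots> = (\<integral>\<^sup>+z. ennreal ((cmod (peak (- z) ^ n * evol h t (x + z)))\<^sup>2) \<partial>lborel)"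
        by (simp only: inv_ft_packet[OF h G(1,3)])
      also have "\<dots> \<le> (\<integral>\<^sup>+z. ennreal ((cmod (evol h t (x + z)))\<^sup>2) * indicator S (x + z) + ennreal (q ^ (2 * n)) * ennreal ((cmod (evol h t (x + z)))\<^sup>2) \<partial>lborel)"
      proof (rule nn_integral_mono)
        fix z
        let ?E = "(cmod (evol h t (x + z)))\<^sup>2"
        have e: "(cmod (peak (- z) ^ n * evol h t (x + z)))\<^sup>2 = cmod (peak (- z)) ^ (2 * n) * ?E"
          by (simp add: norm_mult norm_power power_mult_distrib power_mult[symmetric] mult.commute)
        show "ennreal ((cmod (peak (- z) ^ n * evol h t (x + z)))\<^sup>2) \<le> ennreal ?E * indicator S (x + z) + ennreal (q ^ (2 * n)) * ennreal ?E"
        proof (cases "x + z \<in> S")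
          case True
          have "cmod (peak (- z)) ^ (2 * n) * ?E \<le> 1 * ?E"
            by (intro mult_right_mono power_le_one peak_le_1) auto
          then have "ennreal ((cmod (peak (- z) ^ n * evol h t (x + z)))\<^sup>2) \<le> ennreal ?E" unfolding e by (intro ennreal_leI) simp
          also have "\<dots> \<le> ennreal ?E * indicator S (x + z) + ennreal (q ^ (2 * n)) * ennreal ?E" using True by simp
          finally show ?thesis .
        next
          case False
          \<comment> \<open>By the contrapositive of \<open>peakS\<close>, leaving \<open>S\<close>
            forces a small weight.\<close>
          then have "cmod (peak (- z)) \<le> q" using peakS[OF x, of z] by force
          then have "cmod (peak (- z)) ^ (2 * n) * ?E \<le> q ^ (2 * n) * ?E"
            by (intro mult_right_mono power_mono) auto
          then show ?thesis unfolding e using q(1) by (simp add: False ennreal_mult[symmetric] ennreal_leI)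
        qed
      qed
      also have "\<dots> = (\<integral>\<^sup>+z. ennreal ((cmod (evol h t (x + z)))\<^sup>2) * indicator S (x + z) \<partial>lborel) + ennreal (q ^ (2 * n)) * (\<integral>\<^sup>+z. ennreal ((cmod (evol h t (x + z)))\<^sup>2) \<partial>lborel)"
        by (subst nn_integral_add) (auto simp: nn_integral_cmult)
      also have "(\<integral>\<^sup>+z. ennreal ((cmod (evol h t (x + z)))\<^sup>2) * indicator S (x + z) \<partial>lborel) = Ob t"
        unfolding Ob_def by (rule nn_integral_translate) measurable
      also have "(\<integral>\<^sup>+z. ennreal ((cmod (evol h t (x + z)))\<^sup>2) \<partial>lborel) = (\<integral>\<^sup>+z. ennreal ((cmod (evol h t z))\<^sup>2) \<partial>lborel)"
        by (rule nn_integral_translate) measurable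
      also have "\<dots> = ennreal ((2 * pi) ^ d * H)" unfolding plancherel_evol[OF h] H_def d_def ..
      finally show ?thesis using q(1) H0 by (simp add: ennreal_mult[symmetric])
    qed
    define E where "E = q ^ (2 * n) * ((2 * pi) ^ d * H)"
    have wm[measurable]: "(\<lambda>y::'a \<times> real. indicator (cball x0 r) (fst y) * (Ob (snd y) * indicator {-T<..<0} (snd y))) \<in> borel_measurable borel"
    proof (rule borel_measurable_times_ennreal)
      have "(fst :: 'a \<times> real \<Rightarrow> 'a) \<in> borel_measurable borel" "(snd :: 'a \<times> real \<Rightarrow> real) \<in> borel_measurable borel"
        by (intro borel_measurable_continuous_onI continuous_intros)+
      note fs = this
      show "(\<lambda>y::'a \<times> real. indicator (cball x0 r) (fst y) :: ennreal) \<in> borel_measurable borel"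
        by (rule measurable_compose[OF fs(1)]) (rule borel_measurable_indicator, simp)
      show "(\<lambda>y::'a \<times> real. Ob (snd y) * indicator {-T<..<0} (snd y)) \<in> borel_measurable borel"
        by (rule measurable_compose[OF fs(2), of "\<lambda>t. Ob t * indicator {-T<..<0} t"]) measurable
    qed
    have wm2: "(\<lambda>y::'a \<times> real. indicator (cball x0 r) (fst y) * (Ob (snd y) * indicator {-T<..<0} (snd y))) \<in> borel_measurable (lborel \<Otimes>\<^sub>M lborel)"
      using wm by (simp add: lborel_prod)
    have E0: "0 \<le> E" using q(1) H0 by (simp add: E_def)
    have pm: "(\<lambda>(\<xi>, y). ennreal ((cmod (packet c G h y \<xi>))\<^sup>2) * indicator D y) \<in> borel_measurable (lborel \<Otimes>\<^sub>M lborel)"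
    proof -
      have "(\<lambda>p. packet c G h (fst p) (snd p)) \<in> borel_measurable borel"
        by (rule borel_measurable_continuous_onI[OF continuous_on_packet[OF hc]])
      then have [measurable]: "(\<lambda>p. packet c G h (fst p) (snd p)) \<in> borel_measurable (borel \<Otimes>\<^sub>M borel)" by (simp add: borel_prod)
      have [measurable]: "(\<lambda>p::'a \<times> 'a \<times> real. packet c G h (snd p) (fst p)) \<in> borel_measurable (lborel \<Otimes>\<^sub>M lborel)"
        using measurable_compose[of "\<lambda>p. (snd p, fst p)" "lborel \<Otimes>\<^sub>M lborel" "borel \<Otimes>\<^sub>M borel" "\<lambda>p. packet c G h (fst p) (snd p)"] by simp
      show ?thesis unfolding case_prod_unfold by measurable
    qed
    have "ennreal (1 / N * H) = (\<integral>\<^sup>+\<xi>. ennreal (1 / N * (cmod (h (g0 + \<xi>)))\<^sup>2) \<partial>lborel)"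
    proof -
      have "(\<integral>\<^sup>+\<xi>. ennreal (1 / N * (cmod (h (g0 + \<xi>)))\<^sup>2) \<partial>lborel) = (\<integral>\<^sup>+\<xi>. ennreal (1 / N * (cmod (h \<xi>))\<^sup>2) \<partial>lborel)"
        by (rule nn_integral_translate) measurable
      also have "\<dots> = ennreal (\<integral>\<xi>. 1 / N * (cmod (h \<xi>))\<^sup>2 \<partial>lborel)"
        by (rule nn_integral_eq_integral) (use plancherel_regular_symbol(1)[OF h] N in auto)
      also have "(\<integral>\<xi>. 1 / N * (cmod (h \<xi>))\<^sup>2 \<partial>lborel) = 1 / N * H" unfolding H_def by (rule integral_mult_right_zero)
      finally show ?thesis by simp
    qed
    also have "\<dots> \<le> (\<integral>\<^sup>+\<xi>. ennreal C0 * (\<integral>\<^sup>+y\<in>D. ennreal ((cmod (packet c G h y \<xi>))\<^sup>2) \<partial>lborel) \<partial>lborel)"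
      by (intro nn_integral_mono step1)
    also have "\<dots> = ennreal C0 * (\<integral>\<^sup>+\<xi>. (\<integral>\<^sup>+y\<in>D. ennreal ((cmod (packet c G h y \<xi>))\<^sup>2) \<partial>lborel) \<partial>lborel)"
      by (rule nn_integral_cmult) (use pm in measurable)
    \<comment> \<open>The exchange of integrals switches between the two readings of the packet,
      from sums in \<open>y\<close> to symbols in \<open>\<xi>\<close>.\<close>
    also have "(\<integral>\<^sup>+\<xi>. (\<integral>\<^sup>+y\<in>D. ennreal ((cmod (packet c G h y \<xi>))\<^sup>2) \<partial>lborel) \<partial>lborel) =
       (\<integral>\<^sup>+y. (\<integral>\<^sup>+\<xi>. ennreal ((cmod (packet c G h y \<xi>))\<^sup>2) * indicator D y \<partial>lborel) \<partial>lborel)"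
      by (rule lborel_pair.Fubini'[OF pm, symmetric])
    also have "\<dots> \<le> (\<integral>\<^sup>+y. (indicator (cball x0 r) (fst y) * (Ob (snd y) * indicator {-T<..<0} (snd y)) + ennreal E * indicator D y) \<partial>lborel)"
    proof (rule nn_integral_mono)
      fix y :: "'a \<times> real"
      obtain x t where y: "y = (x, t)" by (cases y)
      show "(\<integral>\<^sup>+\<xi>. ennreal ((cmod (packet c G h y \<xi>))\<^sup>2) * indicator D y \<partial>lborel) \<le>
        indicator (cball x0 r) (fst y) * (Ob (snd y) * indicator {-T<..<0} (snd y)) + ennreal E * indicator D y"
      proof (cases "y \<in> D")
        case True
        then have "dist x x0 \<le> r" "- T < t" "t < 0" using D[of x t] y by auto
        then show ?thesis using step2[of x t] True by (simp add: y E_def dist_commute)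
      qed auto
    qed
    also have "\<dots> = (\<integral>\<^sup>+y. indicator (cball x0 r) (fst y) * (Ob (snd y) * indicator {-T<..<0} (snd y)) \<partial>lborel) + ennreal E * ennreal \<mu>"
      by (subst nn_integral_add) (auto simp: nn_integral_cmult_indicator e2)
    also have "(\<integral>\<^sup>+y. indicator (cball x0 r) (fst y) * (Ob (snd y) * indicator {-T<..<0} (snd y)) \<partial>lborel) =
        (\<integral>\<^sup>+x. (\<integral>\<^sup>+t. indicator (cball x0 r) x * (Ob t * indicator {-T<..<0} t) \<partial>lborel) \<partial>lborel)"
      unfolding lborel_prod[symmetric] lborel.nn_integral_fst[OF wm2, symmetric] by simp
    also have "\<dots> = (\<integral>\<^sup>+x. Obs * indicator (cball x0 r) x \<partial>lborel)"
      unfolding Obs_def by (intro nn_integral_cong) (simp add: nn_integral_cmult mult.commute)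
    also have "\<dots> = Obs * ennreal \<mu>1" by (subst nn_integral_cmult_indicator) (auto simp: e1)
    finally have main: "ennreal (1 / N * H) \<le> ennreal C0 * (Obs * ennreal \<mu>1 + ennreal E * ennreal \<mu>)"
      by (simp add: mult_left_mono)
    have "ennreal H \<le> ennreal C * Obs"
    proof (cases "Obs = \<infinity>")
      case True
      then show ?thesis using \<open>0 < C\<close> by (simp add: ennreal_mult_top)
    next
      case False
      then obtain o' where o': "0 \<le> o'" "Obs = ennreal o'" by (cases Obs) auto
      have \<mu>: "0 \<le> \<mu>" "0 \<le> \<mu>1" by (auto simp: \<mu>_def \<mu>1_def)
      have "ennreal (1 / N * H) \<le> ennreal (C0 * (o' * \<mu>1 + E * \<mu>))"
        using main o' \<mu> C0 E0 by (simp add: ennreal_mult[symmetric] ennreal_plus[symmetric] del: ennreal_plus)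
      then have "1 / N * H \<le> C0 * (o' * \<mu>1 + E * \<mu>)"
        by (subst (asm) ennreal_le_iff) (use \<mu> C0 E0 o' in auto)
      then have "H \<le> N * (C0 * (o' * \<mu>1 + E * \<mu>))" using N by (simp add: field_simps)
      also have "\<dots> = N * C0 * \<mu>1 * o' + (K * q ^ (2 * n) * N) * H"
        by (simp add: E_def K_def algebra_simps)
      \<comment> \<open>The choice of \<open>n\<close> makes the error at most half of
        \<open>H\<close>. Since \<open>H\<close> is a finite real number, it can be subtracted from
        both sides.\<close>
      also have "\<dots> \<le> N * C0 * \<mu>1 * o' + 1 / 2 * H"
        using n H0 unfolding N_def by (intro add_left_mono mult_right_mono) auto
      finally have "H \<le> (2 * N * C0 * \<mu>1) * o'" by simp
      also have "\<dots> \<le> C * o'" unfolding C_def using o' by (intro mult_right_mono) auto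
      finally show ?thesis using o' \<open>0 < C\<close> by (simp add: ennreal_mult[symmetric] ennreal_leI)
    qed
    then show "ennreal (\<integral>\<xi>. (cmod (h \<xi>))\<^sup>2 \<partial>lborel) \<le>
     ennreal C * (\<integral>\<^sup>+t\<in>{-T<..<0}. (\<integral>\<^sup>+z\<in>S. ennreal ((cmod (evol h t z))\<^sup>2) \<partial>lborel) \<partial>lborel)"
      unfolding H_def Obs_def Ob_def .
  qed
qed

end

section \<open>From a periodic set to a frame of lattice vectors\<close>

text \<open>A vector orthogonal to the lattice would have bounded inner products with all of space,
  because modulo the lattice every point lies in a compact set. The point \<open>z\<close> exceeds
  that bound.\<close>

lemma lattice_span_UNIV:
  fixes L :: "'a::euclidean_space set"
  assumes "is_lattice L"
  shows "span L = UNIV"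
proof (rule ccontr)
  assume "span L \<noteq> UNIV"
  then obtain a where a: "a \<noteq> 0" "\<forall>x\<in>span L. a \<bullet> x = 0" using span_not_UNIV_orthogonal by blast
  obtain K where K: "compact K" "\<forall>z. \<exists>k\<in>K. \<exists>l\<in>L. z = k + l" using assms by (auto simp: is_lattice_def)
  obtain B where B: "\<And>k. k \<in> K \<Longrightarrow> norm k \<le> B" using compact_imp_bounded[OF K(1)] by (auto simp: bounded_iff)
  define z where "z = ((B + 1) / norm a) *\<^sub>R a"
  obtain k l where kl: "k \<in> K" "l \<in> L" "z = k + l" using K(2) by blast
  have "a \<bullet> z = a \<bullet> k" using a(2) kl span_base[OF kl(2)] by (simp add: inner_add_right)
  also have "\<dots> \<le> norm a * norm k" by (rule norm_cauchy_schwarz)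
  also have "\<dots> \<le> norm a * B" using B[OF kl(1)] by (simp add: mult_left_mono)
  finally have "(B + 1) * norm a \<le> norm a * B"
    using a(1) by (simp add: z_def power2_norm_eq_inner[symmetric] power2_eq_square)
  then show False using a(1) by (simp add: algebra_simps)
qed

lemma lattice_integer_combination:
  fixes v :: "'a::euclidean_space \<Rightarrow> 'a"
  assumes L: "is_lattice L" and v: "\<And>j. j \<in> J \<Longrightarrow> v j \<in> L" and J: "finite J"
  shows "(\<Sum>j\<in>J. of_int (n j :: int) *\<^sub>R v j) \<in> L"
proof -
  have 0: "0 \<in> L" and diff: "\<And>x y. x \<in> L \<Longrightarrow> y \<in> L \<Longrightarrow> x - y \<in> L" using L by (auto simp: is_lattice_def)
  have add: "x + y \<in> L" if "x \<in> L" "y \<in> L" for x y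
    using diff[OF that(1) diff[OF 0 that(2)]] by simp
  have int: "of_int n *\<^sub>R x \<in> L" if "x \<in> L" for x and n :: int
  proof (induction n rule: int_induct[where k = 0])
    case base
    then show ?case using 0 by simp
  next
    case (step1 i)
    then show ?case using add[OF step1(2) that] by (simp add: scaleR_add_left)
  next
    case (step2 i)
    then show ?case using diff[OF step2(2) that] by (simp add: scaleR_diff_left)
  qed
  show ?thesis using J v by (induction J rule: finite_induct) (auto intro: 0 add int)
qed

text \<open>A maximal independent subset of the lattice may generate only a proper sublattice, but
  \<open>S\<close> is invariant under it all the same.\<close>

lemma periodic_set_frame:
  fixes S :: "'a::euclidean_space set"
  assumes "periodic_set S"
  obtains v b where "dual_frame v b"
    "\<And>x n. x \<in> S \<Longrightarrow> x + (\<Sum>j\<in>Basis. of_int (n j :: int) *\<^sub>R v j) \<in> S"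
proof -
  obtain L where L: "is_lattice L" "\<And>w. w \<in> L \<Longrightarrow> (\<lambda>x. w + x) ` S = S"
    using assms by (auto simp: periodic_set_def)
  obtain B where B: "B \<subseteq> L" "independent B" "L \<subseteq> span B" using maximal_independent_subset by blast
  have spB: "span B = UNIV"
    using lattice_span_UNIV[OF L(1)] span_mono[OF B(3)] by (auto simp: span_span)
  have "card B = DIM('a)" using basis_card_eq_dim[of B UNIV] B(2) spB by simp
  then obtain f where f: "bij_betw f (Basis :: 'a set) B"
    using finite_same_card_bij[of Basis B] independent_imp_finite[OF B(2)] by auto
  obtain g where g: "linear g" "\<forall>x\<in>Basis. g x = f x"
    using linear_independent_extend[OF independent_Basis, of f] by blast
  have "g ` Basis = B" using g(2) f by (auto simp: bij_betw_def image_def)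
  then have "surj g" using linear_span_image[OF g(1), of Basis] spB by simp
  then obtain f' where f': "linear f'" "\<And>x. f' (g x) = x" "\<And>x. g (f' x) = x"
    using linear_surjective_isomorphism[OF g(1)] by blast
  \<comment> \<open>\<open>f'\<close> computes coordinates with respect to the chosen lattice
    vectors; its adjoint turns these coordinates into inner products.\<close>
  define b where "b = (\<lambda>j. (2 * pi) *\<^sub>R adjoint f' j)"
  have bz: "b j \<bullet> z = 2 * pi * (f' z \<bullet> j)" for j z
    unfolding b_def using adjoint_works[OF f'(1), of z j] by (simp add: inner_commute)
  show thesis
  proof (rule that[of f b])
    show "dual_frame f b"
    proof
      fix i j :: 'a assume ij: "i \<in> Basis" "j \<in> Basis"
      have "f' (f j) = j" using g(2) f'(2)[of j] ij by simp
      then show "b i \<bullet> f j = (if i = j then 2 * pi else 0)" using ij by (simp add: bz inner_Basis)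
    next
      fix z :: 'a
      have "z = g (\<Sum>j\<in>Basis. (f' z \<bullet> j) *\<^sub>R j)" by (simp add: euclidean_representation f')
      also have "\<dots> = (\<Sum>j\<in>Basis. (f' z \<bullet> j) *\<^sub>R g j)" by (simp add: linear_sum[OF g(1)] linear_cmul[OF g(1)])
      also have "\<dots> = (\<Sum>j\<in>Basis. (b j \<bullet> z / (2 * pi)) *\<^sub>R f j)" using g(2) by (intro sum.cong) (auto simp: bz)
      finally show "z = (\<Sum>j\<in>Basis. (b j \<bullet> z / (2 * pi)) *\<^sub>R f j)" .
    qed
    fix x and n :: "'a \<Rightarrow> int" assume x: "x \<in> S"
    have "(\<Sum>j\<in>Basis. of_int (n j) *\<^sub>R f j) \<in> L"
      by (rule lattice_integer_combination[OF L(1)]) (use f B(1) in \<open>auto simp: bij_betw_def\<close>)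
    from L(2)[OF this] have "(\<Sum>j\<in>Basis. of_int (n j) *\<^sub>R f j) + x \<in> S" using x by (auto intro: imageI elim!: equalityE)
    then show "x + (\<Sum>j\<in>Basis. of_int (n j) *\<^sub>R f j) \<in> S" by (subst add.commute)
  qed
qed

section \<open>Square-integrable functions and duality\<close>

text \<open>Stated for an arbitrary measure so that states over space and controls over space-time
  share the same lemmas; \<open>sq_norm\<close> is the square of the norm.\<close>

definition sq_int :: "'x measure \<Rightarrow> ('x \<Rightarrow> complex) \<Rightarrow> bool" where
  "sq_int M f \<longleftrightarrow> f \<in> borel_measurable M \<and> integrable M (\<lambda>x. (cmod (f x))\<^sup>2)"

definition sq_norm :: "'x measure \<Rightarrow> ('x \<Rightarrow> complex) \<Rightarrow> real" where
  "sq_norm M f = (\<integral>x. (cmod (f x))\<^sup>2 \<partial>M)"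

lemma sq_norm_nonneg: "0 \<le> sq_norm M f"
  by (simp add: sq_norm_def)

lemma sq_int_measurable: "sq_int M f \<Longrightarrow> f \<in> borel_measurable M"
  by (simp add: sq_int_def)

lemma sq_intI_nn:
  assumes [measurable]: "f \<in> borel_measurable M" and "(\<integral>\<^sup>+x. ennreal ((cmod (f x))\<^sup>2) \<partial>M) \<le> ennreal c" "0 \<le> c"
  shows "sq_int M f" "sq_norm M f \<le> c"
proof -
  have i: "integrable M (\<lambda>x. (cmod (f x))\<^sup>2)"
  proof (rule integrableI_nonneg)
    show "(\<integral>\<^sup>+x. ennreal ((cmod (f x))\<^sup>2) \<partial>M) < \<infinity>" using assms(2) by (rule le_less_trans) simp
  qed auto
  then show "sq_int M f" by (simp add: sq_int_def)
  have "ennreal (sq_norm M f) \<le> ennreal c"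
    unfolding sq_norm_def using nn_integral_eq_integral[OF i] assms(2) by simp
  then show "sq_norm M f \<le> c" using assms(3) by (simp add: ennreal_le_iff)
qed

lemma sq_norm_nn: "sq_int M f \<Longrightarrow> (\<integral>\<^sup>+x. ennreal ((cmod (f x))\<^sup>2) \<partial>M) = ennreal (sq_norm M f)"
  unfolding sq_int_def sq_norm_def by (intro nn_integral_eq_integral) auto

lemma cmod_add_sq_le: "(cmod (a + b))\<^sup>2 \<le> 2 * (cmod a)\<^sup>2 + 2 * (cmod b)\<^sup>2"
proof -
  have "(cmod (a + b))\<^sup>2 \<le> (cmod a + cmod b)\<^sup>2" by (intro power_mono norm_triangle_ineq) auto
  also have "\<dots> \<le> 2 * (cmod a)\<^sup>2 + 2 * (cmod b)\<^sup>2"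
    using zero_le_power2[of "cmod a - cmod b"] by (simp add: power2_eq_square algebra_simps)
  finally show ?thesis .
qed

lemma sq_int_add:
  assumes f: "sq_int M f" and g: "sq_int M g"
  shows "sq_int M (\<lambda>x. f x + g x)"
  unfolding sq_int_def
proof
  have [measurable]: "f \<in> borel_measurable M" "g \<in> borel_measurable M" using assms by (auto simp: sq_int_def)
  show "(\<lambda>x. f x + g x) \<in> borel_measurable M" by measurable
  show "integrable M (\<lambda>x. (cmod (f x + g x))\<^sup>2)"
  proof (rule Bochner_Integration.integrable_bound)
    show "integrable M (\<lambda>x. 2 * (cmod (f x))\<^sup>2 + 2 * (cmod (g x))\<^sup>2)"
      using assms by (auto simp: sq_int_def)
    show "AE x in M. norm ((cmod (f x + g x))\<^sup>2) \<le> norm (2 * (cmod (f x))\<^sup>2 + 2 * (cmod (g x))\<^sup>2)"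
      using cmod_add_sq_le by auto
  qed measurable
qed

lemma sq_int_scale:
  assumes "sq_int M f" shows "sq_int M (\<lambda>x. c * f x)"
  using assms unfolding sq_int_def by (auto simp: norm_mult power_mult_distrib)

lemma sq_int_diff:
  assumes "sq_int M f" "sq_int M g" shows "sq_int M (\<lambda>x. f x - g x)"
  using sq_int_add[OF assms(1) sq_int_scale[OF assms(2), of "-1"]] by simp

lemma sq_int_cauchy_schwarz:
  assumes f: "sq_int M f" and g: "sq_int M g"
  shows "integrable M (\<lambda>x. f x * cnj (g x))"
    and "(cmod (\<integral>x. f x * cnj (g x) \<partial>M))\<^sup>2 \<le> sq_norm M f * sq_norm M g"
proof -
  have [measurable]: "f \<in> borel_measurable M" "g \<in> borel_measurable M" using assms by (auto simp: sq_int_def)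
  have [measurable]: "(\<lambda>x. cnj (g x)) \<in> borel_measurable M"
    by (rule measurable_compose[of g]) (auto intro!: borel_measurable_continuous_onI continuous_intros)
  have le: "(\<integral>\<^sup>+x. ennreal (cmod (f x * cnj (g x))) \<partial>M)\<^sup>2 \<le> ennreal (sq_norm M f * sq_norm M g)"
  proof -
    have "(\<integral>\<^sup>+x. ennreal (cmod (f x * cnj (g x))) \<partial>M)\<^sup>2 = (\<integral>\<^sup>+x. ennreal (cmod (f x)) * ennreal (cmod (g x)) \<partial>M)\<^sup>2"
      by (simp add: norm_mult ennreal_mult)
    also have "\<dots> \<le> (\<integral>\<^sup>+x. (ennreal (cmod (f x)))\<^sup>2 \<partial>M) * (\<integral>\<^sup>+x. (ennreal (cmod (g x)))\<^sup>2 \<partial>M)"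
      by (rule Cauchy_Schwarz_nn_integral) auto
    also have "\<dots> = ennreal (sq_norm M f * sq_norm M g)"
      using sq_norm_nn[OF f] sq_norm_nn[OF g] by (simp add: ennreal_power ennreal_mult sq_norm_nonneg)
    finally show ?thesis .
  qed
  show i: "integrable M (\<lambda>x. f x * cnj (g x))"
    unfolding integrable_iff_bounded
  proof
    have "(\<integral>\<^sup>+x. ennreal (cmod (f x * cnj (g x))) \<partial>M)\<^sup>2 < \<infinity>" using le by (rule le_less_trans) simp
    then show "(\<integral>\<^sup>+x. ennreal (norm (f x * cnj (g x))) \<partial>M) < \<infinity>" by (simp add: power_less_top_ennreal)
  qed measurable
  have "ennreal (cmod (\<integral>x. f x * cnj (g x) \<partial>M)) \<le> (\<integral>\<^sup>+x. ennreal (cmod (f x * cnj (g x))) \<partial>M)"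
    by (rule integral_norm_bound_ennreal[OF i])
  then have "(ennreal (cmod (\<integral>x. f x * cnj (g x) \<partial>M)))\<^sup>2 \<le> (\<integral>\<^sup>+x. ennreal (cmod (f x * cnj (g x))) \<partial>M)\<^sup>2"
    by (rule power_mono) simp
  also note le
  finally have "ennreal ((cmod (\<integral>x. f x * cnj (g x) \<partial>M))\<^sup>2) \<le> ennreal (sq_norm M f * sq_norm M g)" by (simp add: ennreal_power)
  then show "(cmod (\<integral>x. f x * cnj (g x) \<partial>M))\<^sup>2 \<le> sq_norm M f * sq_norm M g"
    by (subst (asm) ennreal_le_iff) (simp_all add: sq_norm_nonneg)
qed

text \<open>A subsequence with geometric increments converges almost everywhere, and Fatou's lemma
  upgrades this to convergence in mean square of the whole sequence.\<close>

lemma riesz_fischer: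
  fixes g :: "nat \<Rightarrow> 'x \<Rightarrow> complex"
  assumes g: "\<And>n. sq_int M (g n)"
    and cauchy: "\<And>\<epsilon>. 0 < \<epsilon> \<Longrightarrow> \<exists>N. \<forall>m\<ge>N. \<forall>n\<ge>N. sq_norm M (\<lambda>x. g m x - g n x) \<le> \<epsilon>"
  obtains f where "sq_int M f" "(\<lambda>n. sq_norm M (\<lambda>x. g n x - f x)) \<longlonglongrightarrow> 0"
proof -
  have gm[measurable]: "g n \<in> borel_measurable M" for n using g by (simp add: sq_int_def)
  have "\<exists>N. \<forall>k. \<forall>m\<ge>N k. \<forall>n\<ge>N k. sq_norm M (\<lambda>x. g m x - g n x) \<le> (1/4)^k"
    by (intro choice allI cauchy) simp
  then obtain N where N: "\<And>k m n. m \<ge> N k \<Longrightarrow> n \<ge> N k \<Longrightarrow> sq_norm M (\<lambda>x. g m x - g n x) \<le> (1/4)^k" by blast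
  \<comment> \<open>The sum makes \<open>r\<close> monotone and at least \<open>N k\<close>, and the
    summand \<open>k\<close> makes it tend to infinity.\<close>
  define r where "r = (\<lambda>k. k + (\<Sum>i\<le>k. N i))"
  have r: "N k \<le> r k" "r k \<le> r (Suc k)" "k \<le> r k" for k
    using member_le_sum[of k "{..k}" N] by (auto simp: r_def)
  define d where "d = (\<lambda>k x. g (r (Suc k)) x - g (r k) x)"
  have dm[measurable]: "d k \<in> borel_measurable M" for k unfolding d_def by measurable
  have dsq: "sq_int M (d k)" for k unfolding d_def by (intro sq_int_diff g)
  have dn: "sq_norm M (d k) \<le> (1/4)^k" for k
    unfolding d_def using r[of k] by (intro N) auto
  \<comment> \<open>The weight \<open>2 ^ k\<close> is still beaten by the decay
    \<open>(1/4)^k\<close>, and finiteness of \<open>s x\<close> yields increments of order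
    \<open>(1 / sqrt 2) ^ k\<close>, which are summable pointwise.\<close>
  define s where "s = (\<lambda>x. \<Sum>k. ennreal (2 ^ k * (cmod (d k x))\<^sup>2))"
  have "(\<integral>\<^sup>+x. s x \<partial>M) = (\<Sum>k. \<integral>\<^sup>+x. ennreal (2 ^ k * (cmod (d k x))\<^sup>2) \<partial>M)"
    unfolding s_def by (rule nn_integral_suminf) measurable
  also have "\<dots> \<le> (\<Sum>k. ennreal ((1/2)^k))"
  proof (rule suminf_le)
    fix k
    have "(\<integral>\<^sup>+x. ennreal (2 ^ k * (cmod (d k x))\<^sup>2) \<partial>M) = (\<integral>\<^sup>+x. ennreal (2 ^ k) * ennreal ((cmod (d k x))\<^sup>2) \<partial>M)"
      by (simp add: ennreal_mult)
    also have "\<dots> = ennreal (2 ^ k) * ennreal (sq_norm M (d k))"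
      by (subst nn_integral_cmult) (auto simp: sq_norm_nn[OF dsq])
    also have "\<dots> = ennreal (2 ^ k * sq_norm M (d k))" by (simp add: ennreal_mult sq_norm_nonneg)
    also have "\<dots> \<le> ennreal (2 ^ k * (1/4)^k)" by (intro ennreal_leI mult_left_mono dn) auto
    also have "(2::real) ^ k * (1/4)^k = (1/2)^k" by (simp add: power_mult_distrib[symmetric])
    finally show "(\<integral>\<^sup>+x. ennreal (2 ^ k * (cmod (d k x))\<^sup>2) \<partial>M) \<le> ennreal ((1/2)^k)" .
  qed auto
  also have "\<dots> = ennreal (\<Sum>k. (1/2)^k)" by (rule suminf_ennreal2) (auto simp: summable_geometric)
  also have "\<dots> < \<infinity>" by simp
  finally have "(\<integral>\<^sup>+x. s x \<partial>M) \<noteq> \<infinity>" by simp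
  moreover have "s \<in> borel_measurable M" unfolding s_def by measurable
  ultimately have sfin: "AE x in M. s x \<noteq> \<infinity>" by (intro nn_integral_PInf_AE) auto
  have conv: "convergent (\<lambda>k. g (r k) x)" if "s x \<noteq> \<infinity>" for x
  proof -
    obtain c where c: "0 \<le> c" "s x = ennreal c" using \<open>s x \<noteq> \<infinity>\<close> by (cases "s x") auto
    have le: "cmod (d k x) \<le> sqrt c * (1 / sqrt 2) ^ k" for k
    proof -
      have "ennreal (2 ^ k * (cmod (d k x))\<^sup>2) \<le> s x"
      proof -
        have "(\<Sum>k\<in>{k}. ennreal (2 ^ k * (cmod (d k x))\<^sup>2)) \<le> s x"
          unfolding s_def by (rule sum_le_suminf) auto
        then show ?thesis by simp
      qed
      then have "2 ^ k * (cmod (d k x))\<^sup>2 \<le> c" using c by (simp add: ennreal_le_iff)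
      then have "(cmod (d k x))\<^sup>2 \<le> c / 2 ^ k" by (simp add: field_simps)
      also have "\<dots> = (sqrt c * (1 / sqrt 2) ^ k)\<^sup>2"
      proof -
        have "((1 / sqrt 2) ^ k)\<^sup>2 = ((1 / sqrt 2)\<^sup>2) ^ k" by (simp only: power_mult[symmetric] mult.commute)
        also have "\<dots> = 1 / 2 ^ k" by (simp add: power_divide)
        finally show ?thesis using c(1) by (simp only: power_mult_distrib) simp
      qed
      finally show ?thesis by (rule power2_le_imp_le) (use c in auto)
    qed
    have "summable (\<lambda>k. sqrt c * (1 / sqrt 2) ^ k)" by (intro summable_mult summable_geometric) simp
    then have "summable (\<lambda>k. d k x)" by (rule summable_comparison_test') (use le in auto)
    then have "(\<lambda>n. g (r 0) x + (\<Sum>k<n. d k x)) \<longlonglongrightarrow> g (r 0) x + (\<Sum>k. d k x)"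
      by (intro tendsto_add tendsto_const summable_LIMSEQ)
    moreover have "g (r 0) x + (\<Sum>k<n. d k x) = g (r n) x" for n
      unfolding d_def using sum_lessThan_telescope[of "\<lambda>k. g (r k) x" n] by simp
    ultimately show ?thesis by (auto simp: convergent_def)
  qed
  define f where "f = (\<lambda>x. lim (\<lambda>k. g (r k) x))"
  have fm[measurable]: "f \<in> borel_measurable M" unfolding f_def by (rule borel_measurable_lim_metric) measurable
  have lim: "AE x in M. (\<lambda>k. g (r k) x) \<longlonglongrightarrow> f x"
    using sfin by eventually_elim (auto simp: f_def convergent_LIMSEQ_iff[symmetric] conv)
  have est: "(\<integral>\<^sup>+x. ennreal ((cmod (g n x - f x))\<^sup>2) \<partial>M) \<le> ennreal \<epsilon>"
    if K: "\<forall>m\<ge>K. \<forall>n\<ge>K. sq_norm M (\<lambda>x. g m x - g n x) \<le> \<epsilon>" and n: "n \<ge> K" for K n \<epsilon>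
  proof -
    have "(\<integral>\<^sup>+x. ennreal ((cmod (g n x - f x))\<^sup>2) \<partial>M) = (\<integral>\<^sup>+x. liminf (\<lambda>k. ennreal ((cmod (g n x - g (r k) x))\<^sup>2)) \<partial>M)"
    proof (rule nn_integral_cong_AE)
      show "AE x in M. ennreal ((cmod (g n x - f x))\<^sup>2) = liminf (\<lambda>k. ennreal ((cmod (g n x - g (r k) x))\<^sup>2))"
        using lim
      proof eventually_elim
        case (elim x)
        then have "(\<lambda>k. ennreal ((cmod (g n x - g (r k) x))\<^sup>2)) \<longlonglongrightarrow> ennreal ((cmod (g n x - f x))\<^sup>2)"
          by (intro tendsto_ennrealI tendsto_power tendsto_norm tendsto_diff tendsto_const)
        then show ?case by (intro lim_imp_Liminf[symmetric]) auto
      qed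
    qed
    also have "\<dots> \<le> liminf (\<lambda>k. \<integral>\<^sup>+x. ennreal ((cmod (g n x - g (r k) x))\<^sup>2) \<partial>M)"
      by (rule nn_integral_liminf) measurable
    also have "\<dots> \<le> liminf (\<lambda>k::nat. ennreal \<epsilon>)"
    proof (rule Liminf_mono)
      show "\<forall>\<^sub>F k in sequentially. (\<integral>\<^sup>+x. ennreal ((cmod (g n x - g (r k) x))\<^sup>2) \<partial>M) \<le> ennreal \<epsilon>"
        using eventually_ge_at_top[of K]
      proof eventually_elim
        case (elim k)
        have "K \<le> r k" using elim r(3)[of k] by simp
        then show ?case using K n by (subst sq_norm_nn[OF sq_int_diff[OF g g]]) (auto intro!: ennreal_leI)
      qed
    qed
    also have "\<dots> = ennreal \<epsilon>" by (rule Liminf_const) simp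
    finally show ?thesis .
  qed
  have est': "sq_int M (\<lambda>x. g n x - f x)" "sq_norm M (\<lambda>x. g n x - f x) \<le> \<epsilon>"
    if "0 < \<epsilon>" "\<forall>m\<ge>K. \<forall>n\<ge>K. sq_norm M (\<lambda>x. g m x - g n x) \<le> \<epsilon>" "n \<ge> K" for K n \<epsilon>
    using sq_intI_nn[OF _ est[OF that(2,3)]] that(1) by (auto intro: borel_measurable_diff)
  show thesis
  proof (rule that[of f])
    obtain K where K: "\<forall>m\<ge>K. \<forall>n\<ge>K. sq_norm M (\<lambda>x. g m x - g n x) \<le> 1" using cauchy[of 1] by auto
    have "sq_int M (\<lambda>x. g K x - (g K x - f x))" by (rule sq_int_diff[OF g est'(1)[OF zero_less_one K order_refl]])
    then show "sq_int M f" by simp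
    show "(\<lambda>n. sq_norm M (\<lambda>x. g n x - f x)) \<longlonglongrightarrow> 0"
    proof (rule LIMSEQ_I)
      fix e :: real assume e: "0 < e"
      then obtain K where K: "\<forall>m\<ge>K. \<forall>n\<ge>K. sq_norm M (\<lambda>x. g m x - g n x) \<le> e/2" using cauchy[of "e/2"] by auto
      have "norm (sq_norm M (\<lambda>x. g n x - f x) - 0) < e" if "n \<ge> K" for n
        using est'(2)[OF _ K that] e sq_norm_nonneg[of M "\<lambda>x. g n x - f x"] by auto
      then show "\<exists>no. \<forall>n\<ge>no. norm (sq_norm M (\<lambda>x. g n x - f x) - 0) < e" by blast
    qed
  qed
qed

lemma sq_norm_parallelogram:
  assumes f: "sq_int M f" and g: "sq_int M g"
  shows "sq_norm M (\<lambda>x. f x - g x) = 2 * sq_norm M f + 2 * sq_norm M g - 4 * sq_norm M (\<lambda>x. (1/2) * (f x + g x))"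
proof -
  have p: "(cmod (a - b))\<^sup>2 = 2 * (cmod a)\<^sup>2 + 2 * (cmod b)\<^sup>2 - 4 * (cmod ((1/2) * (a + b)))\<^sup>2" for a b
    unfolding cmod_power2 by (simp add: power2_eq_square field_simps)
  have i: "integrable M (\<lambda>x. (cmod (f x))\<^sup>2)" "integrable M (\<lambda>x. (cmod (g x))\<^sup>2)"
    "integrable M (\<lambda>x. (cmod ((1/2) * (f x + g x)))\<^sup>2)"
    using f g sq_int_scale[OF sq_int_add[OF f g], of "1/2"] by (auto simp: sq_int_def)
  show ?thesis
    unfolding sq_norm_def p using i
    by (simp only: Bochner_Integration.integral_diff Bochner_Integration.integral_add integrable_mult_right
        Bochner_Integration.integrable_add integral_mult_right_zero)
qed

lemma sq_norm_add_real:
  assumes f: "sq_int M f" and g: "sq_int M g"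
  shows "sq_norm M (\<lambda>x. f x + complex_of_real s * g x) =
    sq_norm M f + 2 * s * Re (\<integral>x. f x * cnj (g x) \<partial>M) + s\<^sup>2 * sq_norm M g"
proof -
  have p: "(cmod (a + complex_of_real s * b))\<^sup>2 = (cmod a)\<^sup>2 + 2 * s * Re (a * cnj b) + s\<^sup>2 * (cmod b)\<^sup>2" for a b
    unfolding cmod_power2 by (simp add: power2_eq_square algebra_simps)
  have i: "integrable M (\<lambda>x. (cmod (f x))\<^sup>2)" "integrable M (\<lambda>x. (cmod (g x))\<^sup>2)"
    "integrable M (\<lambda>x. Re (f x * cnj (g x)))"
    using f g integrable_Re[OF sq_int_cauchy_schwarz(1)[OF f g]] by (auto simp: sq_int_def)
  have "sq_norm M (\<lambda>x. f x + complex_of_real s * g x) =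
     (\<integral>x. (cmod (f x))\<^sup>2 \<partial>M) + 2 * s * (\<integral>x. Re (f x * cnj (g x)) \<partial>M) + s\<^sup>2 * (\<integral>x. (cmod (g x))\<^sup>2 \<partial>M)"
    unfolding sq_norm_def p using i
    by (simp only: Bochner_Integration.integral_add integrable_mult_right
        Bochner_Integration.integrable_add integral_mult_right_zero)
  then show ?thesis by (simp only: sq_norm_def integral_Re[OF sq_int_cauchy_schwarz(1)[OF f g]])
qed

lemma quadratic_nonneg_imp_linear_zero:
  fixes D N :: real
  assumes "\<And>s. 0 \<le> 2 * s * D + s\<^sup>2 * N" "0 \<le> N"
  shows "D = 0"
proof (rule ccontr)
  assume D: "D \<noteq> 0"
  define s where "s = - D / (N + 1)"
  have Ds: "D = - s * (N + 1)" using assms(2) by (simp add: s_def)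
  have "2 * s * D + s\<^sup>2 * N = - s\<^sup>2 * (N + 2)"
    by (subst Ds) (simp add: power2_eq_square algebra_simps)
  moreover have "0 < s\<^sup>2 * (N + 2)" using D assms(2) by (simp add: s_def)
  ultimately show False using assms(1)[of s] by simp
qed

text \<open>The representing element is the limit of \<open>B \<psi>\<close> along a minimising sequence of
  \<open>\<parallel>B \<psi>\<parallel>\<^sup>2 - 2 Re (l \<psi>)\<close>.\<close>

lemma bounded_functional_representation:
  fixes V :: "('y \<Rightarrow> complex) set" and B :: "('y \<Rightarrow> complex) \<Rightarrow> 'x \<Rightarrow> complex" and l :: "('y \<Rightarrow> complex) \<Rightarrow> complex"
  assumes V0: "V \<noteq> {}"
    and Vadd: "\<And>\<phi> \<psi>. \<phi> \<in> V \<Longrightarrow> \<psi> \<in> V \<Longrightarrow> (\<lambda>y. \<phi> y + \<psi> y) \<in> V"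
    and Vscale: "\<And>c \<psi>. \<psi> \<in> V \<Longrightarrow> (\<lambda>y. c * \<psi> y) \<in> V"
    and B: "\<And>\<psi>. \<psi> \<in> V \<Longrightarrow> sq_int M (B \<psi>)"
    and Badd: "\<And>\<phi> \<psi>. \<phi> \<in> V \<Longrightarrow> \<psi> \<in> V \<Longrightarrow> B (\<lambda>y. \<phi> y + \<psi> y) = (\<lambda>x. B \<phi> x + B \<psi> x)"
    and Bscale: "\<And>c \<psi>. \<psi> \<in> V \<Longrightarrow> B (\<lambda>y. c * \<psi> y) = (\<lambda>x. c * B \<psi> x)"
    and ladd: "\<And>\<phi> \<psi>. \<phi> \<in> V \<Longrightarrow> \<psi> \<in> V \<Longrightarrow> l (\<lambda>y. \<phi> y + \<psi> y) = l \<phi> + l \<psi>"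
    and lscale: "\<And>c \<psi>. \<psi> \<in> V \<Longrightarrow> l (\<lambda>y. c * \<psi> y) = cnj c * l \<psi>"
    and bound: "\<And>\<psi>. \<psi> \<in> V \<Longrightarrow> (cmod (l \<psi>))\<^sup>2 \<le> K * sq_norm M (B \<psi>)" and K: "0 < K"
  obtains f where "sq_int M f" "\<And>\<psi>. \<psi> \<in> V \<Longrightarrow> l \<psi> = (\<integral>x. f x * cnj (B \<psi> x) \<partial>M)"
proof -
  define J where "J = (\<lambda>\<psi>. sq_norm M (B \<psi>) - 2 * Re (l \<psi>))"
  have Jlow: "- K \<le> J \<psi>" if "\<psi> \<in> V" for \<psi>
  proof -
    \<comment> \<open>Completing the square with the assumed bound on \<open>l\<close> shows that
      the functional \<open>J\<close> is bounded below.\<close>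
    have "0 \<le> (cmod (l \<psi>) - K)\<^sup>2 / K" using K by simp
    also have "(cmod (l \<psi>) - K)\<^sup>2 / K = (cmod (l \<psi>))\<^sup>2 / K - 2 * cmod (l \<psi>) + K"
      using K by (simp add: power2_eq_square field_simps)
    also have "(cmod (l \<psi>))\<^sup>2 / K \<le> sq_norm M (B \<psi>)" using bound[OF that] K by (simp add: field_simps)
    finally show ?thesis unfolding J_def using complex_Re_le_cmod[of "l \<psi>"] by linarith
  qed
  define I where "I = Inf (J ` V)"
  have bdd: "bdd_below (J ` V)" by (rule bdd_belowI2[of _ "- K"]) (rule Jlow)
  have I: "I \<le> J \<psi>" if "\<psi> \<in> V" for \<psi> unfolding I_def by (rule cINF_lower[OF bdd that])
  have "\<exists>\<psi>\<in>V. J \<psi> < I + 1 / real (Suc n)" for n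
    using cInf_lessD[of "J ` V" "I + 1 / real (Suc n)"] V0 by (auto simp: I_def)
  then obtain p where p: "\<And>n. p n \<in> V" "\<And>n. J (p n) < I + 1 / real (Suc n)" by metis
  \<comment> \<open>Near-minimisers are close to each other by the parallelogram law, since
    \<open>J\<close> at their midpoint is at least \<open>I\<close>.\<close>
  have near: "sq_norm M (\<lambda>x. B (p m) x - B (p n) x) \<le> 2 / real (Suc m) + 2 / real (Suc n)" for m n
  proof -
    let ?q = "\<lambda>y. (1/2) * (p m y + p n y)"
    have qV: "?q \<in> V" by (intro Vscale Vadd p)
    have Bq: "B ?q = (\<lambda>x. (1/2) * (B (p m) x + B (p n) x))" using p by (simp only: Bscale Vadd Badd)
    have lq: "l ?q = (1/2) * (l (p m) + l (p n))" using p by (simp only: lscale Vadd ladd) simp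
    have "sq_norm M (\<lambda>x. B (p m) x - B (p n) x) = 2 * J (p m) + 2 * J (p n) - 4 * J ?q"
      unfolding J_def Bq lq sq_norm_parallelogram[OF B[OF p(1)] B[OF p(1)]] by (simp add: field_simps)
    also have "\<dots> \<le> 2 * (I + 1 / real (Suc m)) + 2 * (I + 1 / real (Suc n)) - 4 * I"
      using I[OF qV] less_imp_le[OF p(2)[of m]] less_imp_le[OF p(2)[of n]] by (intro diff_mono add_mono mult_left_mono) auto
    finally show ?thesis by simp
  qed
  have cauchy: "\<exists>N. \<forall>m\<ge>N. \<forall>n\<ge>N. sq_norm M (\<lambda>x. B (p m) x - B (p n) x) \<le> \<epsilon>" if e: "0 < \<epsilon>" for \<epsilon>
  proof -
    obtain N :: nat where N: "4 / \<epsilon> < real N" using reals_Archimedean2 by blast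
    have small: "2 / real (Suc m) \<le> \<epsilon> / 2" if "m \<ge> N" for m
    proof -
      have "4 / \<epsilon> \<le> real (Suc m)" using N that by linarith
      then show ?thesis using e by (simp add: field_simps)
    qed
    have "sq_norm M (\<lambda>x. B (p m) x - B (p n) x) \<le> \<epsilon>" if "m \<ge> N" "n \<ge> N" for m n
      using near[of m n] small[OF that(1)] small[OF that(2)] by linarith
    then show ?thesis by blast
  qed
  obtain f where f: "sq_int M f" "(\<lambda>n. sq_norm M (\<lambda>x. B (p n) x - f x)) \<longlonglongrightarrow> 0"
    by (rule riesz_fischer[OF B[OF p(1)] cauchy]) (assumption, rule that)
  let ?ip = "\<lambda>g \<psi>. \<integral>x. g x * cnj (B \<psi> x) \<partial>M"
  have Re: "Re (?ip f \<psi>) = Re (l \<psi>)" if \<psi>: "\<psi> \<in> V" for \<psi>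
  proof -
    have lim: "(\<lambda>n. Re (?ip (B (p n)) \<psi>)) \<longlonglongrightarrow> Re (?ip f \<psi>)"
    proof (rule tendsto_Re, rule Lim_transform2)
      show "(\<lambda>n. ?ip f \<psi>) \<longlonglongrightarrow> ?ip f \<psi>" by (rule tendsto_const)
      have "(\<lambda>n. (cmod (?ip f \<psi> - ?ip (B (p n)) \<psi>))\<^sup>2) \<longlonglongrightarrow> 0"
      proof (rule tendsto_sandwich[of "\<lambda>_. 0"])
        show "(\<lambda>n. sq_norm M (\<lambda>x. B (p n) x - f x) * sq_norm M (B \<psi>)) \<longlonglongrightarrow> 0"
          using tendsto_mult_left_zero[OF f(2)] by simp
        have "(cmod (?ip f \<psi> - ?ip (B (p n)) \<psi>))\<^sup>2 \<le> sq_norm M (\<lambda>x. B (p n) x - f x) * sq_norm M (B \<psi>)" for n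
        proof -
          have eq: "?ip (B (p n)) \<psi> - ?ip f \<psi> = ?ip (\<lambda>x. B (p n) x - f x) \<psi>"
            using sq_int_cauchy_schwarz(1)[OF B[OF p(1)] B[OF \<psi>]] sq_int_cauchy_schwarz(1)[OF f(1) B[OF \<psi>]]
            by (simp add: left_diff_distrib)
          show ?thesis
            unfolding norm_minus_commute[of "?ip f \<psi>"] eq
            by (rule sq_int_cauchy_schwarz(2)[OF sq_int_diff[OF B[OF p(1)] f(1)] B[OF \<psi>]])
        qed
        then show "\<forall>\<^sub>F n in sequentially. (cmod (?ip f \<psi> - ?ip (B (p n)) \<psi>))\<^sup>2 \<le> sq_norm M (\<lambda>x. B (p n) x - f x) * sq_norm M (B \<psi>)" by simp
      qed auto
      then have "(\<lambda>n. sqrt ((cmod (?ip f \<psi> - ?ip (B (p n)) \<psi>))\<^sup>2)) \<longlonglongrightarrow> sqrt 0" by (rule tendsto_real_sqrt)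
      then show "(\<lambda>n. ?ip f \<psi> - ?ip (B (p n)) \<psi>) \<longlonglongrightarrow> 0" by (simp add: tendsto_norm_zero_iff)
    qed
    \<comment> \<open>Perturbing \<open>p n\<close> by \<open>s * \<psi>\<close> cannot lower
      \<open>J\<close> by more than \<open>1 / real (Suc n)\<close>; in the limit the quadratic in
      \<open>s\<close> is nonnegative, so its linear term vanishes.\<close>
    have "0 \<le> 2 * s * (Re (?ip f \<psi>) - Re (l \<psi>)) + s\<^sup>2 * sq_norm M (B \<psi>)" for s
    proof (rule tendsto_le[OF sequentially_bot])
      show "(\<lambda>n. 2 * s * (Re (?ip (B (p n)) \<psi>) - Re (l \<psi>)) + s\<^sup>2 * sq_norm M (B \<psi>)) \<longlonglongrightarrow>
         2 * s * (Re (?ip f \<psi>) - Re (l \<psi>)) + s\<^sup>2 * sq_norm M (B \<psi>)"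
        by (intro tendsto_add tendsto_mult tendsto_diff tendsto_const lim)
      show "(\<lambda>n. - (1 / real (Suc n))) \<longlonglongrightarrow> 0"
        using tendsto_minus[OF LIMSEQ_inverse_real_of_nat] by (simp add: inverse_eq_divide)
      show "\<forall>\<^sub>F n in sequentially. - (1 / real (Suc n)) \<le> 2 * s * (Re (?ip (B (p n)) \<psi>) - Re (l \<psi>)) + s\<^sup>2 * sq_norm M (B \<psi>)"
      proof (rule always_eventually, rule allI)
        fix n
        let ?q = "\<lambda>y. p n y + complex_of_real s * \<psi> y"
        have sV: "(\<lambda>y. complex_of_real s * \<psi> y) \<in> V" by (rule Vscale[OF \<psi>])
        have qV: "?q \<in> V" by (intro Vadd sV p)
        have Bq: "B ?q = (\<lambda>x. B (p n) x + complex_of_real s * B \<psi> x)" unfolding Badd[OF p(1) sV] Bscale[OF \<psi>] ..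
        have lq: "Re (l ?q) = Re (l (p n)) + s * Re (l \<psi>)" unfolding ladd[OF p(1) sV] lscale[OF \<psi>] by simp
        have "J ?q = J (p n) + (2 * s * (Re (?ip (B (p n)) \<psi>) - Re (l \<psi>)) + s\<^sup>2 * sq_norm M (B \<psi>))"
          unfolding J_def lq Bq sq_norm_add_real[OF B[OF p(1)] B[OF \<psi>]] by (simp add: algebra_simps)
        then show "- (1 / real (Suc n)) \<le> 2 * s * (Re (?ip (B (p n)) \<psi>) - Re (l \<psi>)) + s\<^sup>2 * sq_norm M (B \<psi>)"
          using I[OF qV] p(2)[of n] by linarith
      qed
    qed
    from quadratic_nonneg_imp_linear_zero[OF this sq_norm_nonneg] show ?thesis by simp
  qed
  show thesis
  proof (rule that[OF f(1)])
    fix \<psi> assume \<psi>: "\<psi> \<in> V"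
    \<comment> \<open>Inserting \<open>\<i> * \<psi>\<close> turns the identity of real parts into
      that of imaginary parts, as both sides are conjugate-linear.\<close>
    have "Re (?ip f (\<lambda>y. \<i> * \<psi> y)) = Re (l (\<lambda>y. \<i> * \<psi> y))" by (rule Re[OF Vscale[OF \<psi>]])
    also have "Re (l (\<lambda>y. \<i> * \<psi> y)) = Im (l \<psi>)" by (simp add: lscale[OF \<psi>])
    also have "?ip f (\<lambda>y. \<i> * \<psi> y) = (\<integral>x. (- \<i>) * (f x * cnj (B \<psi> x)) \<partial>M)"
      unfolding Bscale[OF \<psi>] by (simp add: mult_ac)
    also have "\<dots> = (- \<i>) * ?ip f \<psi>" by (rule integral_mult_right_zero)
    finally have "Im (?ip f \<psi>) = Im (l \<psi>)" by simp
    with Re[OF \<psi>] show "l \<psi> = ?ip f \<psi>" by (simp add: complex_eq_iff)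
  qed
qed

section \<open>Controllability\<close>

lemma L2_sq_int: "L2 u \<longleftrightarrow> sq_int lborel u"
  by (simp add: L2_def sq_int_def)

definition inversion_factor :: "'a::euclidean_space itself \<Rightarrow> real" where
  "inversion_factor _ = (2 * pi) powr (- real DIM('a))"

lemma inversion_factor: "0 < inversion_factor TYPE('a::euclidean_space)" "inversion_factor TYPE('a::euclidean_space) \<le> 1"
  "inversion_factor TYPE('a::euclidean_space) = 1 / (2 * pi) ^ DIM('a)"
proof -
  show e: "inversion_factor TYPE('a::euclidean_space) = 1 / (2 * pi) ^ DIM('a)"
    by (simp add: inversion_factor_def powr_minus powr_realpow divide_inverse)
  show "0 < inversion_factor TYPE('a::euclidean_space)" by (simp add: e)
  have "1 \<le> (2 * pi) ^ DIM('a)" using pi_gt3 by (intro one_le_power) auto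
  then show "inversion_factor TYPE('a::euclidean_space) \<le> 1" by (simp add: e)
qed

lemma schr_free_evol:
  fixes \<psi> :: "'a::euclidean_space \<Rightarrow> complex"
  shows "schr_free t \<psi> x = complex_of_real (inversion_factor TYPE('a)) * evol (fourier \<psi>) t x"
  unfolding schr_free_def evol_eq inversion_factor_def cis_conv_exp ..

lemma schr_test_regular_symbol: "schr_test \<psi> \<Longrightarrow> regular_symbol (fourier \<psi>)"
  unfolding schr_test_def regular_symbol_def using continuous_on_fourier fourier_bound by blast

lemma schr_test_integrable: "schr_test \<psi> \<Longrightarrow> integrable lborel \<psi>" "schr_test \<psi> \<Longrightarrow> integrable lborel (fourier \<psi>)"
  by (auto simp: schr_test_def)

lemma integrable_fourier_kernel:
  fixes \<psi> :: "'a::euclidean_space \<Rightarrow> complex"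
  assumes "integrable lborel \<psi>"
  shows "integrable lborel (\<lambda>x. exp (- \<i> * complex_of_real (x \<bullet> \<xi>)) * \<psi> x)"
proof -
  have "integrable lborel (\<lambda>x. cis (- (x \<bullet> \<xi>)) * \<psi> x)" by (rule integrable_cis_mult[OF assms]) measurable
  then show ?thesis by (simp add: cis_conv_exp)
qed

lemma fourier_add:
  assumes "integrable lborel \<phi>" "integrable lborel \<psi>"
  shows "fourier (\<lambda>x. \<phi> x + \<psi> x) = (\<lambda>\<xi>. fourier \<phi> \<xi> + fourier \<psi> \<xi>)"
  unfolding fourier_def distrib_left
  by (intro ext Bochner_Integration.integral_add integrable_fourier_kernel assms)

lemma fourier_scale: "fourier (\<lambda>x. c * \<psi> x) = (\<lambda>\<xi>. c * fourier \<psi> \<xi>)"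
proof
  fix \<xi>
  have "fourier (\<lambda>x. c * \<psi> x) \<xi> = (\<integral>x. c * (exp (- \<i> * complex_of_real (x \<bullet> \<xi>)) * \<psi> x) \<partial>lborel)"
    unfolding fourier_def by (simp only: mult.left_commute)
  also have "\<dots> = c * fourier \<psi> \<xi>" unfolding fourier_def by (rule integral_mult_right_zero)
  finally show "fourier (\<lambda>x. c * \<psi> x) \<xi> = c * fourier \<psi> \<xi>" .
qed

lemma integrable_evol_kernel:
  fixes h :: "'a::euclidean_space \<Rightarrow> complex"
  assumes "integrable lborel h"
  shows "integrable lborel (\<lambda>\<xi>. cis (x \<bullet> \<xi> - t * (norm \<xi>)\<^sup>2) * h \<xi>)"
  by (rule integrable_cis_mult[OF assms]) measurable

lemma evol_add:
  assumes "integrable lborel h" "integrable lborel k"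
  shows "evol (\<lambda>\<xi>. h \<xi> + k \<xi>) t x = evol h t x + evol k t x"
  unfolding evol_eq distrib_left
  by (intro Bochner_Integration.integral_add integrable_evol_kernel assms)

lemma evol_scale: "evol (\<lambda>\<xi>. c * h \<xi>) t x = c * evol h t x"
proof -
  have "evol (\<lambda>\<xi>. c * h \<xi>) t x = (\<integral>\<xi>. c * (cis (x \<bullet> \<xi> - t * (norm \<xi>)\<^sup>2) * h \<xi>) \<partial>lborel)"
    unfolding evol_eq by (simp only: mult.left_commute)
  also have "\<dots> = c * evol h t x" unfolding evol_eq by (rule integral_mult_right_zero)
  finally show ?thesis .
qed

lemma schr_test_add: "schr_test \<phi> \<Longrightarrow> schr_test \<psi> \<Longrightarrow> schr_test (\<lambda>x. \<phi> x + \<psi> x)"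
  unfolding schr_test_def L2_sq_int by (auto simp: fourier_add intro: sq_int_add)

lemma schr_test_scale: "schr_test \<psi> \<Longrightarrow> schr_test (\<lambda>x. c * \<psi> x)"
  unfolding schr_test_def L2_sq_int by (auto simp: fourier_scale intro: sq_int_scale)

lemma schr_free_add:
  assumes "schr_test \<phi>" "schr_test \<psi>"
  shows "schr_free t (\<lambda>x. \<phi> x + \<psi> x) x = schr_free t \<phi> x + schr_free t \<psi> x"
  using assms by (simp add: schr_free_evol fourier_add evol_add schr_test_integrable distrib_left)

lemma schr_free_scale: "schr_free t (\<lambda>x. c * \<psi> x) x = c * schr_free t \<psi> x"
  by (simp add: schr_free_evol fourier_scale evol_scale)

lemma schr_free_measurable [measurable]:
  assumes "schr_test \<psi>" "f \<in> borel_measurable M" "g \<in> borel_measurable M"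
  shows "(\<lambda>x. schr_free (f x) \<psi> (g x)) \<in> borel_measurable M"
  unfolding schr_free_evol
  by (intro borel_measurable_times borel_measurable_const evol_measurable2 schr_test_integrable assms)

lemma schr_free_sq_int:
  fixes \<psi> :: "'a::euclidean_space \<Rightarrow> complex"
  assumes "schr_test \<psi>"
  shows "sq_int lborel (schr_free t \<psi>)"
    and "sq_norm lborel (schr_free t \<psi>) \<le> (2 * pi) ^ DIM('a) * sq_norm lborel (fourier \<psi>)"
proof -
  let ?c = "(2 * pi) ^ DIM('a) * sq_norm lborel (fourier \<psi>)"
  have [measurable]: "schr_free t \<psi> \<in> borel_measurable borel"
    using schr_free_measurable[OF assms, of "\<lambda>_. t" borel "\<lambda>x. x"] by simp
  have le: "(cmod (schr_free t \<psi> x))\<^sup>2 \<le> (cmod (evol (fourier \<psi>) t x))\<^sup>2" for x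
    unfolding schr_free_evol norm_mult norm_of_real
    using inversion_factor[where 'a='a] by (intro power_mono mult_left_le_one_le) auto
  have "(\<integral>\<^sup>+x. ennreal ((cmod (schr_free t \<psi> x))\<^sup>2) \<partial>lborel) \<le> (\<integral>\<^sup>+x. ennreal ((cmod (evol (fourier \<psi>) t x))\<^sup>2) \<partial>lborel)"
    by (intro nn_integral_mono ennreal_leI le)
  also have "\<dots> = ennreal ?c" unfolding sq_norm_def by (rule plancherel_evol[OF schr_test_regular_symbol[OF assms]])
  finally have b: "(\<integral>\<^sup>+x. ennreal ((cmod (schr_free t \<psi> x))\<^sup>2) \<partial>lborel) \<le> ennreal ?c" .
  show "sq_int lborel (schr_free t \<psi>)" "sq_norm lborel (schr_free t \<psi>) \<le> ?c"
    by (rule sq_intI_nn[OF _ b]; simp add: sq_norm_nonneg)+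
qed

text \<open>By Fourier inversion \<open>\<psi>\<close> agrees almost everywhere with its evolution
  at time 0, whose norm is already bounded.\<close>

lemma schr_test_sq_norm_le:
  fixes \<psi> :: "'a::euclidean_space \<Rightarrow> complex"
  assumes "schr_test \<psi>"
  shows "sq_norm lborel \<psi> \<le> (2 * pi) ^ DIM('a) * sq_norm lborel (fourier \<psi>)"
proof -
  have [measurable]: "\<psi> \<in> borel_measurable borel" "schr_free 0 \<psi> \<in> borel_measurable borel"
    using borel_measurable_integrable[OF schr_test_integrable(1)[OF assms]] sq_int_measurable[OF schr_free_sq_int(1)[OF assms, of 0]] by auto
  have e0: "evol (fourier \<psi>) 0 x = inv_ft (fourier \<psi>) x" for x by (simp add: evol_def)
  have "AE x in lborel. schr_free 0 \<psi> x = \<psi> x"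
    using fourier_inversion_AE[OF schr_test_integrable[OF assms]]
    by eventually_elim (simp add: schr_free_evol e0 inversion_factor(3))
  then have "AE x in lborel. (cmod (\<psi> x))\<^sup>2 = (cmod (schr_free 0 \<psi> x))\<^sup>2" by eventually_elim simp
  then have "sq_norm lborel \<psi> = sq_norm lborel (schr_free 0 \<psi>)"
    unfolding sq_norm_def by (intro integral_cong_AE) auto
  then show ?thesis using schr_free_sq_int(2)[OF assms, of 0] by simp
qed

lemma l2_inner_add:
  assumes "sq_int lborel g" "sq_int lborel h" "sq_int lborel k"
  shows "l2_inner g (\<lambda>x. h x + k x) = l2_inner g h + l2_inner g k"
  unfolding l2_inner_def complex_cnj_add distrib_left
  by (intro Bochner_Integration.integral_add sq_int_cauchy_schwarz assms)

lemma l2_inner_scale: "l2_inner g (\<lambda>x. c * h x) = cnj c * l2_inner g h"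
proof -
  have "l2_inner g (\<lambda>x. c * h x) = (\<integral>x. cnj c * (g x * cnj (h x)) \<partial>lborel)"
    unfolding l2_inner_def complex_cnj_mult by (simp only: mult.left_commute)
  then show ?thesis unfolding l2_inner_def by (simp only: integral_mult_right_zero)
qed

lemma l2_inner_cauchy_schwarz:
  "sq_int lborel g \<Longrightarrow> sq_int lborel h \<Longrightarrow> (cmod (l2_inner g h))\<^sup>2 \<le> sq_norm lborel g * sq_norm lborel h"
  unfolding l2_inner_def by (rule sq_int_cauchy_schwarz)

section \<open>The observation map and the construction of the control\<close>

text \<open>The adjoint of the map from controls to their contribution at time \<open>T\<close>: the
  free solution that equals \<open>\<psi>\<close> at time \<open>T\<close>, restricted to the
  control region.\<close>

definition observe :: "'a::euclidean_space set \<Rightarrow> real \<Rightarrow> ('a \<Rightarrow> complex) \<Rightarrow> 'a \<times> real \<Rightarrow> complex" where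
  "observe S T \<psi> p = indicator (S \<times> {0<..<T}) p * schr_free (snd p - T) \<psi> (fst p)"

text \<open>The substitution \<open>t = s - T\<close> carries the control window to the time window
  of \<open>observability\<close>.\<close>

lemma observe_nn:
  fixes \<psi> :: "'a::euclidean_space \<Rightarrow> complex"
  assumes S: "open S" and \<psi>: "schr_test \<psi>"
  shows "observe S T \<psi> \<in> borel_measurable (lborel \<Otimes>\<^sub>M lborel)"
    and "(\<integral>\<^sup>+p. ennreal ((cmod (observe S T \<psi> p))\<^sup>2) \<partial>(lborel \<Otimes>\<^sub>M lborel)) =
       ennreal ((inversion_factor TYPE('a))\<^sup>2) * (\<integral>\<^sup>+t\<in>{-T<..<0}. (\<integral>\<^sup>+z\<in>S. ennreal ((cmod (evol (fourier \<psi>) t z))\<^sup>2) \<partial>lborel) \<partial>lborel)"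
proof -
  have [measurable]: "S \<in> sets borel" using S by simp
  note [measurable] = \<psi> schr_test_integrable[OF \<psi>]
  show m: "observe S T \<psi> \<in> borel_measurable (lborel \<Otimes>\<^sub>M lborel)"
    unfolding observe_def[abs_def] by measurable
  let ?O = "\<lambda>t. \<integral>\<^sup>+z\<in>S. ennreal ((cmod (evol (fourier \<psi>) t z))\<^sup>2) \<partial>lborel"
  let ?c = "ennreal ((inversion_factor TYPE('a))\<^sup>2)"
  have Om[measurable]: "?O \<in> borel_measurable borel" by measurable
  have pt: "ennreal ((cmod (observe S T \<psi> (x, s)))\<^sup>2) =
     (?c * indicator {-T<..<0} (- T + s)) * (ennreal ((cmod (evol (fourier \<psi>) (- T + s) x))\<^sup>2) * indicator S x)" for x s
  proof -
    have s: "indicator {0<..<T} s = (indicator {-T<..<0} (- T + s) :: ennreal)" by (auto simp: indicator_def)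
    show ?thesis
      unfolding observe_def schr_free_evol
      by (cases "x \<in> S"; cases "s \<in> {0<..<T}")
         (auto simp: indicator_def norm_mult power_mult_distrib ennreal_mult)
  qed
  have "(\<integral>\<^sup>+p. ennreal ((cmod (observe S T \<psi> p))\<^sup>2) \<partial>(lborel \<Otimes>\<^sub>M lborel)) =
     (\<integral>\<^sup>+s. (\<integral>\<^sup>+x. ennreal ((cmod (observe S T \<psi> (x, s)))\<^sup>2) \<partial>lborel) \<partial>lborel)"
    by (rule lborel_pair.nn_integral_snd[symmetric]) (use m in measurable)
  also have "\<dots> = (\<integral>\<^sup>+s. (?c * indicator {-T<..<0} (- T + s)) * ?O (- T + s) \<partial>lborel)"
    unfolding pt by (intro nn_integral_cong nn_integral_cmult) measurable
  also have "\<dots> = (\<integral>\<^sup>+s. (?c * indicator {-T<..<0} s) * ?O s \<partial>lborel)"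
    by (rule nn_integral_translate) measurable
  also have "\<dots> = (\<integral>\<^sup>+s. ?c * (?O s * indicator {-T<..<0} s) \<partial>lborel)" by (simp only: mult_ac)
  also have "\<dots> = ?c * (\<integral>\<^sup>+t\<in>{-T<..<0}. ?O t \<partial>lborel)" by (rule nn_integral_cmult) measurable
  finally show "(\<integral>\<^sup>+p. ennreal ((cmod (observe S T \<psi> p))\<^sup>2) \<partial>(lborel \<Otimes>\<^sub>M lborel)) = ?c * (\<integral>\<^sup>+t\<in>{-T<..<0}. ?O t \<partial>lborel)" .
qed

lemma observe_sq_int:
  fixes \<psi> :: "'a::euclidean_space \<Rightarrow> complex"
  assumes S: "open S" and \<psi>: "schr_test \<psi>" and T: "0 < T"
  shows "sq_int (lborel \<Otimes>\<^sub>M lborel) (observe S T \<psi>)"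
proof (rule sq_intI_nn(1)[OF observe_nn(1)[OF S \<psi>]])
  let ?c = "ennreal ((inversion_factor TYPE('a))\<^sup>2)" and ?H = "(2 * pi) ^ DIM('a) * sq_norm lborel (fourier \<psi>)"
  have H: "0 \<le> ?H" by (simp add: sq_norm_nonneg)
  have "(\<integral>\<^sup>+t\<in>{-T<..<0}. (\<integral>\<^sup>+z\<in>S. ennreal ((cmod (evol (fourier \<psi>) t z))\<^sup>2) \<partial>lborel) \<partial>lborel)
     \<le> (\<integral>\<^sup>+t. ennreal ?H * indicator {-T<..<0} t \<partial>lborel)"
  proof (intro nn_integral_mono mult_right_mono)
    fix t
    have "(\<integral>\<^sup>+z\<in>S. ennreal ((cmod (evol (fourier \<psi>) t z))\<^sup>2) \<partial>lborel) \<le> (\<integral>\<^sup>+z. ennreal ((cmod (evol (fourier \<psi>) t z))\<^sup>2) \<partial>lborel)"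
      by (intro nn_integral_mono) (auto simp: indicator_def)
    also have "\<dots> = ennreal ?H" unfolding sq_norm_def by (rule plancherel_evol[OF schr_test_regular_symbol[OF \<psi>]])
    finally show "(\<integral>\<^sup>+z\<in>S. ennreal ((cmod (evol (fourier \<psi>) t z))\<^sup>2) \<partial>lborel) \<le> ennreal ?H" .
  qed simp
  also have "\<dots> = ennreal ?H * ennreal T"
    using T by (subst nn_integral_cmult_indicator) auto
  finally have "?c * (\<integral>\<^sup>+t\<in>{-T<..<0}. (\<integral>\<^sup>+z\<in>S. ennreal ((cmod (evol (fourier \<psi>) t z))\<^sup>2) \<partial>lborel) \<partial>lborel) \<le> ?c * (ennreal ?H * ennreal T)"
    by (rule mult_left_mono) simp
  also have "\<dots> = ennreal ((inversion_factor TYPE('a))\<^sup>2 * (?H * T))" using H T by (simp only: ennreal_mult zero_le_power2 less_imp_le mult_nonneg_nonneg)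
  finally show "(\<integral>\<^sup>+p. ennreal ((cmod (observe S T \<psi> p))\<^sup>2) \<partial>(lborel \<Otimes>\<^sub>M lborel)) \<le> ennreal ((inversion_factor TYPE('a))\<^sup>2 * (?H * T))"
    unfolding observe_nn(2)[OF S \<psi>] .
  show "0 \<le> (inversion_factor TYPE('a))\<^sup>2 * (?H * T)" using H T by simp
qed

text \<open>The Fourier side is bounded instead of \<open>\<psi>\<close> itself because it dominates
  both \<open>\<psi>\<close> and its evolution at time \<open>- T\<close>, the two quantities
  entering the duality argument.\<close>

lemma schr_observability:
  fixes S :: "'a::euclidean_space set"
  assumes S: "S \<noteq> {}" "open S" "periodic_set S" and T: "0 < T"
  obtains C where "0 < C" "\<And>\<psi>. schr_test \<psi> \<Longrightarrow>
     sq_norm lborel (fourier \<psi>) \<le> C * sq_norm (lborel \<Otimes>\<^sub>M lborel) (observe S T \<psi>)"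
proof -
  obtain v b where vb: "dual_frame v b"
    "\<And>x n. x \<in> S \<Longrightarrow> x + (\<Sum>j\<in>Basis. of_int (n j :: int) *\<^sub>R v j) \<in> S"
    by (rule periodic_set_frame[OF S(3)]) (rule that)
  interpret dual_frame v b by (rule vb(1))
  obtain x0 where x0: "x0 \<in> S" using S(1) by blast
  obtain C where C: "0 < C" "\<And>h::'a \<Rightarrow> complex. regular_symbol h \<Longrightarrow> ennreal (\<integral>\<xi>. (cmod (h \<xi>))\<^sup>2 \<partial>lborel) \<le>
     ennreal C * (\<integral>\<^sup>+t\<in>{-T<..<0}. (\<integral>\<^sup>+z\<in>S. ennreal ((cmod (evol h t z))\<^sup>2) \<partial>lborel) \<partial>lborel)"
    by (rule observability[OF S(2) x0 vb(2) T]) (assumption, rule that)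
  let ?c = "(inversion_factor TYPE('a))\<^sup>2"
  have c: "0 < ?c" using inversion_factor(1)[where 'a='a] by simp
  show thesis
  proof (rule that[of "C / ?c"])
    show "0 < C / ?c" using C(1) c by simp
    fix \<psi> :: "'a \<Rightarrow> complex" assume \<psi>: "schr_test \<psi>"
    let ?O = "\<integral>\<^sup>+t\<in>{-T<..<0}. (\<integral>\<^sup>+z\<in>S. ennreal ((cmod (evol (fourier \<psi>) t z))\<^sup>2) \<partial>lborel) \<partial>lborel"
    let ?n = "sq_norm (lborel \<Otimes>\<^sub>M lborel) (observe S T \<psi>)"
    have n: "ennreal ?n = ennreal ?c * ?O"
      unfolding observe_nn(2)[OF S(2) \<psi>, symmetric] by (rule sq_norm_nn[OF observe_sq_int[OF S(2) \<psi> T], symmetric])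
    have "ennreal (sq_norm lborel (fourier \<psi>)) \<le> ennreal C * ?O"
      unfolding sq_norm_def by (rule C(2)[OF schr_test_regular_symbol[OF \<psi>]])
    also have "ennreal C * ?O = ennreal (C / ?c) * (ennreal ?c * ?O)"
      using C(1) c by (simp add: mult.assoc[symmetric] ennreal_mult[symmetric])
    also have "\<dots> = ennreal (C / ?c * ?n)"
      unfolding n[symmetric] using C(1) c sq_norm_nonneg by (intro ennreal_mult[symmetric]) auto
    finally have le: "ennreal (sq_norm lborel (fourier \<psi>)) \<le> ennreal (C / ?c * ?n)" .
    have "0 \<le> C / ?c * ?n" using C(1) by (intro mult_nonneg_nonneg divide_nonneg_nonneg sq_norm_nonneg) auto
    with le show "sq_norm lborel (fourier \<psi>) \<le> C / ?c * ?n" by (simp only: ennreal_le_iff)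
  qed
qed

theorem theorem1:
  fixes S :: "'a::euclidean_space set"
  assumes "S \<noteq> {}" and "open S" and "periodic_set S"
    and "T > 0"
    and "L2 u0" and "L2 uT"
  shows "\<exists>f. L2_control S T f \<and> schr_solution_at T u0 S f uT"
proof -
  let ?M = "lborel \<Otimes>\<^sub>M lborel :: ('a \<times> real) measure"
  obtain C where C: "0 < C" "\<And>\<psi>. schr_test \<psi> \<Longrightarrow> sq_norm lborel (fourier \<psi>) \<le> C * sq_norm ?M (observe S T \<psi>)"
    by (rule schr_observability[OF assms(1-4)]) (rule that)
  have u: "sq_int lborel u0" "sq_int lborel uT" using assms(5,6) by (auto simp: L2_sq_int)
  \<comment> \<open>The part of the target that free evolution of \<open>u0\<close> does not reach,
    tested against \<open>\<psi>\<close>; the control must produce exactly this functional.\<close>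
  define l where "l = (\<lambda>\<psi>. l2_inner uT \<psi> - l2_inner u0 (schr_free (- T) \<psi>))"
  define A where "A = sq_norm lborel uT + sq_norm lborel u0"
  define D where "D = (2 * pi) ^ DIM('a)"
  have D: "0 < D" by (simp add: D_def)
  have A: "0 \<le> A" by (simp add: A_def sq_norm_nonneg)
  \<comment> \<open>The 2 comes from squaring a sum of two terms, \<open>D\<close> from bounding the
    norms of \<open>\<psi>\<close> and of its evolution by the Fourier side, and \<open>C\<close>
    from observability. \<open>A + 1\<close> replaces \<open>A\<close> to keep \<open>K\<close>
    positive when both states vanish.\<close>
  define K where "K = 2 * (A + 1) * (D * C)"
  have K: "0 < K" using A C D by (simp add: K_def)
  have test_sq: "sq_int lborel \<psi>" if "schr_test \<psi>" for \<psi> :: "'a \<Rightarrow> complex"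
    using that by (simp add: schr_test_def L2_sq_int)
  have bound: "(cmod (l \<psi>))\<^sup>2 \<le> K * sq_norm ?M (observe S T \<psi>)" if \<psi>: "schr_test \<psi>" for \<psi>
  proof -
    let ?H = "D * sq_norm lborel (fourier \<psi>)"
    have "(cmod (l \<psi>))\<^sup>2 \<le> 2 * (cmod (l2_inner uT \<psi>))\<^sup>2 + 2 * (cmod (- l2_inner u0 (schr_free (- T) \<psi>)))\<^sup>2"
      unfolding l_def diff_conv_add_uminus by (rule cmod_add_sq_le)
    also have "\<dots> \<le> 2 * (sq_norm lborel uT * ?H) + 2 * (sq_norm lborel u0 * ?H)"
    proof (intro add_mono mult_left_mono)
      have "(cmod (l2_inner uT \<psi>))\<^sup>2 \<le> sq_norm lborel uT * sq_norm lborel \<psi>"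
        by (rule l2_inner_cauchy_schwarz[OF u(2) test_sq[OF \<psi>]])
      also have "\<dots> \<le> sq_norm lborel uT * ?H"
        unfolding D_def by (intro mult_left_mono schr_test_sq_norm_le \<psi> sq_norm_nonneg)
      finally show "(cmod (l2_inner uT \<psi>))\<^sup>2 \<le> sq_norm lborel uT * ?H" .
      have "(cmod (l2_inner u0 (schr_free (- T) \<psi>)))\<^sup>2 \<le> sq_norm lborel u0 * sq_norm lborel (schr_free (- T) \<psi>)"
        by (rule l2_inner_cauchy_schwarz[OF u(1) schr_free_sq_int(1)[OF \<psi>]])
      also have "\<dots> \<le> sq_norm lborel u0 * ?H"
        unfolding D_def by (intro mult_left_mono schr_free_sq_int(2) \<psi> sq_norm_nonneg)
      finally show "(cmod (- l2_inner u0 (schr_free (- T) \<psi>)))\<^sup>2 \<le> sq_norm lborel u0 * ?H" by simp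
    qed auto
    also have "\<dots> = 2 * A * ?H" by (simp add: A_def algebra_simps)
    also have "\<dots> \<le> 2 * (A + 1) * (D * (C * sq_norm ?M (observe S T \<psi>)))"
      by (intro mult_mono mult_left_mono C \<psi> mult_nonneg_nonneg sq_norm_nonneg) (use A D in auto)
    finally show ?thesis by (simp add: K_def mult.assoc)
  qed
  obtain f where f: "sq_int ?M f" "\<And>\<psi>. \<psi> \<in> Collect schr_test \<Longrightarrow> l \<psi> = (\<integral>p. f p * cnj (observe S T \<psi> p) \<partial>?M)"
  proof (rule bounded_functional_representation[where V = "Collect schr_test" and B = "observe S T" and l = l and M = ?M and K = K])
    have "schr_test (\<lambda>x::'a. 0)" by (simp add: schr_test_def L2_def fourier_def[abs_def])
    then show "Collect schr_test \<noteq> ({} :: ('a \<Rightarrow> complex) set)" by blast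
    show "l (\<lambda>y. \<phi> y + \<psi> y) = l \<phi> + l \<psi>" if "\<phi> \<in> Collect schr_test" "\<psi> \<in> Collect schr_test" for \<phi> \<psi>
    proof -
      have e: "schr_free (- T) (\<lambda>y. \<phi> y + \<psi> y) = (\<lambda>x. schr_free (- T) \<phi> x + schr_free (- T) \<psi> x)"
        using that by (intro ext schr_free_add) auto
      show ?thesis using that u
        by (simp add: l_def e l2_inner_add test_sq schr_free_sq_int(1))
    qed
    show "l (\<lambda>y. c * \<psi> y) = cnj c * l \<psi>" for c \<psi>
    proof -
      have e: "schr_free (- T) (\<lambda>y. c * \<psi> y) = (\<lambda>x. c * schr_free (- T) \<psi> x)" by (intro ext schr_free_scale)
      show ?thesis by (simp add: l_def e l2_inner_scale right_diff_distrib)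
    qed
    show "observe S T (\<lambda>y. \<phi> y + \<psi> y) = (\<lambda>x. observe S T \<phi> x + observe S T \<psi> x)"
      if "\<phi> \<in> Collect schr_test" "\<psi> \<in> Collect schr_test" for \<phi> \<psi> :: "'a \<Rightarrow> complex"
      using that by (simp add: observe_def[abs_def] schr_free_add distrib_left)
    show "observe S T (\<lambda>y. c * \<psi> y) = (\<lambda>x. c * observe S T \<psi> x)" for c and \<psi> :: "'a \<Rightarrow> complex"
      by (simp add: observe_def[abs_def] schr_free_scale mult.left_commute)
    show "sq_int ?M (observe S T \<psi>)" if "\<psi> \<in> Collect schr_test" for \<psi>
      using observe_sq_int[OF assms(2) _ assms(4)] that by simp
  qed (simp_all add: bound K schr_test_add schr_test_scale that)
  have fm: "f \<in> borel_measurable ?M" using f(1) by (rule sq_int_measurable)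
  have Sm: "S \<in> sets borel" using assms(2) by simp
  have "L2_control S T f"
    unfolding L2_control_def
  proof
    have "integrable ?M (\<lambda>p. indicator (S \<times> {0<..<T}) p *\<^sub>R (cmod (f p))\<^sup>2)"
      by (rule integrable_mult_indicator) (use Sm f(1) in \<open>auto simp: sq_int_def\<close>)
    then show "integrable ?M (\<lambda>p. indicator (S \<times> {0<..<T}) p * (cmod (f p))\<^sup>2)" by simp
  qed (rule fm)
  moreover have "schr_solution_at T u0 S f uT"
    unfolding schr_solution_at_def
  proof (intro conjI allI impI)
    show "L2 uT" by (rule assms(6))
    fix \<psi> :: "'a \<Rightarrow> complex" assume \<psi>: "schr_test \<psi>"
    have i: "integrable ?M (\<lambda>p. f p * cnj (observe S T \<psi> p))"
      by (rule sq_int_cauchy_schwarz(1)[OF f(1) observe_sq_int[OF assms(2) \<psi> assms(4)]])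
    \<comment> \<open>The time cutoff splits off as a scalar, so the space-time pairing becomes an
      integral over the restricted time measure, and the space cutoff moves onto
      \<open>f\<close>.\<close>
    have pt: "f (x, s) * cnj (observe S T \<psi> (x, s)) =
       indicator {0<..<T} s *\<^sub>R (indicator S x * f (x, s) * cnj (schr_free (s - T) \<psi> x))" for x s
      by (auto simp: observe_def indicator_def)
    have "l \<psi> = (\<integral>p. f p * cnj (observe S T \<psi> p) \<partial>?M)" using f(2) \<psi> by simp
    also have "\<dots> = integral\<^sup>L ?M (\<lambda>(x, s). f (x, s) * cnj (observe S T \<psi> (x, s)))"
      by (simp add: case_prod_unfold)
    also have "\<dots> = (\<integral>s. (\<integral>x. f (x, s) * cnj (observe S T \<psi> (x, s)) \<partial>lborel) \<partial>lborel)"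
      by (rule lborel_pair.integral_snd[of "\<lambda>x s. f (x, s) * cnj (observe S T \<psi> (x, s))", symmetric])
         (use i in \<open>simp add: case_prod_unfold\<close>)
    also have "\<dots> = (\<integral>s. indicator {0<..<T} s *\<^sub>R l2_inner (\<lambda>x. indicator S x * f (x, s)) (schr_free (s - T) \<psi>) \<partial>lborel)"
      unfolding pt l2_inner_def by (simp only: integral_scaleR_right)
    also have "\<dots> = (\<integral>s. l2_inner (\<lambda>x. indicator S x * f (x, s)) (schr_free (s - T) \<psi>) \<partial>(restrict_space lborel {0<..<T}))"
      by (rule integral_restrict_space[symmetric]) simp
    finally show "l2_inner uT \<psi> = l2_inner u0 (schr_free (- T) \<psi>) +
          (\<integral>s. l2_inner (\<lambda>x. indicator S x * f (x, s)) (schr_free (s - T) \<psi>) \<partial>(restrict_space lborel {0<..<T}))"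
      by (simp add: l_def algebra_simps)
  qed
  ultimately show ?thesis by blast
qed

end
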